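(* Fix $\eta=0.02$, $\beta_l=0.9$, $\beta_u=0.905$, $\omega=0.005$, $\alpha_c=0.85$, $\sigma=0.9025$, $\delta=\eta^2+2\eta$, $\gamma=\sqrt{\frac{(\eta+\sqrt{\nu})^2}{1-\delta}+\frac{\beta_u}{2}}$ and $\alpha_p=\frac{\omega\sqrt{1-\delta}}{\gamma}$. There is an absolute constant $C>0$ (independent of $\mathbb K$, $F$, $\nu$, $m$, $n$, $A$, $b$, $c$, of the initial point and of $\varepsilon$) such that the following holds. Let $z^{(0)}$ be an initial point of the form described in the context, and let $(z^{(k)})_{k\ge 0}$ be the iterates of the predictor--corrector algorithm described in the context, run from $z^{(0)}$ with predictor step length $\alpha_p=\frac{\omega\sqrt{1-\delta}}{\gamma}$, corrector step length $\alpha_c=0.85$ and centering parameter $\sigma=0.9025$. Then for every $\varepsilon\in(0,1)$, after a number $N\le\lceil C\sqrt{\nu}\,\log(1/\varepsilon)\rceil$ of iterations the algorithm reaches an iterate $z^{(N)}$ with $$\bar\mu^{(N)}\le\varepsilon\,\bar\mu^{(0)}\quad\text{and}\quad \|r(z^{(N)})\|\le\varepsilon\,\|r(z^{(0)})\|,$$ where $\bar\mu^{(k)}$ denotes the homogeneous complementarity measure of $z^{(k)}$; i.e. the algorithm terminates in $\mathcal O(\sqrt{\nu}\log(1/\varepsilon))$ iterations.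
   Context: Setting. $\mathbb K\subseteq\mathbb R^n$ ($n\ge1$) is a proper cone (closed, convex, pointed, with nonempty interior; in general not symmetric), $\mathbb K^*=\{s:\langle s,x\rangle\ge0\ \forall x\in\mathbb K\}$ is its dual cone, $A\in\mathbb R^{m\times n}$ has full row rank, $b\in\mathbb R^m$, $c\in\mathbb R^n$. $F:\operatorname{int}(\mathbb K)\to\mathbb R$ is a $\nu$-logarithmically homogeneous self-concordant barrier ($\nu$-LHSCB): $F$ is convex, $C^3$, satisfies $|D^3F(x)[h,h,h]|\le2(D^2F(x)[h,h])^{3/2}$ for all $x\in\operatorname{int}(\mathbb K)$, $h\in\mathbb R^n$, tends to $+\infty$ along every sequence in $\operatorname{int}(\mathbb K)$ converging to a boundary point, and $F(tx)=F(x)-\nu\log t$ for $t>0$. It is a known fact that $\nu\ge1$ and $\nabla^2F(x)\succ0$. Write $g_x=\nabla F(x)$, $H_x=\nabla^2F(x)$, $\|v\|_x^*=\langle v,H_x^{-1}v\rangle^{1/2}$; $\|\cdot\|$ is the Euclidean norm. Homogeneous self-dual embedding. Set $\bar x=(x;\tau)\in\bar{\mathbb K}=\mathbb K\times\mathbb R_+$, $\bar s=(s;\kappa)\in\bar{\mathbb K}^*=\mathbb K^*\times\mathbb R_+$, $\bar\nu=\nu+1$, $z=(\bar x;y;\bar s)\in\mathcal F=\bar{\mathbb K}\times\mathbb R^m\times\bar{\mathbb K}^*$, and $$G=\begin{pmatrix}0&A&-b\\ -A^\top&0&c\\ b^\top&-c^\top&0\end{pmatrix},\qquad r(z)=G(y;\bar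 x)-(0;\bar s).$$ Put $\mu=\langle x,s\rangle/\nu$ (cone complementarity measure), $\bar\mu=\langle\bar x,\bar s\rangle/\bar\nu=(\langle x,s\rangle+\tau\kappa)/(\nu+1)$ (homogeneous complementarity measure), $\psi(x,s,\mu)=s+\mu g_x$. The split neighborhood is $$\mathcal N(\eta,\beta_l,\beta_u)=\{z\in\operatorname{int}(\mathcal F):\ \|\psi(x,s,\mu)\|_x^*\le\eta\mu,\ \beta_l\mu\le\kappa\tau\le\beta_u\mu\}.$$ Initial point. Choose any $x^{(0)}\in\operatorname{int}(\mathbb K)$, any $y^{(0)}\in\mathbb R^m$, any $\beta_0\in[\beta_l,\beta_u]$, and set $s^{(0)}=-g_{x^{(0)}}$, $\tau^{(0)}=1$, $\kappa^{(0)}=\beta_0$, $z^{(0)}=((x^{(0)};\tau^{(0)});y^{(0)};(s^{(0)};\kappa^{(0)}))$ (this lies in $\mathcal N(\eta,\beta_l,\beta_u)$). Algorithm. One iteration from the current iterate $z=z^{(k)}$: Predictor: with $W=H_x+\frac{ss^\top}{\nu\mu^2}-\frac{g_xg_x^\top}{\nu}$, let $\Delta z_p=(\Delta\bar x_p;\Delta y_p;\Delta\bar s_p)$, $\Delta\bar x_p=(\Delta x_p;\Delta\tau_p)$, $\Delta\bar s_p=(\Delta s_p;\Delta\kappa_p)$, be the solution of $$G(\Delta y_p;\Delta\bar x_p)-(0;\Delta\bar s_p)=-r(z),\quad \tau\Delta\kappa_p+\kappa\Delta\tau_p=-\kappa\tau,\quad \Delta s_p+\mu W\Delta x_p=-s,$$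 and set $z^+=z+\alpha_p\Delta z_p$. Corrector: with $\mu^+=\langle x^+,s^+\rangle/\nu$ and $W^+=H_{x^+}+\frac{s^+(s^+)^\top}{\nu(\mu^+)^2}-\frac{g_{x^+}g_{x^+}^\top}{\nu}$, let $\Delta z_c=(\Delta\bar x_c;\Delta y_c;\Delta\bar s_c)$ be the solution of $$G(\Delta y_c;\Delta\bar x_c)-(0;\Delta\bar s_c)=0,\quad \tau^+\Delta\kappa_c+\kappa^+\Delta\tau_c=\sigma\mu^+-\kappa^+\tau^+,\quad \Delta s_c+\mu^+W^+\Delta x_c=-\psi(x^+,s^+,\mu^+),$$ and set $z^{(k+1)}=z^{++}=z^++\alpha_c\Delta z_c$. The algorithm stops once $\bar\mu^{(k)}\le\varepsilon\bar\mu^{(0)}$ and $\|r(z^{(k)})\|\le\varepsilon\|r(z^{(0)})\|$. *)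

theory Defs
  imports "HOL-Analysis.Analysis"
begin

text \<open>
  The constant in the complexity bound must not depend on the dimensions \<open>n\<close> and \<open>m\<close>, so these
  have to be quantified inside a formula and cannot be types. All coordinate spaces are therefore
  realised inside one inner product space, the finitely supported real sequences: \<open>Rn n\<close> is the
  subspace of the sequences supported on \<open>{0..<n}\<close>, with the Euclidean inner product and norm.
  Interiors, boundaries and derivatives are always taken relative to \<open>Rn n\<close>.
\<close>

typedef rseq = "{f :: nat \<Rightarrow> real. finite {i. f i \<noteq> 0}}"
  morphisms coord Abs_rseq
  by (rule exI[of _ "\<lambda>_. 0"]) simp

setup_lifting type_definition_rseq

lemma finite_support: "finite {i. coord v i \<noteq> 0}"
  using coord[of v] by simp

lemma rseq_eqI: "(\<And>i. coord u i = coord v i) \<Longrightarrow> u = v"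
  by (metis coord_inject ext)

instantiation rseq :: real_vector
begin

lift_definition zero_rseq :: rseq is "\<lambda>_. 0"
  by simp

lift_definition plus_rseq :: "rseq \<Rightarrow> rseq \<Rightarrow> rseq" is "\<lambda>f g i. f i + g i"
  subgoal for f g
    by (rule finite_subset[of _ "{i. f i \<noteq> 0} \<union> {i. g i \<noteq> 0}"]) auto
  done

lift_definition uminus_rseq :: "rseq \<Rightarrow> rseq" is "\<lambda>f i. - f i"
  by simp

lift_definition minus_rseq :: "rseq \<Rightarrow> rseq \<Rightarrow> rseq" is "\<lambda>f g i. f i - g i"
  subgoal for f g
    by (rule finite_subset[of _ "{i. f i \<noteq> 0} \<union> {i. g i \<noteq> 0}"]) auto
  done

lift_definition scaleR_rseq :: "real \<Rightarrow> rseq \<Rightarrow> rseq" is "\<lambda>r f i. r * f i"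
  subgoal for r f
    by (rule finite_subset[of _ "{i. f i \<noteq> 0}"]) auto
  done

instance
  by standard (transfer; simp add: fun_eq_iff algebra_simps)+

end

lemma coord_zero [simp]: "coord 0 i = 0"
  by transfer simp

lemma coord_add [simp]: "coord (u + v) i = coord u i + coord v i"
  by transfer simp

lemma coord_uminus [simp]: "coord (- u) i = - coord u i"
  by transfer simp

lemma coord_diff [simp]: "coord (u - v) i = coord u i - coord v i"
  by transfer simp

lemma coord_scaleR [simp]: "coord (r *\<^sub>R u) i = r * coord u i"
  by transfer simp

instantiation rseq :: real_inner
begin

definition inner_rseq :: "rseq \<Rightarrow> rseq \<Rightarrow> real" where
  "inner_rseq u v = (\<Sum>i | coord u i \<noteq> 0. coord u i * coord v i)"

definition norm_rseq :: "rseq \<Rightarrow> real" where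
  "norm_rseq u = sqrt (inner u u)"

definition dist_rseq :: "rseq \<Rightarrow> rseq \<Rightarrow> real" where
  "dist_rseq u v = norm (u - v)"

definition sgn_rseq :: "rseq \<Rightarrow> rseq" where
  "sgn_rseq u = u /\<^sub>R norm u"

definition uniformity_rseq :: "(rseq \<times> rseq) filter" where
  "uniformity_rseq = (INF e\<in>{0<..}. principal {(x, y). dist x y < e})"

definition open_rseq :: "rseq set \<Rightarrow> bool" where
  "open_rseq U \<longleftrightarrow> (\<forall>x\<in>U. eventually (\<lambda>(x', y). x' = x \<longrightarrow> y \<in> U) uniformity)"

lemma inner_rseq_superset:
  assumes "finite S" "{i. coord u i \<noteq> 0} \<subseteq> S"
  shows "inner u v = (\<Sum>i\<in>S. coord u i * coord v i)"
  unfolding inner_rseq_def by (rule sum.mono_neutral_left) (use assms in auto)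

instance
proof
  fix x y z :: rseq and r :: real
  let ?X = "{i. coord x i \<noteq> 0}" and ?Y = "{i. coord y i \<noteq> 0}" and ?Z = "{i. coord z i \<noteq> 0}"
  let ?S = "?X \<union> ?Y \<union> ?Z"
  have S: "finite ?S"
    by (simp add: finite_support)
  have exp: "inner u v = (\<Sum>i\<in>?S. coord u i * coord v i)" if "{i. coord u i \<noteq> 0} \<subseteq> ?S" for u v
    by (rule inner_rseq_superset[OF S that])
  show "dist x y = norm (x - y)" by (rule dist_rseq_def)
  show "sgn x = x /\<^sub>R norm x" by (rule sgn_rseq_def)
  show "(uniformity :: (rseq \<times> rseq) filter) = (INF e\<in>{0<..}. principal {(x, y). dist x y < e})"
    by (rule uniformity_rseq_def)
  show "open U = (\<forall>x\<in>U. \<forall>\<^sub>F (x', y) in uniformity. x' = x \<longrightarrow> y \<in> U)" for U :: "rseq set"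
    by (rule open_rseq_def)
  show "inner x y = inner y x"
    by (subst (1 2) exp) (auto simp: mult.commute)
  show "inner (x + y) z = inner x z + inner y z"
    by (subst (1 2 3) exp) (auto simp: algebra_simps sum.distrib)
  show "inner (r *\<^sub>R x) y = r * inner x y"
    by (subst (1 2) exp) (auto simp: algebra_simps sum_distrib_left)
  show "0 \<le> inner x x"
    by (simp add: inner_rseq_def sum_nonneg)
  have "inner x x = 0 \<longleftrightarrow> (\<forall>i\<in>?X. coord x i * coord x i = 0)"
    unfolding inner_rseq_def by (rule sum_nonneg_eq_0_iff) (simp_all add: finite_support)
  also have "\<dots> \<longleftrightarrow> x = 0"
    by (auto intro: rseq_eqI)
  finally show "inner x x = 0 \<longleftrightarrow> x = 0" .
  show "norm x = sqrt (inner x x)" by (rule norm_rseq_def)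
qed

end

definition Rn :: "nat \<Rightarrow> rseq set" where
  "Rn n = {v. \<forall>i\<ge>n. coord v i = 0}"

lemma inner_Rn: "u \<in> Rn n \<Longrightarrow> u \<bullet> v = (\<Sum>i<n. coord u i * coord v i)"
  by (rule inner_rseq_superset) (auto simp: Rn_def not_less[symmetric])

lift_definition vec_of :: "nat \<Rightarrow> (nat \<Rightarrow> real) \<Rightarrow> rseq" is "\<lambda>n f i. if i < n then f i else 0"
  subgoal for n f
    by (rule finite_subset[of _ "{..<n}"]) auto
  done

lemma coord_vec_of [simp]: "coord (vec_of n f) i = (if i < n then f i else 0)"
  by transfer simp


section \<open>Matrices\<close>

text \<open>A matrix in \<open>\<real>\<^sup>m\<^sup>\<times>\<^sup>n\<close> is given by its entries \<open>A i j\<close> with \<open>i < m\<close> and \<open>j < n\<close>; other entries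
  are never used.\<close>

definition mat_mult :: "nat \<Rightarrow> nat \<Rightarrow> (nat \<Rightarrow> nat \<Rightarrow> real) \<Rightarrow> rseq \<Rightarrow> rseq" where
  "mat_mult m n A x = vec_of m (\<lambda>i. \<Sum>j<n. A i j * coord x j)"

definition mat_tmult :: "nat \<Rightarrow> nat \<Rightarrow> (nat \<Rightarrow> nat \<Rightarrow> real) \<Rightarrow> rseq \<Rightarrow> rseq" where
  "mat_tmult m n A y = vec_of n (\<lambda>j. \<Sum>i<m. A i j * coord y i)"

definition full_row_rank :: "nat \<Rightarrow> nat \<Rightarrow> (nat \<Rightarrow> nat \<Rightarrow> real) \<Rightarrow> bool" where
  "full_row_rank m n A \<longleftrightarrow>
     inj_on (\<lambda>i. vec_of n (A i)) {..<m} \<and> independent ((\<lambda>i. vec_of n (A i)) ` {..<m})"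


section \<open>Proper cones and logarithmically homogeneous self-concordant barriers\<close>

definition int_Rn :: "nat \<Rightarrow> rseq set \<Rightarrow> rseq set" where
  "int_Rn n K = top_of_set (Rn n) interior_of K"

definition bd_Rn :: "nat \<Rightarrow> rseq set \<Rightarrow> rseq set" where
  "bd_Rn n K = top_of_set (Rn n) frontier_of K"

definition proper_cone :: "nat \<Rightarrow> rseq set \<Rightarrow> bool" where
  "proper_cone n K \<longleftrightarrow>
     K \<subseteq> Rn n \<and> cone K \<and> closed K \<and> convex K \<and> (\<forall>x. x \<in> K \<and> - x \<in> K \<longrightarrow> x = 0) \<and> int_Rn n K \<noteq> {}"

text \<open>Below, \<open>U\<close> is a relatively open subset of \<open>Rn n\<close>. The derivative within \<open>U\<close> at a point of \<open>U\<close>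
  is then uniquely determined in the directions \<open>h \<in> Rn n\<close> (and only in these).\<close>

definition dderiv ::
  "'a::real_normed_vector set \<Rightarrow> 'a \<Rightarrow> ('a \<Rightarrow> 'b::real_normed_vector) \<Rightarrow> 'a \<Rightarrow> 'b" where
  "dderiv U h f x = frechet_derivative f (at x within U) h"

primrec Ck_on :: "nat \<Rightarrow> nat \<Rightarrow> rseq set \<Rightarrow> (rseq \<Rightarrow> real) \<Rightarrow> bool" where
  "Ck_on n 0 U f \<longleftrightarrow> continuous_on U f"
| "Ck_on n (Suc k) U f \<longleftrightarrow> f differentiable_on U \<and> (\<forall>h\<in>Rn n. Ck_on n k U (dderiv U h f))"

definition LHSCB :: "nat \<Rightarrow> rseq set \<Rightarrow> real \<Rightarrow> (rseq \<Rightarrow> real) \<Rightarrow> bool" where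
  "LHSCB n K \<nu> F \<longleftrightarrow> (let U = int_Rn n K in
     convex_on U F \<and>
     Ck_on n 3 U F \<and>
     (\<forall>x\<in>U. \<forall>h\<in>Rn n.
        \<bar>dderiv U h (dderiv U h (dderiv U h F)) x\<bar> \<le> 2 * dderiv U h (dderiv U h F) x powr (3/2)) \<and>
     (\<forall>X x. (\<forall>k. X k \<in> U) \<and> X \<longlonglongrightarrow> x \<and> x \<in> bd_Rn n K \<longrightarrow>
        filterlim (\<lambda>k. F (X k)) at_top sequentially) \<and>
     (\<forall>x\<in>U. \<forall>t>0. F (t *\<^sub>R x) = F x - \<nu> * ln t))"

definition grad :: "nat \<Rightarrow> rseq set \<Rightarrow> (rseq \<Rightarrow> real) \<Rightarrow> rseq \<Rightarrow> rseq" where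
  "grad n U F x = (THE g. g \<in> Rn n \<and> (\<forall>h\<in>Rn n. g \<bullet> h = dderiv U h F x))"

definition hess :: "nat \<Rightarrow> rseq set \<Rightarrow> (rseq \<Rightarrow> real) \<Rightarrow> rseq \<Rightarrow> rseq \<Rightarrow> rseq" where
  "hess n U F x v =
     (THE w. w \<in> Rn n \<and> (\<forall>h\<in>Rn n. w \<bullet> h = dderiv U h (dderiv U v F) x))"


section \<open>The homogeneous self-dual embedding\<close>

text \<open>A point \<open>z = ((x, \<tau>), y, (s, \<kappa>))\<close>. Its norm, and the norm of the residual below, is the
  Euclidean norm, by the library's definition of the norm on products.\<close>

type_synonym point = "(rseq \<times> real) \<times> rseq \<times> (rseq \<times> real)"

definition hsd_G :: "nat \<Rightarrow> nat \<Rightarrow> (nat \<Rightarrow> nat \<Rightarrow> real) \<Rightarrow> rseq \<Rightarrow> rseq \<Rightarrow>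
    rseq \<times> rseq \<times> real \<Rightarrow> rseq \<times> rseq \<times> real" where
  "hsd_G m n A b c = (\<lambda>(y, x, \<tau>).
     (mat_mult m n A x - \<tau> *\<^sub>R b, - mat_tmult m n A y + \<tau> *\<^sub>R c, b \<bullet> y - c \<bullet> x))"

definition residual :: "nat \<Rightarrow> nat \<Rightarrow> (nat \<Rightarrow> nat \<Rightarrow> real) \<Rightarrow> rseq \<Rightarrow> rseq \<Rightarrow>
    point \<Rightarrow> rseq \<times> rseq \<times> real" where
  "residual m n A b c = (\<lambda>((x, \<tau>), y, (s, \<kappa>)). hsd_G m n A b c (y, x, \<tau>) - (0, s, \<kappa>))"

definition mu :: "real \<Rightarrow> rseq \<Rightarrow> rseq \<Rightarrow> real" where
  "mu \<nu> x s = x \<bullet> s / \<nu>"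

definition mu_bar :: "real \<Rightarrow> point \<Rightarrow> real" where
  "mu_bar \<nu> = (\<lambda>((x, \<tau>), y, (s, \<kappa>)). (x \<bullet> s + \<tau> * \<kappa>) / (\<nu> + 1))"

definition \<psi> :: "nat \<Rightarrow> rseq set \<Rightarrow> (rseq \<Rightarrow> real) \<Rightarrow> rseq \<Rightarrow> rseq \<Rightarrow> real \<Rightarrow> rseq" where
  "\<psi> n U F x s \<mu> = s + \<mu> *\<^sub>R grad n U F x"


section \<open>The predictor--corrector algorithm\<close>

definition scaling :: "nat \<Rightarrow> rseq set \<Rightarrow> real \<Rightarrow> (rseq \<Rightarrow> real) \<Rightarrow> rseq \<Rightarrow> rseq \<Rightarrow> rseq \<Rightarrow> rseq" where
  "scaling n U \<nu> F x s v = (let g = grad n U F x in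
     hess n U F x v + ((s \<bullet> v) / (\<nu> * (mu \<nu> x s)\<^sup>2)) *\<^sub>R s - ((g \<bullet> v) / \<nu>) *\<^sub>R g)"

text \<open>The system shared by predictor and corrector, with right-hand sides \<open>\<rho>\<close>, \<open>\<theta>\<close>, \<open>\<xi>\<close>; the
  first argument of the inner function is the current point, the second one the direction.\<close>

definition newton_system ::
  "nat \<Rightarrow> nat \<Rightarrow> rseq set \<Rightarrow> real \<Rightarrow> (rseq \<Rightarrow> real) \<Rightarrow> (nat \<Rightarrow> nat \<Rightarrow> real) \<Rightarrow> rseq \<Rightarrow> rseq \<Rightarrow>
     rseq \<times> rseq \<times> real \<Rightarrow> real \<Rightarrow> rseq \<Rightarrow> point \<Rightarrow> point \<Rightarrow> bool" where
  "newton_system m n U \<nu> F A b c \<rho> \<theta> \<xi> =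
     (\<lambda>((x, \<tau>), y, (s, \<kappa>)) ((dx, d\<tau>), dy, (ds, d\<kappa>)).
        dx \<in> Rn n \<and> dy \<in> Rn m \<and> ds \<in> Rn n \<and>
        hsd_G m n A b c (dy, dx, d\<tau>) - (0, ds, d\<kappa>) = \<rho> \<and>
        \<tau> * d\<kappa> + \<kappa> * d\<tau> = \<theta> \<and>
        ds + mu \<nu> x s *\<^sub>R scaling n U \<nu> F x s dx = \<xi>)"

definition predictor_dir ::
  "nat \<Rightarrow> nat \<Rightarrow> rseq set \<Rightarrow> real \<Rightarrow> (rseq \<Rightarrow> real) \<Rightarrow> (nat \<Rightarrow> nat \<Rightarrow> real) \<Rightarrow> rseq \<Rightarrow> rseq \<Rightarrow>
     point \<Rightarrow> point" where
  "predictor_dir m n U \<nu> F A b c = (\<lambda>((x, \<tau>), y, (s, \<kappa>)).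
     THE \<Delta>. newton_system m n U \<nu> F A b c
       (- residual m n A b c ((x, \<tau>), y, (s, \<kappa>))) (- (\<kappa> * \<tau>)) (- s) ((x, \<tau>), y, (s, \<kappa>)) \<Delta>)"

definition corrector_dir ::
  "nat \<Rightarrow> nat \<Rightarrow> rseq set \<Rightarrow> real \<Rightarrow> (rseq \<Rightarrow> real) \<Rightarrow> (nat \<Rightarrow> nat \<Rightarrow> real) \<Rightarrow> rseq \<Rightarrow> rseq \<Rightarrow>
     real \<Rightarrow> point \<Rightarrow> point" where
  "corrector_dir m n U \<nu> F A b c \<sigma> = (\<lambda>((x, \<tau>), y, (s, \<kappa>)).
     THE \<Delta>. newton_system m n U \<nu> F A b c
       0 (\<sigma> * mu \<nu> x s - \<kappa> * \<tau>) (- \<psi> n U F x s (mu \<nu> x s)) ((x, \<tau>), y, (s, \<kappa>)) \<Delta>)"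

definition pc_step ::
  "nat \<Rightarrow> nat \<Rightarrow> rseq set \<Rightarrow> real \<Rightarrow> (rseq \<Rightarrow> real) \<Rightarrow> (nat \<Rightarrow> nat \<Rightarrow> real) \<Rightarrow> rseq \<Rightarrow> rseq \<Rightarrow>
     real \<Rightarrow> real \<Rightarrow> real \<Rightarrow> point \<Rightarrow> point" where
  "pc_step m n U \<nu> F A b c \<alpha>p \<alpha>c \<sigma> z =
     (let z' = z + \<alpha>p *\<^sub>R predictor_dir m n U \<nu> F A b c z
      in z' + \<alpha>c *\<^sub>R corrector_dir m n U \<nu> F A b c \<sigma> z')"

definition pc_iterate ::
  "nat \<Rightarrow> nat \<Rightarrow> rseq set \<Rightarrow> real \<Rightarrow> (rseq \<Rightarrow> real) \<Rightarrow> (nat \<Rightarrow> nat \<Rightarrow> real) \<Rightarrow> rseq \<Rightarrow> rseq \<Rightarrow>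
     real \<Rightarrow> real \<Rightarrow> real \<Rightarrow> point \<Rightarrow> nat \<Rightarrow> point" where
  "pc_iterate m n U \<nu> F A b c \<alpha>p \<alpha>c \<sigma> z0 k = (pc_step m n U \<nu> F A b c \<alpha>p \<alpha>c \<sigma> ^^ k) z0"

definition initial_point ::
  "nat \<Rightarrow> rseq set \<Rightarrow> (rseq \<Rightarrow> real) \<Rightarrow> rseq \<Rightarrow> rseq \<Rightarrow> real \<Rightarrow> point" where
  "initial_point n U F x0 y0 \<beta>0 = ((x0, 1), y0, (- grad n U F x0, \<beta>0))"

end

theory Submission
  imports Defs
begin

text \<open>
  Self-concordance makes the Hessian norms at nearby points comparable and the gradient close to its
  linearisation, so that near the central path the scaling \<open>W\<close> differs from the Hessian by at most
  \<open>\<delta>\<close> in relative norm. The embedding is skew-symmetric, hence the complementarity products of a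
  direction sum to zero. For the predictor this bounds \<open>\<langle>\<Delta>x, W \<Delta>x\<rangle>\<close> by \<open>\<nu> + \<kappa>\<tau> / (2\<mu>)\<close>, which is what
  \<open>\<alpha>\<^sub>p\<close> is tuned to: the predictor moves by at most \<open>\<omega>\<close> in the local norm and only slightly enlarges the
  neighbourhood, while shrinking the residual and \<open>\<mu>\<close>-bar by exactly \<open>1 - \<alpha>\<^sub>p\<close>. The corrector damps the
  distance to the central path by about \<open>1 - \<alpha>\<^sub>c\<close>, which restores the original neighbourhood, preserves the residual
  and increases \<open>\<mu>\<close>-bar by much less than the predictor gained. Each iteration thus gains a factor
  \<open>1 - c / sqrt \<nu>\<close>.

  Dual norms are never computed through inverse Hessians; a bound on \<open>\<parallel>s\<parallel>\<^sub>x\<^sup>*\<close> is expressed by testing \<open>s\<close>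
  against all directions.
\<close>

section \<open>Directional derivatives on relatively open sets\<close>

text \<open>Since \<open>- s = - P + \<mu> * g x\<close> with \<open>P\<close> the centrality error,
  both Newton equations have the right-hand side \<open>- P + l * \<mu> * g x\<close>, with
  \<open>l = 1\<close> for the predictor and \<open>l = 0\<close> for the corrector. One estimate of
  the new centrality error therefore serves both. The iterates are defined through definite
  descriptions, so nothing is known about a step before its Newton system is shown to be uniquely
  solvable. Nearness to the central path makes \<open>W\<close> positive definite there, which is
  why both half-steps must carry it as an invariant. Neither \<open>\<nu> \<ge> 1\<close> nor
  definiteness of the Hessian is part of \<open>LHSCB\<close>. The former comes from
  self-concordance along \<open>x\<close> itself, the latter from the Dikin ellipsoid and
  pointedness of the cone. The triple \<open>21/1000\<close>, \<open>8999/10000\<close>,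
  \<open>9051/10000\<close> describes the neighbourhood between predictor and corrector: wide enough
  for the predictor to stay in, narrow enough for the corrector to return from, even with the crude
  bounds on third derivatives. In units of \<open>1 / sqrt \<nu>\<close> the predictor gains
  \<open>39/10000\<close> and the corrector loses less than \<open>12/10000\<close>. The net rate
  \<open>27/10000\<close> makes \<open>C = 400\<close> sufficient.\<close>

lemma subspace_Rn: "subspace (Rn n)"
  by (simp add: subspace_def Rn_def)

lemmas Rn_intros [simp, intro] =
  subspace_0[OF subspace_Rn] subspace_add[OF subspace_Rn] subspace_diff[OF subspace_Rn]
  subspace_scale[OF subspace_Rn] subspace_neg[OF subspace_Rn]

lemma vec_of_in_Rn [simp]: "vec_of n f \<in> Rn n"
  by (simp add: Rn_def)

locale rel_open =
  fixes n :: nat and U :: "rseq set"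
  assumes openU: "openin (top_of_set (Rn n)) U"
begin

lemma U_subset: "x \<in> U \<Longrightarrow> x \<in> Rn n"
  using openin_imp_subset[OF openU] by auto

lemma open_line:
  assumes "x \<in> Rn n" "h \<in> Rn n"
  shows "open {t. x + t *\<^sub>R h \<in> U}"
proof -
  obtain T where T: "open T" "U = Rn n \<inter> T"
    using openU by (auto simp: openin_open)
  have "{t. x + t *\<^sub>R h \<in> U} = (\<lambda>t. x + t *\<^sub>R h) -` T"
    using assms T by auto
  moreover have "open ((\<lambda>t. x + t *\<^sub>R h) -` T)"
    by (rule open_vimage[OF T(1)]) (intro continuous_intros)
  ultimately show ?thesis by simp
qed

lemma ball_in_U:
  assumes "x \<in> U"
  obtains e where "e > 0" "\<And>y. y \<in> Rn n \<Longrightarrow> dist y x < e \<Longrightarrow> y \<in> U"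
  using openU assms by (auto simp: openin_euclidean_subtopology_iff)

lemma dderiv_line_within:
  assumes "f differentiable_on U" "t \<in> T" "\<And>t. t \<in> T \<Longrightarrow> x + t *\<^sub>R h \<in> U"
  shows "((\<lambda>t. f (x + t *\<^sub>R h)) has_real_derivative dderiv U h f (x + t *\<^sub>R h)) (at t within T)"
proof -
  let ?D = "frechet_derivative f (at (x + t *\<^sub>R h) within U)"
  have D: "(f has_derivative ?D) (at (x + t *\<^sub>R h) within U)"
    using assms by (auto simp: differentiable_on_def frechet_derivative_works)
  have "((\<lambda>t. f (x + t *\<^sub>R h)) has_derivative (\<lambda>s. ?D (s *\<^sub>R h))) (at t within T)"
  proof (rule has_derivative_in_compose[where g = f and g' = "?D"])
    show "((\<lambda>t. x + t *\<^sub>R h) has_derivative (\<lambda>s. s *\<^sub>R h)) (at t within T)"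
      by (auto intro!: derivative_eq_intros)
    show "(f has_derivative ?D) (at (x + t *\<^sub>R h) within (\<lambda>t. x + t *\<^sub>R h) ` T)"
      by (rule has_derivative_subset[OF D]) (use assms in auto)
  qed
  moreover have "?D (s *\<^sub>R h) = dderiv U h f (x + t *\<^sub>R h) * s" for s
    using linear_scale[OF has_derivative_linear[OF D], of s h] by (simp add: dderiv_def)
  ultimately show ?thesis
    by (simp add: has_field_derivative_def)
qed

lemma dderiv_line:
  assumes "f differentiable_on U" "x + t *\<^sub>R h \<in> U" "x \<in> Rn n" "h \<in> Rn n"
  shows "((\<lambda>t. f (x + t *\<^sub>R h)) has_real_derivative dderiv U h f (x + t *\<^sub>R h)) (at t)"
proof -
  have "((\<lambda>t. f (x + t *\<^sub>R h)) has_real_derivative dderiv U h f (x + t *\<^sub>R h))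
        (at t within {t. x + t *\<^sub>R h \<in> U})"
    by (rule dderiv_line_within) (use assms in auto)
  then show ?thesis
    using at_within_open[OF _ open_line[OF assms(3,4)], of t] assms(2) by simp
qed

text \<open>Once differentiability is known, a derivative can be read off from one line. Logarithmic
  homogeneity enters in this way, since it describes \<open>F\<close> along explicit lines
  only.\<close>

lemma dderiv_eqI:
  fixes f :: "rseq \<Rightarrow> real"
  assumes "f differentiable_on U" "x \<in> U" "h \<in> Rn n"
    and "((\<lambda>t. f (x + t *\<^sub>R h)) has_real_derivative d) (at 0)"
  shows "dderiv U h f x = d"
  using dderiv_line[OF assms(1), of x 0 h] assms DERIV_unique U_subset by fastforce

lemma dderiv_add_dir:
  assumes "f differentiable_on U" "x \<in> U"
  shows "dderiv U (h + k) f x = dderiv U h f x + dderiv U k f x"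
proof -
  have "linear (frechet_derivative f (at x within U))"
    using assms by (simp add: differentiable_on_def linear_frechet_derivative)
  then show ?thesis
    by (simp add: dderiv_def linear_add)
qed

lemma dderiv_scale_dir:
  assumes "f differentiable_on U" "x \<in> U"
  shows "dderiv U (r *\<^sub>R h) f x = r * dderiv U h f x"
proof -
  have "linear (frechet_derivative f (at x within U))"
    using assms by (simp add: differentiable_on_def linear_frechet_derivative)
  then show ?thesis
    by (simp add: dderiv_def linear_scale)
qed

lemma eventually_line_in_U:
  assumes "x \<in> U" "h \<in> Rn n"
  shows "\<forall>\<^sub>F t in nhds 0. x + t *\<^sub>R h \<in> U"
proof -
  have "0 \<in> {t. x + t *\<^sub>R h \<in> U}" using assms by simp
  with open_line[OF U_subset[OF assms(1)] assms(2)] show ?thesis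
    by (metis (mono_tags, lifting) eventually_nhds mem_Collect_eq)
qed

lemma dderiv_cong:
  fixes f g :: "rseq \<Rightarrow> real"
  assumes "f differentiable_on U" "g differentiable_on U" "x \<in> U" "h \<in> Rn n"
    and "\<And>y. y \<in> U \<Longrightarrow> f y = g y"
  shows "dderiv U h f x = dderiv U h g x"
proof (rule dderiv_eqI[OF assms(1,3,4)])
  have ev: "\<forall>\<^sub>F t in nhds 0. f (x + t *\<^sub>R h) = g (x + t *\<^sub>R h)"
    by (rule eventually_mono[OF eventually_line_in_U[OF assms(3,4)]]) (use assms in auto)
  show "((\<lambda>t. f (x + t *\<^sub>R h)) has_real_derivative dderiv U h g x) (at 0)"
    using dderiv_line[OF assms(2), of x 0 h] assms U_subset DERIV_cong_ev[OF refl ev refl] by simp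
qed

text \<open>The mean value theorem in direction \<open>h\<close>, applied to the difference of
  \<open>f\<close> between two parallel segments, followed by the mean value theorem in direction
  \<open>v\<close>.\<close>

lemma second_difference:
  assumes f: "f differentiable_on U" "dderiv U h f differentiable_on U"
    and hv: "h \<in> Rn n" "v \<in> Rn n" and x: "x \<in> U" and s: "s > 0"
    and sq: "\<And>a b. 0 \<le> a \<Longrightarrow> a \<le> s \<Longrightarrow> 0 \<le> b \<Longrightarrow> b \<le> s \<Longrightarrow> x + a *\<^sub>R h + b *\<^sub>R v \<in> U"
  shows "\<exists>a b. 0 \<le> a \<and> a \<le> s \<and> 0 \<le> b \<and> b \<le> s \<and>
     f (x + s *\<^sub>R h + s *\<^sub>R v) - f (x + s *\<^sub>R h) - f (x + s *\<^sub>R v) + f x =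
       s\<^sup>2 * dderiv U v (dderiv U h f) (x + a *\<^sub>R h + b *\<^sub>R v)"
proof -
  have R: "x \<in> Rn n" using U_subset x by auto
  have "\<exists>a>0. a < s \<and> (f ((x + s *\<^sub>R v) + s *\<^sub>R h) - f (x + s *\<^sub>R h)) -
       (f ((x + s *\<^sub>R v) + 0 *\<^sub>R h) - f (x + 0 *\<^sub>R h))
     = (s - 0) * (dderiv U h f ((x + s *\<^sub>R v) + a *\<^sub>R h) - dderiv U h f (x + a *\<^sub>R h))"
  proof (rule MVT2[OF s])
    fix a assume a: "0 \<le> a" "a \<le> s"
    show "((\<lambda>a. f ((x + s *\<^sub>R v) + a *\<^sub>R h) - f (x + a *\<^sub>R h)) has_real_derivative
       dderiv U h f ((x + s *\<^sub>R v) + a *\<^sub>R h) - dderiv U h f (x + a *\<^sub>R h)) (at a)"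
      by (intro DERIV_diff dderiv_line f)
        (use sq[OF a, of s] sq[OF a, of 0] s R hv in \<open>auto simp: algebra_simps\<close>)
  qed
  then obtain a where a: "0 < a" "a < s" and
    e1: "f ((x + s *\<^sub>R v) + s *\<^sub>R h) - f (x + s *\<^sub>R h) - (f (x + s *\<^sub>R v) - f x)
     = s * (dderiv U h f ((x + a *\<^sub>R h) + s *\<^sub>R v) - dderiv U h f ((x + a *\<^sub>R h) + 0 *\<^sub>R v))"
    by (auto simp: algebra_simps)
  have "\<exists>b>0. b < s \<and> dderiv U h f ((x + a *\<^sub>R h) + s *\<^sub>R v) - dderiv U h f ((x + a *\<^sub>R h) + 0 *\<^sub>R v)
     = (s - 0) * dderiv U v (dderiv U h f) ((x + a *\<^sub>R h) + b *\<^sub>R v)"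
    by (rule MVT2[OF s], rule dderiv_line) (use f sq a R hv in auto)
  then obtain b where b: "0 < b" "b < s" and
    "dderiv U h f ((x + a *\<^sub>R h) + s *\<^sub>R v) - dderiv U h f ((x + a *\<^sub>R h) + 0 *\<^sub>R v)
     = s * dderiv U v (dderiv U h f) ((x + a *\<^sub>R h) + b *\<^sub>R v)" by auto
  with e1 a b show ?thesis
    by (intro exI[of _ a] exI[of _ b]) (simp add: algebra_simps power2_eq_square)
qed

text \<open>The second difference over a small parallelogram is symmetric in \<open>h\<close> and
  \<open>v\<close>, so the two mixed derivatives agree at a pair of points near \<open>x\<close>.
  Continuity then excludes a gap between them at \<open>x\<close>.\<close>

lemma schwarz:
  fixes f :: "rseq \<Rightarrow> real"
  assumes f: "f differentiable_on U" "dderiv U h f differentiable_on U" "dderiv U v f differentiable_on U"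
    and cont: "continuous_on U (dderiv U v (dderiv U h f))" "continuous_on U (dderiv U h (dderiv U v f))"
    and hv: "h \<in> Rn n" "v \<in> Rn n" and x: "x \<in> U"
  shows "dderiv U v (dderiv U h f) x = dderiv U h (dderiv U v f) x" (is "?P x = ?Q x")
proof (rule ccontr)
  assume ne: "?P x \<noteq> ?Q x"
  define e where "e = \<bar>?P x - ?Q x\<bar> / 2"
  have e: "e > 0" using ne by (simp add: e_def)
  obtain d1 where d1: "d1 > 0" "\<And>y. y \<in> U \<Longrightarrow> dist y x < d1 \<Longrightarrow> dist (?P y) (?P x) < e"
    using cont(1) x e unfolding continuous_on_iff by meson
  obtain d2 where d2: "d2 > 0" "\<And>y. y \<in> U \<Longrightarrow> dist y x < d2 \<Longrightarrow> dist (?Q y) (?Q x) < e"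
    using cont(2) x e unfolding continuous_on_iff by meson
  obtain d3 where d3: "d3 > 0" "\<And>y. y \<in> Rn n \<Longrightarrow> dist y x < d3 \<Longrightarrow> y \<in> U"
    using ball_in_U[OF x] by auto
  define d where "d = min d1 (min d2 d3)"
  define c where "c = norm h + norm v + 1"
  \<comment> \<open>\<open>c\<close> bounds \<open>norm h + norm v\<close>, with \<open>+ 1\<close>
    keeping it positive, so the whole parallelogram lies within \<open>d / 2\<close> of
    \<open>x\<close>.\<close>
  define s where "s = d / (2 * c)"
  have npos: "c > 0" unfolding c_def by (smt (verit) norm_ge_zero)
  have d: "d > 0" using d1 d2 d3 by (simp add: d_def)
  then have s: "s > 0" using npos by (simp add: s_def)
  have near: "dist (x + a *\<^sub>R h + b *\<^sub>R v) x < d" if "0 \<le> a" "a \<le> s" "0 \<le> b" "b \<le> s" for a b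
  proof -
    have "dist (x + a *\<^sub>R h + b *\<^sub>R v) x = norm (a *\<^sub>R h + b *\<^sub>R v)"
      by (simp add: dist_norm algebra_simps)
    also have "\<dots> \<le> a * norm h + b * norm v"
      using norm_triangle_ineq[of "a *\<^sub>R h" "b *\<^sub>R v"] that by simp
    also have "\<dots> \<le> s * norm h + s * norm v"
      using that by (intro add_mono mult_right_mono) auto
    also have "\<dots> \<le> s * c"
      using s by (simp add: c_def algebra_simps)
    also have "\<dots> = d / 2" using npos by (simp add: s_def)
    also have "\<dots> < d" using d by simp
    finally show ?thesis .
  qed
  have sq: "x + a *\<^sub>R h + b *\<^sub>R v \<in> U" if "0 \<le> a" "a \<le> s" "0 \<le> b" "b \<le> s" for a b
    using near[OF that] d3 U_subset[OF x] hv by (auto simp: d_def)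
  obtain a b where ab: "0 \<le> a" "a \<le> s" "0 \<le> b" "b \<le> s" and
    1: "f (x + s *\<^sub>R h + s *\<^sub>R v) - f (x + s *\<^sub>R h) - f (x + s *\<^sub>R v) + f x =
       s\<^sup>2 * ?P (x + a *\<^sub>R h + b *\<^sub>R v)"
    using second_difference[OF f(1,2) hv x s sq] by auto
  have "x + a *\<^sub>R v + b *\<^sub>R h \<in> U" if "0 \<le> a" "a \<le> s" "0 \<le> b" "b \<le> s" for a b
    using sq[of b a] that by (simp add: algebra_simps)
  from second_difference[OF f(1,3) hv(2,1) x s this]
  obtain a' b' where ab': "0 \<le> a'" "a' \<le> s" "0 \<le> b'" "b' \<le> s" and
    2: "f (x + s *\<^sub>R h + s *\<^sub>R v) - f (x + s *\<^sub>R h) - f (x + s *\<^sub>R v) + f x =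
       s\<^sup>2 * ?Q (x + b' *\<^sub>R h + a' *\<^sub>R v)"
    by (auto simp: algebra_simps)
  have "?P (x + a *\<^sub>R h + b *\<^sub>R v) = ?Q (x + b' *\<^sub>R h + a' *\<^sub>R v)"
    using 1 2 s by simp
  moreover have "dist (?P (x + a *\<^sub>R h + b *\<^sub>R v)) (?P x) < e"
    using d1(2)[OF sq[OF ab]] near[OF ab] by (simp add: d_def)
  moreover have "dist (?Q (x + b' *\<^sub>R h + a' *\<^sub>R v)) (?Q x) < e"
    using d2(2)[OF sq] near[of b' a'] ab' by (simp add: d_def)
  ultimately show False
    unfolding dist_real_def e_def by (simp add: abs_if field_simps split: if_splits)
qed

end

section \<open>One-dimensional differential inequalities\<close>

text \<open>The discriminant argument. The forms are only known to be semidefinite, so a vanishing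
  leading coefficient has to be treated as well.\<close>

lemma quadratic_form_Cauchy_Schwarz:
  fixes a b c :: real
  assumes "\<And>t. a + 2 * t * b + t\<^sup>2 * c \<ge> 0"
  shows "b\<^sup>2 \<le> a * c"
proof (cases "c = 0")
  case True
  have "b = 0"
  proof (rule ccontr)
    assume "b \<noteq> 0"
    \<comment> \<open>At this \<open>t\<close> the affine function takes the value
      \<open>-1\<close>.\<close>
    then show False
      using assms[of "- (a + 1) / (2 * b)"] True by (simp add: field_simps)
  qed
  then show ?thesis using True by simp
next
  case False
  have "c > 0"
  proof (rule ccontr)
    assume "\<not> c > 0"
    with False have c: "c < 0" by simp
    define t where "t = (\<bar>a\<bar> + 2 * \<bar>b\<bar> + 1) / (- c) + 1"
    have "t \<ge> 1" using c by (simp add: t_def field_simps)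
    have "- c * t \<ge> \<bar>a\<bar> + 2 * \<bar>b\<bar> + 1" using c by (simp add: t_def field_simps)
    then have "- c * t * t \<ge> (\<bar>a\<bar> + 2 * \<bar>b\<bar> + 1) * t" using \<open>t \<ge> 1\<close> by (intro mult_right_mono) auto
    then have "- (c * (t * t)) \<ge> \<bar>a\<bar> * t + 2 * (\<bar>b\<bar> * t) + t" by (simp add: algebra_simps)
    moreover have "\<bar>a\<bar> * t \<ge> \<bar>a\<bar>" using \<open>t \<ge> 1\<close> by (simp add: mult_le_cancel_left1)
    moreover have "b * t \<le> \<bar>b\<bar> * t" using \<open>t \<ge> 1\<close> by (intro mult_right_mono) auto
    moreover have "a + 2 * (b * t) + c * (t * t) \<ge> 0"
      using assms[of t] by (simp add: power2_eq_square algebra_simps)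
    ultimately show False using \<open>t \<ge> 1\<close> abs_ge_self[of a] by linarith
  qed
  then show ?thesis
    using assms[of "- b / c"] by (simp add: field_simps power2_eq_square)
qed

text \<open>Adding the tangent inequalities at two points makes \<open>f'\<close> monotone near
  \<open>0\<close>; no regularity of the second derivative enters.\<close>

lemma convex_second_deriv_nonneg:
  fixes f :: "real \<Rightarrow> real"
  assumes "convex_on {-e<..<e} f" "e > 0"
    and d1: "\<And>t. t \<in> {-e<..<e} \<Longrightarrow> (f has_real_derivative f' t) (at t)"
    and d2: "(f' has_real_derivative d) (at 0)"
  shows "d \<ge> 0"
proof (rule mono_on_imp_deriv_nonneg[OF _ d2])
  let ?A = "{-e<..<e}"
  have tangent: "f y - f x \<ge> f' x * (y - x)" if "x \<in> ?A" "y \<in> ?A" for x y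
    by (rule convex_on_imp_above_tangent[OF assms(1)])
      (use that d1[of x] in \<open>auto simp: interior_open intro: has_field_derivative_at_within\<close>)
  show "mono_on ?A f'"
  proof (rule mono_onI)
    fix r s assume rs: "r \<in> ?A" "s \<in> ?A" "r \<le> s"
    have "(f' s - f' r) * (s - r) \<ge> 0"
      using tangent[of r s] tangent[of s r] rs by (simp add: algebra_simps)
    then show "f' r \<le> f' s"
      using rs by (cases "r = s") (auto simp: zero_le_mult_iff)
  qed
  show "0 \<in> interior ?A" using \<open>e > 0\<close> by (simp add: interior_open)
qed

text \<open>With \<open>e = r\<^sup>2 - p 0\<close>, the function \<open>1 / sqrt (p + e)\<close> has slope at least \<open>-1\<close>.\<close>

lemma self_concordant_growth:
  fixes p p' :: "real \<Rightarrow> real"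
  assumes T: "0 \<le> T" "T < 1 / r" and r: "sqrt (p 0) < r"
    and nn: "\<And>t. 0 \<le> t \<Longrightarrow> t \<le> T \<Longrightarrow> p t \<ge> 0"
    and d: "\<And>t. 0 \<le> t \<Longrightarrow> t \<le> T \<Longrightarrow> (p has_real_derivative p' t) (at t)"
    and sc: "\<And>t. 0 \<le> t \<Longrightarrow> t \<le> T \<Longrightarrow> \<bar>p' t\<bar> \<le> 2 * p t powr (3/2)"
  shows "sqrt (p T) \<le> r / (1 - r * T)"
proof -
  have p0: "p 0 \<ge> 0" using nn T by simp
  then have rpos: "r > 0" using r real_sqrt_ge_zero[of "p 0"] by linarith
  \<comment> \<open>The shift keeps the base of the power positive where \<open>p\<close> vanishes,
    and makes the initial value of the power exactly \<open>1 / r\<close>.\<close>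
  define e where "e = r\<^sup>2 - p 0"
  have e: "e > 0"
    using r p0 rpos by (simp add: e_def real_less_rsqrt real_sqrt_less_iff real_less_lsqrt sqrt_le_D)
      (metis real_sqrt_less_iff real_sqrt_pow2_iff real_sqrt_power abs_of_pos real_sqrt_abs)
  define u where "u t = (p t + e) powr (-1/2) + t" for t
  have "u 0 \<le> u T"
  proof (rule DERIV_nonneg_imp_nondecreasing[OF T(1)])
    fix t assume t: "0 \<le> t" "t \<le> T"
    have pos: "p t + e > 0" using nn[OF t] e by simp
    have 1: "(u has_real_derivative (-1/2) * (p t + e) powr (-1/2 - 1) * p' t + 1) (at t)"
      unfolding u_def using pos d[OF t] by (auto intro!: derivative_eq_intros simp: powr_diff)
    have "p' t \<le> 2 * p t powr (3/2)" using sc[OF t] by simp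
    also have "\<dots> \<le> 2 * (p t + e) powr (3/2)"
      using nn[OF t] e by (simp add: powr_mono2)
    finally have "(p t + e) powr (-3/2) * p' t \<le> (p t + e) powr (-3/2) * (2 * (p t + e) powr (3/2))"
      by (intro mult_left_mono) auto
    also have "\<dots> = 2" using pos by (simp add: powr_minus field_simps)
    finally show "\<exists>y. (u has_real_derivative y) (at t) \<and> 0 \<le> y"
      using 1 by (intro exI[of _ "(-1/2) * (p t + e) powr (-1/2 - 1) * p' t + 1"]) auto
  qed
  moreover have "(p 0 + e) powr (-1/2) = 1 / r"
    using rpos by (simp add: e_def powr_minus powr_half_sqrt field_simps)
  ultimately have 2: "1 / r - T \<le> (p T + e) powr (-1/2)" by (simp add: u_def)
  have pT: "p T + e > 0" using nn[of T] T e by simp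
  have "1 / r - T > 0" using T by simp
  then have "1 / (p T + e) powr (-1/2) \<le> 1 / (1 / r - T)" using 2 pT by (intro divide_left_mono mult_pos_pos) auto
  then have "sqrt (p T + e) \<le> 1 / (1 / r - T)"
    using pT by (simp add: powr_minus powr_half_sqrt field_simps)
  moreover have "sqrt (p T) \<le> sqrt (p T + e)" using e by simp
  moreover have "1 / (1 / r - T) = r / (1 - r * T)" using rpos by (simp add: field_simps)
  ultimately show ?thesis by linarith
qed

text \<open>Gronwall with integrating factors: \<open>exp (c * t) * q t\<close> is nondecreasing and
  \<open>exp (- c * t) * q t\<close> is nonincreasing.\<close>

lemma exp_growth_bounds:
  fixes q q' :: "real \<Rightarrow> real"
  assumes T: "0 \<le> T"
    and d: "\<And>t. 0 \<le> t \<Longrightarrow> t \<le> T \<Longrightarrow> (q has_real_derivative q' t) (at t)"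
    and b: "\<And>t. 0 \<le> t \<Longrightarrow> t \<le> T \<Longrightarrow> \<bar>q' t\<bar> \<le> c * q t"
  shows "exp (- c * T) * q 0 \<le> q T" "q T \<le> exp (c * T) * q 0"
proof -
  have "(exp (c * 0) * q 0) \<le> exp (c * T) * q T"
  proof (rule DERIV_nonneg_imp_nondecreasing[OF T])
    fix t assume t: "0 \<le> t" "t \<le> T"
    have "((\<lambda>t. exp (c * t) * q t) has_real_derivative exp (c * t) * (q' t + c * q t)) (at t)"
      using d[OF t] by (auto intro!: derivative_eq_intros simp: algebra_simps)
    moreover have "exp (c * t) * (q' t + c * q t) \<ge> 0" using b[OF t] by (intro mult_nonneg_nonneg) auto
    ultimately show "\<exists>y. ((\<lambda>t. exp (c * t) * q t) has_real_derivative y) (at t) \<and> 0 \<le> y" by blast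
  qed
  then show "exp (- c * T) * q 0 \<le> q T" by (simp add: exp_minus field_simps)
  have "- (exp (- c * 0) * q 0) \<le> - (exp (- c * T) * q T)"
  proof (rule DERIV_nonneg_imp_nondecreasing[OF T])
    fix t assume t: "0 \<le> t" "t \<le> T"
    have "((\<lambda>t. - (exp (- c * t) * q t)) has_real_derivative exp (- c * t) * (c * q t - q' t)) (at t)"
      using d[OF t] by (auto intro!: derivative_eq_intros simp: algebra_simps)
    moreover have "exp (- c * t) * (c * q t - q' t) \<ge> 0" using b[OF t] by (intro mult_nonneg_nonneg) auto
    ultimately show "\<exists>y. ((\<lambda>t. - (exp (- c * t) * q t)) has_real_derivative y) (at t) \<and> 0 \<le> y" by blast
  qed
  then show "q T \<le> exp (c * T) * q 0" by (simp add: exp_minus field_simps)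
qed

section \<open>Self-concordant barriers\<close>

lemma DERIV_eventually_cong:
  assumes "\<forall>\<^sub>F t in nhds a. f t = g t" "(g has_real_derivative d) (at a)"
  shows "(f has_real_derivative d) (at a)"
  using DERIV_cong_ev[OF refl assms(1) refl] assms(2) by simp

lemma Rn_basis_expansion:
  assumes "h \<in> Rn n"
  shows "h = (\<Sum>i<n. coord h i *\<^sub>R vec_of n (\<lambda>j. if j = i then 1 else 0))"
proof (rule rseq_eqI)
  fix j
  have c: "coord (sum g I) j = (\<Sum>i\<in>I. coord (g i) j)" if "finite I" for g :: "nat \<Rightarrow> rseq" and I
    using that by induction auto
  have "coord (\<Sum>i<n. coord h i *\<^sub>R vec_of n (\<lambda>j. if j = i then 1 else 0)) j
      = (\<Sum>i<n. if i = j then coord h i else 0)"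
    unfolding c[OF finite_lessThan] by (rule sum.cong) auto
  also have "\<dots> = coord h j" using assms by (auto simp: Rn_def)
  finally show "coord h j = coord (\<Sum>i<n. coord h i *\<^sub>R vec_of n (\<lambda>j. if j = i then 1 else 0)) j" by simp
qed

lemma Rn_eqI:
  assumes "u \<in> Rn n" "v \<in> Rn n" "\<And>h. h \<in> Rn n \<Longrightarrow> u \<bullet> h = v \<bullet> h"
  shows "u = v"
proof -
  have "(u - v) \<bullet> (u - v) = 0" using assms by (simp add: inner_diff_left)
  then show ?thesis by simp
qed

text \<open>This justifies the definite descriptions in \<open>grad\<close> and \<open>hess\<close>.
  Linearity is asked for on \<open>Rn n\<close> only, because derivatives are determined only in
  those directions.\<close>

lemma Riesz_Rn:
  assumes add: "\<And>u v. u \<in> Rn n \<Longrightarrow> v \<in> Rn n \<Longrightarrow> L (u + v) = L u + L v"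
    and scale: "\<And>r v. v \<in> Rn n \<Longrightarrow> L (r *\<^sub>R v) = r * L v"
  shows "\<exists>!w. w \<in> Rn n \<and> (\<forall>h\<in>Rn n. w \<bullet> h = L h)"
proof -
  let ?e = "\<lambda>i. vec_of n (\<lambda>j. if j = i then 1 else 0)"
  define w where "w = vec_of n (\<lambda>i. L (?e i))"
  have L0: "L 0 = 0" using scale[of 0 0] by simp
  have Lsum: "L (\<Sum>i\<in>I. coord h i *\<^sub>R ?e i) = (\<Sum>i\<in>I. coord h i * L (?e i))" if "finite I" for h I
    using that
  proof induction
    case (insert i I)
    have "(\<Sum>i\<in>I. coord h i *\<^sub>R ?e i) \<in> Rn n" by (intro subspace_sum[OF subspace_Rn]) auto
    then show ?case using insert by (simp add: add scale)
  qed (simp add: L0)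
  have "w \<bullet> h = L h" if "h \<in> Rn n" for h
  proof -
    have "L h = (\<Sum>i<n. coord h i * L (?e i))"
      using Lsum[OF finite_lessThan, of h n] Rn_basis_expansion[OF that] by simp
    also have "\<dots> = w \<bullet> h"
      using inner_Rn[of w n h] by (simp add: w_def mult.commute)
    finally show ?thesis by simp
  qed
  moreover have "w \<in> Rn n" by (simp add: w_def)
  ultimately show ?thesis by (metis Rn_eqI)
qed

locale lhscb =
  fixes n :: nat and K :: "rseq set" and \<nu> :: real and F :: "rseq \<Rightarrow> real"
  assumes n: "n \<ge> 1" and K: "proper_cone n K" and F: "LHSCB n K \<nu> F"
begin

abbreviation "U \<equiv> int_Rn n K"

sublocale rel_open n U
  by unfold_locales (simp add: int_Rn_def)

section \<open>Second and third derivatives as symmetric multilinear forms\<close>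

abbreviation "D1 h \<equiv> dderiv U h F"
abbreviation "D2 h v \<equiv> dderiv U h (dderiv U v F)"
abbreviation "D3 h v w \<equiv> dderiv U h (dderiv U v (dderiv U w F))"

lemma smooth: "Ck_on n 3 U F"
  using F by (simp add: LHSCB_def Let_def)

lemma F_diff: "F differentiable_on U"
  using smooth by (simp add: numeral_3_eq_3)

lemma D1_diff: "h \<in> Rn n \<Longrightarrow> D1 h differentiable_on U"
  using smooth by (simp add: numeral_3_eq_3)

lemma D2_diff: "h \<in> Rn n \<Longrightarrow> v \<in> Rn n \<Longrightarrow> D2 h v differentiable_on U"
  using smooth by (simp add: numeral_3_eq_3)

lemma D3_cont: "h \<in> Rn n \<Longrightarrow> v \<in> Rn n \<Longrightarrow> w \<in> Rn n \<Longrightarrow> continuous_on U (D3 h v w)"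
  using smooth by (simp add: numeral_3_eq_3)

lemma D2_sym:
  assumes "h \<in> Rn n" "v \<in> Rn n" "x \<in> U"
  shows "D2 h v x = D2 v h x"
  by (rule schwarz)
    (use assms in \<open>auto intro!: F_diff D1_diff differentiable_imp_continuous_on D2_diff\<close>)

lemma D3_sym12:
  assumes "h \<in> Rn n" "v \<in> Rn n" "w \<in> Rn n" "x \<in> U"
  shows "D3 h v w x = D3 v h w x"
  by (rule schwarz) (use assms in \<open>auto intro!: D1_diff D2_diff D3_cont\<close>)

text \<open>Symmetry of the second derivative holds on all of \<open>U\<close>, so it may be
  differentiated. Together with \<open>D3_sym12\<close> this generates all permutations of the three
  directions.\<close>

lemma D3_sym23:
  assumes "h \<in> Rn n" "v \<in> Rn n" "w \<in> Rn n" "x \<in> U"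
  shows "D3 h v w x = D3 h w v x"
  by (rule dderiv_cong) (use assms in \<open>auto intro!: D2_diff D2_sym\<close>)

lemma D2_add:
  assumes "h \<in> Rn n" "v \<in> Rn n" "w \<in> Rn n" "x \<in> U"
  shows "D2 (h + v) w x = D2 h w x + D2 v w x" "D2 w (h + v) x = D2 w h x + D2 w v x"
  using assms dderiv_add_dir[OF D1_diff] D2_sym[of w "h + v"] D2_sym[of w h] D2_sym[of w v] by simp_all

lemma D2_scale:
  assumes "h \<in> Rn n" "w \<in> Rn n" "x \<in> U"
  shows "D2 (r *\<^sub>R h) w x = r * D2 h w x" "D2 w (r *\<^sub>R h) x = r * D2 w h x"
  using assms dderiv_scale_dir[OF D1_diff] D2_sym[of w "r *\<^sub>R h"] D2_sym[of w h] by simp_all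

lemma D3_add:
  assumes "h \<in> Rn n" "v \<in> Rn n" "w \<in> Rn n" "k \<in> Rn n" "x \<in> U"
  shows "D3 (h + v) w k x = D3 h w k x + D3 v w k x"
    "D3 w (h + v) k x = D3 w h k x + D3 w v k x"
    "D3 w k (h + v) x = D3 w k h x + D3 w k v x"
proof -
  have 1: "D3 (h + v) w k x = D3 h w k x + D3 v w k x" if "w \<in> Rn n" "k \<in> Rn n" for w k
    using assms dderiv_add_dir[OF D2_diff] that by simp
  have 2: "D3 w (h + v) k x = D3 w h k x + D3 w v k x" if "w \<in> Rn n" "k \<in> Rn n" for w k
    using assms that 1[of w k] by (simp add: D3_sym12[of w])
  show "D3 (h + v) w k x = D3 h w k x + D3 v w k x" "D3 w (h + v) k x = D3 w h k x + D3 w v k x"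
    "D3 w k (h + v) x = D3 w k h x + D3 w k v x"
    using assms 1[of w k] 2[of w k] by (simp_all add: D3_sym23[of w k])
qed

lemma D3_scale:
  assumes "h \<in> Rn n" "w \<in> Rn n" "k \<in> Rn n" "x \<in> U"
  shows "D3 (r *\<^sub>R h) w k x = r * D3 h w k x"
    "D3 w (r *\<^sub>R h) k x = r * D3 w h k x"
    "D3 w k (r *\<^sub>R h) x = r * D3 w k h x"
proof -
  have 1: "D3 (r *\<^sub>R h) w k x = r * D3 h w k x" if "w \<in> Rn n" "k \<in> Rn n" for w k
    using assms dderiv_scale_dir[OF D2_diff] that by simp
  have 2: "D3 w (r *\<^sub>R h) k x = r * D3 w h k x" if "w \<in> Rn n" "k \<in> Rn n" for w k
    using assms that 1[of w k] by (simp add: D3_sym12[of w])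
  show "D3 (r *\<^sub>R h) w k x = r * D3 h w k x" "D3 w (r *\<^sub>R h) k x = r * D3 w h k x"
    "D3 w k (r *\<^sub>R h) x = r * D3 w k h x"
    using assms 1[of w k] 2[of w k] by (simp_all add: D3_sym23[of w k])
qed

section \<open>Convexity and the local norm\<close>

lemma D2_nonneg:
  assumes "x \<in> U" "h \<in> Rn n"
  shows "D2 h h x \<ge> 0"
proof -
  have "open {t. x + t *\<^sub>R h \<in> U}" "0 \<in> {t. x + t *\<^sub>R h \<in> U}"
    using open_line[OF U_subset] assms by auto
  then obtain e where "e > 0" "\<And>t. dist t 0 < e \<Longrightarrow> t \<in> {t. x + t *\<^sub>R h \<in> U}"
    unfolding open_dist by blast
  then have e: "e > 0" "\<And>t. \<bar>t\<bar> < e \<Longrightarrow> x + t *\<^sub>R h \<in> U" by (simp_all add: dist_real_def)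
  have Fconv: "convex_on U F" using F by (simp add: LHSCB_def Let_def)
  have "convex_on {-e<..<e} (\<lambda>t. F (x + t *\<^sub>R h))"
  proof (rule convex_onI)
    fix t r s :: real assume t: "0 < t" "t < 1" and rs: "r \<in> {-e<..<e}" "s \<in> {-e<..<e}"
    have "x + ((1 - t) *\<^sub>R r + t *\<^sub>R s) *\<^sub>R h = (1 - t) *\<^sub>R (x + r *\<^sub>R h) + t *\<^sub>R (x + s *\<^sub>R h)"
      by (simp add: algebra_simps)
    then show "F (x + ((1 - t) *\<^sub>R r + t *\<^sub>R s) *\<^sub>R h)
        \<le> (1 - t) * F (x + r *\<^sub>R h) + t * F (x + s *\<^sub>R h)"
      using convex_onD[OF Fconv, of t "x + r *\<^sub>R h" "x + s *\<^sub>R h"] t rs e(2)[of r] e(2)[of s]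
      by (simp add: abs_if)
  qed simp
  then show ?thesis
  proof (rule convex_second_deriv_nonneg[OF _ e(1)])
    show "((\<lambda>t. F (x + t *\<^sub>R h)) has_real_derivative D1 h (x + t *\<^sub>R h)) (at t)"
      if "t \<in> {-e<..<e}" for t
      using that e(2)[of t] by (intro dderiv_line F_diff U_subset assms) auto
    show "((\<lambda>t. D1 h (x + t *\<^sub>R h)) has_real_derivative D2 h h x) (at 0)"
      using dderiv_line[OF D1_diff, of h x 0 h] assms U_subset by simp
  qed
qed

text \<open>The local norm of \<open>h\<close> at \<open>x\<close>. It is only known to be a
  seminorm until \<open>N_eq_0\<close>.\<close>

definition N :: "rseq \<Rightarrow> rseq \<Rightarrow> real" where
  "N x h = sqrt (D2 h h x)"

lemma N_nonneg [simp]: "x \<in> U \<Longrightarrow> h \<in> Rn n \<Longrightarrow> N x h \<ge> 0"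
  by (simp add: N_def D2_nonneg)

lemma N_sq: "x \<in> U \<Longrightarrow> h \<in> Rn n \<Longrightarrow> (N x h)\<^sup>2 = D2 h h x"
  by (simp add: N_def D2_nonneg)

lemma N_scale: "x \<in> U \<Longrightarrow> h \<in> Rn n \<Longrightarrow> N x (r *\<^sub>R h) = \<bar>r\<bar> * N x h"
  by (simp add: N_def D2_scale real_sqrt_mult flip: mult.assoc power2_eq_square)

lemma N_zero [simp]: "x \<in> U \<Longrightarrow> N x 0 = 0"
  using N_scale[of x 0 0] by simp

lemma D2_Cauchy_Schwarz:
  assumes "x \<in> U" "h \<in> Rn n" "v \<in> Rn n"
  shows "\<bar>D2 h v x\<bar> \<le> N x h * N x v"
proof -
  have "(D2 h v x)\<^sup>2 \<le> D2 h h x * D2 v v x"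
  proof (rule quadratic_form_Cauchy_Schwarz)
    fix t
    have "D2 (h + t *\<^sub>R v) (h + t *\<^sub>R v) x \<ge> 0" using assms by (intro D2_nonneg) auto
    also have "D2 (h + t *\<^sub>R v) (h + t *\<^sub>R v) x = D2 h h x + 2 * t * D2 h v x + t\<^sup>2 * D2 v v x"
      using assms D2_sym[of v h x] by (simp add: D2_add D2_scale power2_eq_square algebra_simps)
    finally show "D2 h h x + 2 * t * D2 h v x + t\<^sup>2 * D2 v v x \<ge> 0" .
  qed
  then have "sqrt ((D2 h v x)\<^sup>2) \<le> sqrt (D2 h h x * D2 v v x)" by (rule real_sqrt_le_mono)
  then show ?thesis by (simp add: N_def real_sqrt_mult)
qed

lemma N_triangle:
  assumes "x \<in> U" "h \<in> Rn n" "v \<in> Rn n"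
  shows "N x (h + v) \<le> N x h + N x v"
proof (rule power2_le_imp_le)
  have "(N x (h + v))\<^sup>2 = (N x h)\<^sup>2 + 2 * D2 h v x + (N x v)\<^sup>2"
    using assms D2_sym[of v h x] N_sq[of x "h + v"] by (simp add: N_sq D2_add)
  then show "(N x (h + v))\<^sup>2 \<le> (N x h + N x v)\<^sup>2"
    using D2_Cauchy_Schwarz[OF assms] by (simp add: power2_eq_square algebra_simps abs_le_iff)
qed (use assms in simp)

lemma self_concordant:
  assumes "x \<in> U" "h \<in> Rn n"
  shows "\<bar>D3 h h h x\<bar> \<le> 2 * D2 h h x powr (3/2)"
  using F assms by (simp add: LHSCB_def Let_def)

lemma D3_diag_le:
  assumes "x \<in> U" "h \<in> Rn n" "N x h \<le> c"
  shows "\<bar>D3 h h h x\<bar> \<le> 2 * c ^ 3"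
proof -
  have "D2 h h x powr (3/2) = (N x h) ^ 3"
  proof (cases "D2 h h x = 0")
    case False
    then have pos: "D2 h h x > 0" using D2_nonneg[OF assms(1,2)] by simp
    have "D2 h h x powr (3/2) = (D2 h h x powr (1/2)) powr 3" by (simp add: powr_powr)
    also have "\<dots> = N x h powr 3" using pos by (simp add: N_def powr_half_sqrt)
    also have "\<dots> = N x h ^ 3" using pos by (simp add: N_def flip: powr_numeral)
    finally show ?thesis .
  qed (simp add: N_def)
  also have "\<dots> \<le> c ^ 3" using assms by (intro power_mono) auto
  finally show ?thesis using self_concordant[OF assms(1,2)] by simp
qed

text \<open>The growth inequality for the second derivative along the line. The strict bound
  \<open>r\<close> keeps \<open>1 / r\<close> meaningful when the local norm of \<open>h\<close> is
  zero.\<close>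

lemma N_line_growth:
  assumes x: "x \<in> U" "h \<in> Rn n" and r: "N x h < r" and T: "0 \<le> T" "T < 1 / r"
    and seg: "\<And>t. 0 \<le> t \<Longrightarrow> t \<le> T \<Longrightarrow> x + t *\<^sub>R h \<in> U"
  shows "N (x + T *\<^sub>R h) h \<le> r / (1 - r * T)"
  unfolding N_def
proof (rule self_concordant_growth[OF T, where p' = "\<lambda>t. D3 h h h (x + t *\<^sub>R h)"])
  fix t assume t: "0 \<le> t" "t \<le> T"
  show "0 \<le> D2 h h (x + t *\<^sub>R h)" using D2_nonneg seg t x by blast
  show "\<bar>D3 h h h (x + t *\<^sub>R h)\<bar> \<le> 2 * D2 h h (x + t *\<^sub>R h) powr (3/2)"
    using self_concordant seg t x by blast
  show "((\<lambda>t. D2 h h (x + t *\<^sub>R h)) has_real_derivative D3 h h h (x + t *\<^sub>R h)) (at t)"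
    by (rule dderiv_line) (use D2_diff seg t x U_subset in auto)
qed (use r in \<open>simp add: N_def\<close>)

section \<open>The Dikin ellipsoid and nondegeneracy of the Hessian\<close>

lemma U_subset_K: "U \<subseteq> K"
  by (simp add: int_Rn_def interior_of_subset)

lemma K_subset_Rn: "K \<subseteq> Rn n"
  using K by (simp add: proper_cone_def)

lemma barrier:
  "(\<And>k. X k \<in> U) \<Longrightarrow> X \<longlonglongrightarrow> x \<Longrightarrow> x \<in> bd_Rn n K \<Longrightarrow> filterlim (\<lambda>k. F (X k)) at_top sequentially"
  using F unfolding LHSCB_def Let_def by blast

lemma bdI: "x \<in> K \<Longrightarrow> x \<notin> U \<Longrightarrow> x \<in> bd_Rn n K"
  using closure_of_subset[of K "top_of_set (Rn n)"] K_subset_Rn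
  by (auto simp: bd_Rn_def int_Rn_def frontier_of_def)

text \<open>Let \<open>T\<close> be the first time at which the segment leaves \<open>U\<close>. The
  second derivative along the segment stays bounded before \<open>T\<close>, hence so do the first
  derivative and \<open>F\<close>. But the exit point lies on the boundary of \<open>K\<close>,
  where the barrier property forces \<open>F\<close> to infinity.\<close>

lemma Dikin:
  assumes x: "x \<in> U" "h \<in> Rn n" and r: "N x h < 1" and t: "0 \<le> t" "t \<le> 1"
  shows "x + t *\<^sub>R h \<in> U"
proof (rule ccontr)
  assume out: "x + t *\<^sub>R h \<notin> U"
  let ?S = "{t. x + t *\<^sub>R h \<notin> U} \<inter> {0..1}"
  define T where "T = Inf ?S"
  have cl: "closed ?S"
    using open_line[OF U_subset[OF x(1)] x(2)]
    by (intro closed_Int closed_atLeastAtMost) (simp add: closed_def Compl_eq)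
  have ne: "?S \<noteq> {}" using out t by auto
  have bdd: "bdd_below ?S" by (rule bdd_belowI[of _ 0]) auto
  have TS: "T \<in> ?S" unfolding T_def by (rule closed_contains_Inf[OF ne bdd cl])
  then have T: "0 \<le> T" "T \<le> 1" "x + T *\<^sub>R h \<notin> U" by auto
  then have Tpos: "T > 0" using x by (cases "T = 0") auto
  have inU: "x + s *\<^sub>R h \<in> U" if "0 \<le> s" "s < T" for s
  proof (rule ccontr)
    assume "x + s *\<^sub>R h \<notin> U"
    then have "T \<le> s" unfolding T_def using that T by (intro cInf_lower bdd) auto
    then show False using that by simp
  qed
  obtain r where r: "N x h < r" "r < 1" using r dense by blast
  have rpos: "r > 0" using r N_nonneg[OF x] by linarith
  define M where "M = (r / (1 - r))\<^sup>2"
  have M: "D2 h h (x + s *\<^sub>R h) \<le> M" if s: "0 \<le> s" "s < T" for s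
  proof -
    have "r * s \<le> r" using s T rpos by (simp add: mult_le_cancel_left1)
    then have "r / (1 - r * s) \<le> r / (1 - r)"
      using r rpos by (intro divide_left_mono mult_pos_pos) linarith+
    moreover have "s < 1 / r"
    proof -
      have "1 < 1 / r" using r rpos by simp
      then show ?thesis using s T by linarith
    qed
    then have "N (x + s *\<^sub>R h) h \<le> r / (1 - r * s)"
      using N_line_growth[OF x r(1), of s] s inU by auto
    ultimately have "N (x + s *\<^sub>R h) h \<le> r / (1 - r)" by simp
    then have "(N (x + s *\<^sub>R h) h)\<^sup>2 \<le> M"
      unfolding M_def using inU s x by (intro power_mono) auto
    then show ?thesis using N_sq inU s x by simp
  qed
  have M0: "M \<ge> 0" by (simp add: M_def)
  have d1: "((\<lambda>t. F (x + t *\<^sub>R h)) has_real_derivative D1 h (x + s *\<^sub>R h)) (at s)" if "0 \<le> s" "s < T" for s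
    by (intro dderiv_line F_diff U_subset x inU that)
  have d2: "((\<lambda>t. D1 h (x + t *\<^sub>R h)) has_real_derivative D2 h h (x + s *\<^sub>R h)) (at s)" if "0 \<le> s" "s < T" for s
    by (intro dderiv_line D1_diff U_subset x inU that)
  have b1: "D1 h (x + s *\<^sub>R h) \<le> \<bar>D1 h x\<bar> + M" if s: "0 \<le> s" "s < T" for s
  proof (cases "s = 0")
    case False
    then have "\<exists>z>0. z < s \<and> D1 h (x + s *\<^sub>R h) - D1 h (x + 0 *\<^sub>R h) = (s - 0) * D2 h h (x + z *\<^sub>R h)"
      using s by (intro MVT2) (auto intro!: d2)
    then obtain z where z: "0 < z" "z < s" "D1 h (x + s *\<^sub>R h) - D1 h x = s * D2 h h (x + z *\<^sub>R h)" by auto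
    have "s * D2 h h (x + z *\<^sub>R h) \<le> 1 * M"
      using M[of z] z s T M0 D2_nonneg[OF inU x(2), of z] by (intro mult_mono) auto
    then show ?thesis using z by simp
  qed (use M0 in simp)
  have b0: "F (x + s *\<^sub>R h) \<le> F x + \<bar>D1 h x\<bar> + M" if s: "0 \<le> s" "s < T" for s
  proof (cases "s = 0")
    case False
    then have "\<exists>z>0. z < s \<and> F (x + s *\<^sub>R h) - F (x + 0 *\<^sub>R h) = (s - 0) * D1 h (x + z *\<^sub>R h)"
      using s by (intro MVT2) (auto intro!: d1)
    then obtain z where z: "0 < z" "z < s" "F (x + s *\<^sub>R h) - F x = s * D1 h (x + z *\<^sub>R h)" by auto
    have "s * D1 h (x + z *\<^sub>R h) \<le> s * (\<bar>D1 h x\<bar> + M)"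
      using b1[of z] z s by (intro mult_left_mono) auto
    also have "\<dots> \<le> 1 * (\<bar>D1 h x\<bar> + M)" using s T M0 by (intro mult_right_mono) auto
    finally show ?thesis using z by simp
  qed (use M0 in simp)
  \<comment> \<open>These points approach the exit point from inside; the factor is below
    \<open>1\<close> for every \<open>k\<close>, and \<open>k = 0\<close> gives \<open>x\<close>
    itself.\<close>
  define X where "X k = x + (T * (1 - inverse (real (Suc k)))) *\<^sub>R h" for k :: nat
  have s: "0 \<le> T * (1 - inverse (real (Suc k))) \<and> T * (1 - inverse (real (Suc k))) < T" for k
    using Tpos by (simp add: field_simps)
  then have XU: "X k \<in> U" for k unfolding X_def using inU by auto
  have lim: "X \<longlonglongrightarrow> x + (T * (1 - 0)) *\<^sub>R h"
    unfolding X_def by (intro tendsto_intros LIMSEQ_inverse_real_of_nat)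
  have "closed K" using K by (simp add: proper_cone_def)
  then have "x + T *\<^sub>R h \<in> K"
    using closed_sequentially[of K X] XU U_subset_K lim by auto
  then have "x + T *\<^sub>R h \<in> bd_Rn n K" using T bdI by simp
  then have "filterlim (\<lambda>k. F (X k)) at_top sequentially"
    using XU lim by (intro barrier) auto
  then have "\<forall>\<^sub>F k in sequentially. F (X k) \<ge> F x + \<bar>D1 h x\<bar> + M + 1"
    by (simp add: filterlim_at_top)
  then obtain k where "F (X k) \<ge> F x + \<bar>D1 h x\<bar> + M + 1"
    by (auto simp: eventually_sequentially)
  moreover have "F (X k) \<le> F x + \<bar>D1 h x\<bar> + M" unfolding X_def using b0 s by blast
  ultimately show False by simp
qed

text \<open>Every multiple of \<open>h\<close> has local norm zero, so by \<open>Dikin\<close> the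
  whole line through \<open>x\<close> lies in \<open>K\<close>. Then \<open>h\<close> and
  \<open>- h\<close> are recession directions of the closed cone and belong to it, which pointedness
  allows only for \<open>h = 0\<close>.\<close>

lemma N_eq_0:
  assumes x: "x \<in> U" "h \<in> Rn n" and "N x h = 0"
  shows "h = 0"
proof -
  have line: "x + t *\<^sub>R h \<in> K" for t
    using Dikin[of x "t *\<^sub>R h" 1] assms N_scale[of x h t] U_subset_K by auto
  have "k \<in> K" if k: "\<And>t. x + t *\<^sub>R k \<in> K" for k
  proof -
    have cone: "cone K" and cl: "closed K" using K by (auto simp: proper_cone_def)
    \<comment> \<open>Points of the ray from \<open>x\<close> in direction \<open>k\<close>, scaled
      back by the cone property so that they converge to \<open>k\<close>.\<close>
    define X where "X i = inverse (real (Suc i)) *\<^sub>R x + k" for i :: nat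
    have "X i = inverse (real (Suc i)) *\<^sub>R (x + real (Suc i) *\<^sub>R k)" for i
      by (simp add: X_def scaleR_right_distrib del: of_nat_Suc)
    then have "X i \<in> K" for i using cone k[of "real (Suc i)"] unfolding cone_def
      by (metis inverse_nonnegative_iff_nonnegative of_nat_0_le_iff)
    moreover have "X \<longlonglongrightarrow> 0 *\<^sub>R x + k"
      unfolding X_def by (intro tendsto_intros LIMSEQ_inverse_real_of_nat)
    ultimately show ?thesis using closed_sequentially[OF cl, of X] by simp
  qed
  from this[of h] this[of "- h"] have "h \<in> K" "- h \<in> K"
    using line line[of "- t" for t] by (auto simp del: scaleR_minus_left simp flip: scaleR_minus_left)
  then show ?thesis using K by (auto simp: proper_cone_def)
qed

lemma N_pos: "x \<in> U \<Longrightarrow> h \<in> Rn n \<Longrightarrow> h \<noteq> 0 \<Longrightarrow> N x h > 0"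
  by (metis N_eq_0 N_nonneg less_le)

section \<open>Consequences of logarithmic homogeneity\<close>

lemma F_scale: "x \<in> U \<Longrightarrow> t > 0 \<Longrightarrow> F (t *\<^sub>R x) = F x - \<nu> * ln t"
  using F by (simp add: LHSCB_def Let_def)

text \<open>Dilation by \<open>1 + t\<close> maps the line through \<open>x\<close> in direction
  \<open>h\<close> to the line through the new point in direction
  \<open>(1 + t) *\<^sub>R h\<close>, and changes \<open>F\<close> by a constant. The dilated point
  is written \<open>x + t *\<^sub>R x\<close> so that it again lies on a line through
  \<open>x\<close>.\<close>

lemma D1_scale_point:
  assumes x: "x \<in> U" "x + t *\<^sub>R x \<in> U" and t: "t > -1" and h: "h \<in> Rn n"
  shows "D1 h (x + t *\<^sub>R x) = D1 h x / (1 + t)"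
proof -
  have "D1 ((1 + t) *\<^sub>R h) (x + t *\<^sub>R x) = D1 h x"
  proof (rule dderiv_eqI)
    have "\<forall>\<^sub>F s in nhds 0. F ((x + t *\<^sub>R x) + s *\<^sub>R ((1 + t) *\<^sub>R h)) = F (x + s *\<^sub>R h) - \<nu> * ln (1 + t)"
      using eventually_line_in_U[OF x(1) h]
    proof eventually_elim
      case (elim s)
      have "(x + t *\<^sub>R x) + s *\<^sub>R ((1 + t) *\<^sub>R h) = (1 + t) *\<^sub>R (x + s *\<^sub>R h)"
        by (simp add: algebra_simps)
      then show ?case using F_scale[OF elim, of "1 + t"] t by simp
    qed
    moreover have "((\<lambda>s. F (x + s *\<^sub>R h) - \<nu> * ln (1 + t)) has_real_derivative D1 h x) (at 0)"
      using dderiv_line[OF F_diff, of x 0 h] x h U_subset by (auto intro!: derivative_eq_intros)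
    ultimately show "((\<lambda>s. F ((x + t *\<^sub>R x) + s *\<^sub>R ((1 + t) *\<^sub>R h))) has_real_derivative D1 h x) (at 0)"
      by (rule DERIV_eventually_cong)
  qed (use x h F_diff in auto)
  then show ?thesis
    using dderiv_scale_dir[OF F_diff x(2), of "1 + t" h] t by (simp add: field_simps)
qed

lemma D1_self:
  assumes x: "x \<in> U"
  shows "D1 x x = - \<nu>"
proof (rule dderiv_eqI[OF F_diff x U_subset[OF x]])
  have ev: "\<forall>\<^sub>F t in nhds (0::real). t \<in> {-1<..}" by (rule eventually_nhds_in_open) auto
  have "\<forall>\<^sub>F t in nhds 0. F (x + t *\<^sub>R x) = F x - \<nu> * ln (1 + t)"
    by (rule eventually_mono[OF ev]) (use F_scale[OF x, of "1 + t" for t] in \<open>simp add: algebra_simps\<close>)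
  moreover have "((\<lambda>t. F x - \<nu> * ln (1 + t)) has_real_derivative - \<nu>) (at 0)"
    by (auto intro!: derivative_eq_intros)
  ultimately show "((\<lambda>t. F (x + t *\<^sub>R x)) has_real_derivative - \<nu>) (at 0)"
    by (rule DERIV_eventually_cong)
qed

text \<open>Euler's identity for the gradient, which is homogeneous of degree \<open>-1\<close>. It
  reads \<open>H x x = - g x\<close> and lets the Hessian norm control the gradient.\<close>

lemma D2_self:
  assumes x: "x \<in> U" and h: "h \<in> Rn n"
  shows "D2 x h x = - D1 h x"
proof (rule dderiv_eqI[OF D1_diff[OF h] x U_subset[OF x]])
  have "\<forall>\<^sub>F t in nhds (0::real). t \<in> {-1<..}" by (rule eventually_nhds_in_open) auto
  then have "\<forall>\<^sub>F t in nhds 0. D1 h (x + t *\<^sub>R x) = D1 h x / (1 + t)"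
    using eventually_line_in_U[OF x U_subset[OF x]]
    by eventually_elim (use D1_scale_point[OF x _ _ h] in auto)
  moreover have "((\<lambda>t. D1 h x / (1 + t)) has_real_derivative - D1 h x) (at 0)"
    by (auto intro!: derivative_eq_intros)
  ultimately show "((\<lambda>t. D1 h (x + t *\<^sub>R x)) has_real_derivative - D1 h x) (at 0)"
    by (rule DERIV_eventually_cong)
qed

lemma D3_self:
  assumes x: "x \<in> U"
  shows "D3 x x x x = - 2 * \<nu>"
proof (rule dderiv_eqI[OF D2_diff x])
  have "\<forall>\<^sub>F t in nhds (0::real). t \<in> {-1<..}" by (rule eventually_nhds_in_open) auto
  then have "\<forall>\<^sub>F t in nhds 0. D2 x x (x + t *\<^sub>R x) = \<nu> / (1 + t)\<^sup>2"
    using eventually_line_in_U[OF x U_subset[OF x]]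
  proof eventually_elim
    case (elim t)
    have R: "x \<in> Rn n" using U_subset x by auto
    have "D2 ((1 + t) *\<^sub>R x) x (x + t *\<^sub>R x) = - D1 x (x + t *\<^sub>R x)"
      using D2_self[OF elim(2) R] by (simp add: algebra_simps)
    also have "\<dots> = \<nu> / (1 + t)"
      using D1_scale_point[OF x elim(2) _ R] elim D1_self[OF x] by simp
    finally have "(1 + t) * D2 x x (x + t *\<^sub>R x) = \<nu> / (1 + t)"
      using D2_scale(1)[OF R R elim(2), of "1 + t"] by simp
    then have "(1 + t) * D2 x x (x + t *\<^sub>R x) / (1 + t) = \<nu> / (1 + t) / (1 + t)" by simp
    then show ?case using elim by (simp add: power2_eq_square)
  qed
  moreover have "((\<lambda>t. \<nu> / (1 + t)\<^sup>2) has_real_derivative - 2 * \<nu>) (at 0)"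
    by (auto intro!: derivative_eq_intros)
  ultimately show "((\<lambda>t. D2 x x (x + t *\<^sub>R x)) has_real_derivative - 2 * \<nu>) (at 0)"
    by (rule DERIV_eventually_cong)
qed (use U_subset x in auto)

lemma zero_notin_U: "0 \<notin> U"
proof
  assume "0 \<in> U"
  then obtain e where e: "e > 0" "\<And>y. y \<in> Rn n \<Longrightarrow> dist y 0 < e \<Longrightarrow> y \<in> U"
    using ball_in_U by blast
  define v where "v = vec_of n (\<lambda>i. if i = 0 then 1 else 0)"
  have "coord v 0 = 1" using n by (simp add: v_def)
  then have v0: "v \<noteq> 0" by (metis coord_zero zero_neq_one)
  define w where "w = (e / (2 * norm v)) *\<^sub>R v"
  have "w \<in> Rn n" "norm w < e" "w \<noteq> 0" using v0 e(1) by (auto simp: w_def v_def)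
  then have "w \<in> K" "- w \<in> K" using e(2)[of w] e(2)[of "- w"] U_subset_K by (auto simp: dist_norm)
  then show False using K \<open>w \<noteq> 0\<close> by (auto simp: proper_cone_def)
qed

lemma N_self:
  assumes "x \<in> U"
  shows "N x x = sqrt \<nu>"
  using D2_self[OF assms U_subset[OF assms]] D1_self[OF assms] by (simp add: N_def)

text \<open>Self-concordance at \<open>x\<close> in direction \<open>x\<close>, where the second
  derivative is \<open>\<nu>\<close> and the third is \<open>- 2 * \<nu>\<close>, gives
  \<open>\<nu> \<le> \<nu> * sqrt \<nu>\<close>. Positivity of \<open>\<nu>\<close>, needed to
  cancel, is definiteness of the local norm.\<close>

lemma nu_ge_1:
  assumes x: "x \<in> U"
  shows "\<nu> \<ge> 1"
proof -
  have R: "x \<in> Rn n" using U_subset x by auto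
  have "x \<noteq> 0" using x zero_notin_U by auto
  then have pos: "\<nu> > 0" using N_pos[OF x R] N_self[OF x] by simp
  have "2 * \<nu> \<le> 2 * sqrt \<nu> ^ 3"
    using D3_diag_le[OF x R, of "sqrt \<nu>"] N_self[OF x] D3_self[OF x] pos by simp
  also have "sqrt \<nu> ^ 3 = \<nu> * sqrt \<nu>" using pos by (simp add: power3_eq_cube)
  finally show ?thesis using pos by simp
qed

text \<open>Polarization gives \<open>6\<close> in place of the optimal constant \<open>2\<close>, which would need more work.\<close>

lemma D3_mixed_le:
  assumes x: "x \<in> U" and h: "h \<in> Rn n" "v \<in> Rn n"
  shows "\<bar>D3 h v v x\<bar> \<le> 6 * N x h * (N x v)\<^sup>2"
proof (cases "h = 0 \<or> v = 0")
  case True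
  then show ?thesis
    using D3_scale(1)[of 0 v v x 0] D3_scale(2)[of 0 h 0 x 0] x h by auto
next
  case False
  define a b where "a = N x h" and "b = N x v"
  have ab: "a > 0" "b > 0" using False N_pos x h by (auto simp: a_def b_def)
  define u w where "u = (1 / a) *\<^sub>R h" and "w = (1 / b) *\<^sub>R v"
  have R: "u \<in> Rn n" "w \<in> Rn n" "- w \<in> Rn n" using h by (auto simp: u_def w_def)
  have one: "N x u = 1" "N x w = 1" "N x (- w) = 1"
    using N_scale[OF x] R(2) h ab N_scale[OF x R(2), of "-1"] by (auto simp: u_def w_def a_def b_def)
  have *: "D3 u u w x = D3 w u u x" "D3 u w u x = D3 w u u x"
    "D3 w u w x = D3 u w w x" "D3 w w u x = D3 u w w x"
    using D3_sym12 D3_sym23 R x by metis+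
  have m: "D3 p q (- w) x = - D3 p q w x" "D3 p (- w) q x = - D3 p w q x" "D3 (- w) p q x = - D3 w p q x"
    if "p \<in> Rn n" "q \<in> Rn n" for p q
    using D3_scale[OF R(2) that x, of "-1"] by simp_all
  \<comment> \<open>The terms odd in \<open>w\<close> cancel. The diagonal values belong to vectors
    of norm at most 2, 2 and 1, so the right side is at most
    \<open>16 + 16 + 4 = 36\<close>.\<close>
  have "6 * D3 u w w x = D3 (u + w) (u + w) (u + w) x + D3 (u + - w) (u + - w) (u + - w) x - 2 * D3 u u u x"
    using R x by (simp only: D3_add Rn_intros m *)
  moreover have "\<bar>D3 (u + w) (u + w) (u + w) x\<bar> \<le> 2 * 2 ^ 3"
    using N_triangle[OF x R(1,2)] one R x by (intro D3_diag_le) auto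
  moreover have "\<bar>D3 (u + - w) (u + - w) (u + - w) x\<bar> \<le> 2 * 2 ^ 3"
    using N_triangle[OF x R(1,3)] one R x by (intro D3_diag_le Rn_intros) auto
  moreover have "\<bar>D3 u u u x\<bar> \<le> 2 * 1 ^ 3"
    using one R x by (intro D3_diag_le) auto
  ultimately have "\<bar>D3 u w w x\<bar> \<le> 6" by (auto simp: abs_le_iff)
  moreover have "D3 h v v x = a * b\<^sup>2 * D3 u w w x"
    using D3_scale h x ab by (simp add: u_def w_def power2_eq_square)
  ultimately show ?thesis
    using ab by (simp add: abs_mult a_def[symmetric] b_def[symmetric] mult.commute mult_left_mono)
qed

section \<open>Variation of Hessian and gradient within local distance 1/50\<close>

context
  fixes x h r
  assumes x: "x \<in> U" and h: "h \<in> Rn n" and r: "N x h < r" "r \<le> 1 / 50"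
begin

lemma small_segment:
  assumes "0 \<le> t" "t \<le> 1"
  shows "x + t *\<^sub>R h \<in> U"
  using Dikin[OF x h _ assms] r by simp

lemma small_pos: "r > 0"
  using r(1) N_nonneg[OF x h] by linarith

lemma small_growth:
  assumes t: "0 \<le> t" "t \<le> 1"
  shows "N (x + t *\<^sub>R h) h \<le> r / (1 - r)"
proof -
  have "r * t \<le> r" using t small_pos by (simp add: mult_le_cancel_left1)
  then have "r / (1 - r * t) \<le> r / (1 - r)"
    using r small_pos by (intro divide_left_mono mult_pos_pos) linarith+
  moreover have "1 < 1 / r" using r small_pos by simp
  then have "N (x + t *\<^sub>R h) h \<le> r / (1 - r * t)"
    using t small_segment by (intro N_line_growth[OF x h r(1)]) auto
  ultimately show ?thesis by simp
qed

text \<open>The mixed third-derivative bound gives \<open>\<bar>q'\<bar> \<le> 6 * c * q\<close> for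
  the squared norm \<open>q\<close> of \<open>v\<close>, with \<open>c = r / (1 - r)\<close>.
  Gronwall applies, and the square root halves the exponent to \<open>3 * c\<close>. For
  \<open>r \<le> 1/50\<close> this is at most \<open>3.1 * r\<close> and at most
  \<open>0.0613\<close>, and \<open>1.066\<close> exceeds \<open>1 / (1 - 0.0613)\<close>.\<close>

lemma small_hessian:
  assumes t: "0 \<le> t" "t \<le> 1" and v: "v \<in> Rn n"
  shows "(1 - 3.1 * r) * N x v \<le> N (x + t *\<^sub>R h) v" "N (x + t *\<^sub>R h) v \<le> 1.066 * N x v"
proof -
  define c where "c = r / (1 - r)"
  define q where "q t = D2 v v (x + t *\<^sub>R h)" for t
  have c: "c \<ge> 0" "3 * c \<le> 3.1 * r" "3 * c \<le> 0.0613"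
    using small_pos r(2) by (simp_all add: c_def field_simps)
  have d: "(q has_real_derivative D3 h v v (x + t *\<^sub>R h)) (at t)" if "0 \<le> t" "t \<le> 1" for t
    unfolding q_def by (rule dderiv_line) (use D2_diff small_segment that x h v U_subset in auto)
  have b: "\<bar>D3 h v v (x + t *\<^sub>R h)\<bar> \<le> 6 * c * q t" if "0 \<le> t" "t \<le> 1" for t
  proof -
    have "\<bar>D3 h v v (x + t *\<^sub>R h)\<bar> \<le> 6 * N (x + t *\<^sub>R h) h * (N (x + t *\<^sub>R h) v)\<^sup>2"
      by (rule D3_mixed_le[OF small_segment[OF that] h v])
    also have "\<dots> \<le> 6 * c * (N (x + t *\<^sub>R h) v)\<^sup>2"
      using small_growth[OF that] by (intro mult_right_mono) (auto simp: c_def)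
    finally show ?thesis using N_sq[OF small_segment[OF that] v] by (simp add: q_def)
  qed
  have N: "N (x + t *\<^sub>R h) v = sqrt (q t)" "N x v = sqrt (q 0)" by (simp_all add: N_def q_def)
  have sq: "sqrt (exp (6 * s)) = exp (3 * s)" for s :: real
    by (rule real_sqrt_unique) (auto simp flip: exp_of_nat_mult)
  have qb: "exp (- (6 * c) * t) * q 0 \<le> q t" "q t \<le> exp (6 * c * t) * q 0"
    by (rule exp_growth_bounds[of t q "\<lambda>t. D3 h v v (x + t *\<^sub>R h)"]; use t d b in auto)+
  have q0: "sqrt (q 0) \<ge> 0" using N N_nonneg[OF x v] by simp
  have "exp (3 * (- c * t)) * sqrt (q 0) \<le> sqrt (q t)"
    using real_sqrt_le_mono[OF qb(1)] sq[of "- c * t"] by (simp add: real_sqrt_mult algebra_simps)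
  moreover have "3 * (c * t) \<le> 3 * c" using c t by (simp add: mult_left_le)
  then have e: "1 - 3 * c \<le> exp (3 * (- c * t))" "1 - 3 * c \<le> exp (- (3 * (c * t)))"
    using exp_ge_add_one_self[of "3 * (- c * t)"] by (auto simp: algebra_simps)
  ultimately have 1: "(1 - 3 * c) * sqrt (q 0) \<le> sqrt (q t)"
    using mult_right_mono[OF e(1) q0] by linarith
  have "(1 - 3.1 * r) * sqrt (q 0) \<le> (1 - 3 * c) * sqrt (q 0)" using c q0 by (intro mult_right_mono) auto
  with 1 show "(1 - 3.1 * r) * N x v \<le> N (x + t *\<^sub>R h) v" by (simp add: N)
  have "1 / 1.066 \<le> exp (- (3 * (c * t)))" using e(2) c(3) by simp
  then have "exp (3 * (c * t)) \<le> 1.066" by (simp add: exp_minus field_simps)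
  then have "exp (3 * (c * t)) * sqrt (q 0) \<le> 1.066 * sqrt (q 0)" using q0 by (rule mult_right_mono)
  moreover have "sqrt (q t) \<le> exp (3 * (c * t)) * sqrt (q 0)"
    using real_sqrt_le_mono[OF qb(2)] sq[of "c * t"] by (simp add: real_sqrt_mult algebra_simps)
  ultimately show "N (x + t *\<^sub>R h) v \<le> 1.066 * N x v" by (simp add: N)
qed

text \<open>By the mean value theorem the change is a third derivative with \<open>h\<close> twice
  and \<open>v\<close> once. Reordered as \<open>D3 v h h\<close>, the mixed bound puts the square
  on \<open>h\<close>. The constant is \<open>6 * 1.066 * 1.042\<close>, the last factor bounding
  \<open>1 / (1 - r)\<close> squared.\<close>

lemma small_hessian_change:
  assumes t: "0 \<le> t" "t \<le> 1" and v: "v \<in> Rn n"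
  shows "\<bar>D2 h v (x + t *\<^sub>R h) - D2 h v x\<bar> \<le> 7 * r\<^sup>2 * N x v"
proof (cases "t = 0")
  case True
  then show ?thesis using N_nonneg[OF x v] by simp
next
  case False
  have "\<exists>z>0. z < t \<and> D2 h v (x + t *\<^sub>R h) - D2 h v (x + 0 *\<^sub>R h) = (t - 0) * D3 h h v (x + z *\<^sub>R h)"
    using False t x h v U_subset
    by (intro MVT2 dderiv_line D2_diff small_segment) auto
  then obtain z where z: "0 < z" "z < t"
    and eq: "D2 h v (x + t *\<^sub>R h) - D2 h v x = t * D3 h h v (x + z *\<^sub>R h)" by auto
  have zU: "x + z *\<^sub>R h \<in> U" using z t small_segment by simp
  have "D3 h h v (x + z *\<^sub>R h) = D3 v h h (x + z *\<^sub>R h)"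
    using D3_sym12 D3_sym23 h v zU by metis
  then have "\<bar>D3 h h v (x + z *\<^sub>R h)\<bar> \<le> 6 * N (x + z *\<^sub>R h) v * (N (x + z *\<^sub>R h) h)\<^sup>2"
    using D3_mixed_le[OF zU v h] by simp
  also have "\<dots> \<le> 6 * (1.066 * N x v) * (r / (1 - r))\<^sup>2"
    using small_hessian(2)[OF _ _ v, of z] small_growth[of z] z t N_nonneg zU h v x
    by (intro mult_mono power_mono) auto
  also have "\<dots> \<le> 6 * (1.066 * N x v) * (1.042 * r\<^sup>2)"
  proof -
    have "(r / (1 - r))\<^sup>2 \<le> (1.0205 * r)\<^sup>2"
      using small_pos r(2) by (intro power_mono) (auto simp: field_simps)
    also have "\<dots> \<le> 1.042 * r\<^sup>2" by (simp add: power_mult_distrib power2_eq_square)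
    finally show ?thesis using N_nonneg[OF x v] by (intro mult_left_mono) auto
  qed
  also have "\<dots> = 6.664632 * (r\<^sup>2 * N x v)" by simp
  also have "\<dots> \<le> 7 * (r\<^sup>2 * N x v)" using N_nonneg[OF x v] by (intro mult_right_mono) auto
  finally have *: "\<bar>D3 h h v (x + z *\<^sub>R h)\<bar> \<le> 7 * r\<^sup>2 * N x v" by simp
  have "\<bar>t * D3 h h v (x + z *\<^sub>R h)\<bar> \<le> 1 * \<bar>D3 h h v (x + z *\<^sub>R h)\<bar>"
    unfolding abs_mult using t by (intro mult_right_mono) auto
  with * eq show ?thesis by simp
qed

text \<open>The mean value theorem leaves the Hessian at an intermediate point, and its deviation
  from the Hessian at \<open>x\<close> is already quadratic in \<open>r\<close>.\<close>

lemma small_gradient_change: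
  assumes v: "v \<in> Rn n"
  shows "\<bar>D1 v (x + h) - D1 v x - D2 h v x\<bar> \<le> 7 * r\<^sup>2 * N x v"
proof -
  have "\<exists>z>0. z < 1 \<and> D1 v (x + 1 *\<^sub>R h) - D1 v (x + 0 *\<^sub>R h) = (1 - 0) * D2 h v (x + z *\<^sub>R h)"
    using x h v U_subset by (intro MVT2 dderiv_line D1_diff small_segment) auto
  then show ?thesis using small_hessian_change[OF _ _ v] by force
qed

end

section \<open>Gradient and Hessian as vectors of the space\<close>

abbreviation "g \<equiv> grad n U F"
abbreviation "H \<equiv> hess n U F"

lemma grad_spec:
  assumes x: "x \<in> U"
  shows "g x \<in> Rn n" "\<And>h. h \<in> Rn n \<Longrightarrow> g x \<bullet> h = D1 h x"
proof -
  have "\<exists>!w. w \<in> Rn n \<and> (\<forall>h\<in>Rn n. w \<bullet> h = D1 h x)"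
    by (rule Riesz_Rn) (use x F_diff in \<open>auto simp: dderiv_add_dir dderiv_scale_dir\<close>)
  from theI'[OF this] show "g x \<in> Rn n" "\<And>h. h \<in> Rn n \<Longrightarrow> g x \<bullet> h = D1 h x"
    by (auto simp: grad_def)
qed

lemma hess_spec:
  assumes x: "x \<in> U" and v: "v \<in> Rn n"
  shows "H x v \<in> Rn n" "\<And>h. h \<in> Rn n \<Longrightarrow> H x v \<bullet> h = D2 h v x"
proof -
  have "\<exists>!w. w \<in> Rn n \<and> (\<forall>h\<in>Rn n. w \<bullet> h = D2 h v x)"
    by (rule Riesz_Rn) (use x v in \<open>auto simp: D2_add D2_scale\<close>)
  from theI'[OF this] show "H x v \<in> Rn n" "\<And>h. h \<in> Rn n \<Longrightarrow> H x v \<bullet> h = D2 h v x"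
    by (auto simp: hess_def)
qed

lemma grad_self: "x \<in> U \<Longrightarrow> g x \<bullet> x = - \<nu>"
  using grad_spec D1_self U_subset by auto

text \<open>Cauchy-Schwarz for \<open>D2 x h\<close>, which is minus the gradient term, since the
  local norm of \<open>x\<close> is \<open>sqrt \<nu>\<close>.\<close>

lemma grad_bound:
  assumes "x \<in> U" "h \<in> Rn n"
  shows "\<bar>g x \<bullet> h\<bar> \<le> sqrt \<nu> * N x h"
  using D2_Cauchy_Schwarz[OF assms(1) U_subset[OF assms(1)] assms(2)] assms
  by (simp add: grad_spec D2_self N_self)

end

section \<open>Solvability of the Newton systems\<close>

text \<open>\<open>T\<close> is controlled on \<open>S\<close> only, so it is replaced by a globally
  linear \<open>L\<close> agreeing with it there. Injectivity sends a basis of \<open>S\<close> to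
  an independent set of the same size inside \<open>S\<close>, which leaves no room for a further
  independent vector.\<close>

lemma inj_endomorphism_surj:
  fixes T :: "'a::real_vector \<Rightarrow> 'a"
  assumes fin: "finite B" and S: "S = span B"
    and add: "\<And>x y. x \<in> S \<Longrightarrow> y \<in> S \<Longrightarrow> T (x + y) = T x + T y"
    and scale: "\<And>r x. x \<in> S \<Longrightarrow> T (r *\<^sub>R x) = r *\<^sub>R T x"
    and maps: "\<And>x. x \<in> S \<Longrightarrow> T x \<in> S"
    and ker: "\<And>x. x \<in> S \<Longrightarrow> T x = 0 \<Longrightarrow> x = 0"
    and y: "y \<in> S"
  shows "\<exists>x\<in>S. T x = y"
proof -
  have sub: "subspace S" by (simp add: S)
  obtain C where C: "C \<subseteq> S" "independent C" "S \<subseteq> span C"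
    using maximal_independent_subset[of S] by blast
  have finC: "finite C" using independent_span_bound[OF fin C(2)] C(1) S by auto
  have spanC: "span C = S" using C sub by (simp add: span_minimal subset_antisym)
  obtain L where L: "linear L" "\<And>x. x \<in> C \<Longrightarrow> L x = T x"
    using linear_independent_extend[OF C(2), of T] by blast
  have LT: "L x = T x" if "x \<in> S" for x
  proof -
    have "x \<in> span C" using that spanC by simp
    then have "x \<in> S \<and> L x = T x"
    proof (induction rule: span_induct_alt)
      case base
      have "T (0 *\<^sub>R 0) = 0 *\<^sub>R T 0" by (rule scale) (use sub in \<open>auto simp: subspace_0\<close>)
      then show ?case using L(1) sub by (simp add: linear_0 subspace_0)
    next
      case (step c a v)
      have "a \<in> S" using C(1) step.hyps(1) by blast
      have ca: "c *\<^sub>R a \<in> S" by (rule subspace_scale[OF sub \<open>a \<in> S\<close>])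
      have "L (c *\<^sub>R a + v) = c *\<^sub>R L a + L v" using L(1) by (simp add: linear_add linear_scale)
      also have "\<dots> = T (c *\<^sub>R a + v)"
        unfolding L(2)[OF step.hyps(1)] conjunct2[OF step.IH] scale[OF \<open>a \<in> S\<close>, symmetric]
        by (rule add[symmetric]) (use ca step.IH in auto)
      finally show ?case using step.IH subspace_add[OF sub ca, of v] by blast
    qed
    then show ?thesis ..
  qed
  have inj: "inj_on L S"
  proof (rule inj_onI)
    fix u v assume uv: "u \<in> S" "v \<in> S" "L u = L v"
    then have "T (u - v) = 0" using LT[of "u - v"] L(1) sub by (simp add: linear_diff subspace_diff)
    then show "u = v" using ker[of "u - v"] uv sub by (simp add: subspace_diff)
  qed
  have ind: "independent (L ` C)"
    using linear_independent_injective_image[OF L(1) C(2)] inj spanC by simp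
  have card: "card (L ` C) = card C" using inj C(1) by (meson card_image inj_on_subset)
  have LC: "L ` C \<subseteq> S" using LT maps C(1) by auto
  have "y \<in> span (L ` C)"
  proof (rule ccontr)
    assume ny: "y \<notin> span (L ` C)"
    then have "independent (insert y (L ` C))" using ind by (simp add: independent_insertI)
    moreover have "insert y (L ` C) \<subseteq> span C" using y LC spanC by simp
    ultimately have "card (insert y (L ` C)) \<le> card C" using independent_span_bound[OF finC] by simp
    moreover have "y \<notin> L ` C" using ny span_base[of y "L ` C"] by blast
    ultimately show False using finC card by simp
  qed
  then have "y \<in> L ` S" using linear_span_image[OF L(1), of C] spanC by simp
  then show ?thesis using LT by auto
qed

text \<open>Finite dimension is a property of the subspaces here, because the ambient type
  \<open>rseq\<close> has infinite dimension.\<close>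

definition finitely_spanned :: "'a::real_vector set \<Rightarrow> bool" where
  "finitely_spanned S \<longleftrightarrow> (\<exists>B. finite B \<and> S = span B)"

lemma finitely_spanned_Rn: "finitely_spanned (Rn n)"
proof -
  let ?B = "(\<lambda>i. vec_of n (\<lambda>j. if j = i then 1 else 0)) ` {..<n}"
  have "Rn n \<subseteq> span ?B"
  proof
    fix h assume "h \<in> Rn n"
    have "(\<Sum>i<n. coord h i *\<^sub>R vec_of n (\<lambda>j. if j = i then 1 else 0)) \<in> span ?B"
      by (intro span_sum span_scale span_base) auto
    then show "h \<in> span ?B" using Rn_basis_expansion[OF \<open>h \<in> Rn n\<close>] by simp
  qed
  moreover have "span ?B \<subseteq> Rn n" by (intro span_minimal subspace_Rn) auto
  ultimately show ?thesis unfolding finitely_spanned_def by (intro exI[of _ ?B]) auto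
qed

lemma finitely_spanned_real: "finitely_spanned (UNIV :: real set)"
proof -
  have "x \<in> span {1}" for x :: real using span_scale[OF span_base, of "1::real" "{1}" x] by (metis insertI1 mult.right_neutral real_scaleR_def)
  then have "UNIV = span {1 :: real}" by blast
  then show ?thesis unfolding finitely_spanned_def by (intro exI[of _ "{1}"]) simp
qed

lemma finitely_spanned_Times:
  assumes "finitely_spanned S" "finitely_spanned T"
  shows "finitely_spanned (S \<times> T)"
proof -
  obtain A B where AB: "finite A" "S = span A" "finite B" "T = span B"
    using assms by (auto simp: finitely_spanned_def)
  have "span (A \<times> {0} \<union> {0} \<times> B) = {x + y |x y. x \<in> span A \<times> {0} \<and> y \<in> {0} \<times> span B}"
    unfolding span_Un span_Times_sing1 span_Times_sing2 ..
  also have "\<dots> = span A \<times> span B" by force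
  finally show ?thesis unfolding finitely_spanned_def using AB
    by (intro exI[of _ "A \<times> {0} \<union> {0} \<times> B"]) auto
qed

section \<open>The matrix of the embedding\<close>

lemma mat_mult_in_Rn [simp]: "mat_mult m n A x \<in> Rn m"
  by (simp add: mat_mult_def)

lemma mat_tmult_in_Rn [simp]: "mat_tmult m n A y \<in> Rn n"
  by (simp add: mat_tmult_def)

lemma mat_mult_linear:
  "mat_mult m n A (u + v) = mat_mult m n A u + mat_mult m n A v"
  "mat_mult m n A (r *\<^sub>R u) = r *\<^sub>R mat_mult m n A u"
  by (auto intro!: rseq_eqI simp: mat_mult_def algebra_simps sum.distrib sum_distrib_left)

lemma mat_tmult_linear:
  "mat_tmult m n A (u + v) = mat_tmult m n A u + mat_tmult m n A v"
  "mat_tmult m n A (r *\<^sub>R u) = r *\<^sub>R mat_tmult m n A u"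
  by (auto intro!: rseq_eqI simp: mat_tmult_def algebra_simps sum.distrib sum_distrib_left)

lemma mat_mult_adjoint:
  assumes "x \<in> Rn n" "y \<in> Rn m"
  shows "mat_tmult m n A y \<bullet> x = y \<bullet> mat_mult m n A x"
proof -
  have "mat_tmult m n A y \<bullet> x = (\<Sum>j<n. (\<Sum>i<m. A i j * coord y i) * coord x j)"
    using inner_Rn[of "mat_tmult m n A y" n x] by (simp add: mat_tmult_def)
  also have "\<dots> = (\<Sum>i<m. \<Sum>j<n. A i j * coord y i * coord x j)"
    unfolding sum_distrib_right by (rule sum.swap)
  also have "\<dots> = y \<bullet> mat_mult m n A x"
    using inner_Rn[OF assms(2), of "mat_mult m n A x"]
    by (simp add: mat_mult_def sum_distrib_left algebra_simps)
  finally show ?thesis .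
qed

text \<open>The transposed product is a linear combination of the rows. Injectivity of the row map
  turns the sum over indices into one over the set of rows, to which independence applies.\<close>

lemma mat_tmult_inj:
  assumes A: "full_row_rank m n A" and y: "y \<in> Rn m" and z: "mat_tmult m n A y = 0"
  shows "y = 0"
proof (rule rseq_eqI)
  let ?f = "\<lambda>i. vec_of n (A i)"
  have inj: "inj_on ?f {..<m}" and ind: "independent (?f ` {..<m})"
    using A by (auto simp: full_row_rank_def)
  have c: "coord (sum g I) j = (\<Sum>i\<in>I. coord (g i) j)" if "finite I" for g :: "nat \<Rightarrow> rseq" and I j
    using that by induction auto
  have "mat_tmult m n A y = (\<Sum>i<m. coord y i *\<^sub>R ?f i)"
    by (rule rseq_eqI) (simp add: c mat_tmult_def mult.commute)
  also have "\<dots> = (\<Sum>v\<in>?f ` {..<m}. coord y (the_inv_into {..<m} ?f v) *\<^sub>R v)"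
    by (subst sum.reindex[OF inj]) (simp add: the_inv_into_f_f[OF inj])
  finally have s: "(\<Sum>v\<in>?f ` {..<m}. coord y (the_inv_into {..<m} ?f v) *\<^sub>R v) = 0" using z by simp
  fix i show "coord y i = coord 0 i"
  proof (cases "i < m")
    case True
    then have "coord y (the_inv_into {..<m} ?f (?f i)) = 0"
      by (intro independentD[OF ind _ _ s]) auto
    then show ?thesis using True by (simp add: the_inv_into_f_f[OF inj])
  qed (use y in \<open>simp add: Rn_def\<close>)
qed

lemma hsd_G_linear:
  "hsd_G m n A b c (u + v) = hsd_G m n A b c u + hsd_G m n A b c v"
  "hsd_G m n A b c (r *\<^sub>R u) = r *\<^sub>R hsd_G m n A b c u"
  by (auto simp: hsd_G_def split_beta mat_mult_linear mat_tmult_linear inner_add_right algebra_simps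
      inner_scaleR_right)

text \<open>Skew-symmetry: pairing the equation with \<open>(y, x, \<tau>)\<close> annihilates the
  left side, and the zero first component of the right side removes \<open>y\<close>.\<close>

lemma hsd_G_skew:
  assumes "x \<in> Rn n" "y \<in> Rn m"
    and eq: "hsd_G m n A b c (y, x, \<tau>) = (0, s, \<kappa>)"
  shows "x \<bullet> s + \<tau> * \<kappa> = 0"
proof -
  have e: "mat_mult m n A x = \<tau> *\<^sub>R b" "s = - mat_tmult m n A y + \<tau> *\<^sub>R c" "\<kappa> = b \<bullet> y - c \<bullet> x"
    using eq by (auto simp: hsd_G_def)
  have "mat_tmult m n A y \<bullet> x = \<tau> * (b \<bullet> y)"
    using mat_mult_adjoint[OF assms(1,2), of A] e(1) by (simp add: inner_commute)
  then show ?thesis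
    by (simp add: e(2,3) inner_add_right inner_diff_right inner_commute algebra_simps)
qed

section \<open>The scaling near the central path\<close>

context lhscb
begin

definition dual_le :: "rseq \<Rightarrow> rseq \<Rightarrow> real \<Rightarrow> bool" where
  "dual_le x s c \<longleftrightarrow> (\<forall>h\<in>Rn n. \<bar>s \<bullet> h\<bar> \<le> c * N x h)"

lemma dual_leD: "dual_le x s c \<Longrightarrow> h \<in> Rn n \<Longrightarrow> \<bar>s \<bullet> h\<bar> \<le> c * N x h"
  by (simp add: dual_le_def)

abbreviation "W x s \<equiv> scaling n U \<nu> F x s"

lemma hess_linear:
  assumes "x \<in> U" "u \<in> Rn n" "v \<in> Rn n"
  shows "H x (u + v) = H x u + H x v" "H x (r *\<^sub>R u) = r *\<^sub>R H x u"
proof -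
  show "H x (u + v) = H x u + H x v"
    by (rule Rn_eqI) (use assms hess_spec in \<open>auto simp: inner_add_left D2_add\<close>)
  show "H x (r *\<^sub>R u) = r *\<^sub>R H x u"
    by (rule Rn_eqI) (use assms hess_spec in \<open>auto simp: D2_scale\<close>)
qed

lemma scaling_in_Rn [simp]:
  assumes "x \<in> U" "s \<in> Rn n" "v \<in> Rn n"
  shows "W x s v \<in> Rn n"
  using assms hess_spec grad_spec by (auto simp: scaling_def Let_def)

lemma scaling_linear:
  assumes "x \<in> U" "u \<in> Rn n" "v \<in> Rn n"
  shows "W x s (u + v) = W x s u + W x s v" "W x s (r *\<^sub>R u) = r *\<^sub>R W x s u"
  using assms by (simp_all add: scaling_def Let_def hess_linear inner_add_right algebra_simps
      add_divide_distrib)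

lemma scaling_inner:
  assumes "x \<in> U" "u \<in> Rn n" "v \<in> Rn n"
  shows "W x s u \<bullet> v = D2 u v x + (s \<bullet> u) * (s \<bullet> v) / (\<nu> * (mu \<nu> x s)\<^sup>2) - (g x \<bullet> u) * (g x \<bullet> v) / \<nu>"
  using assms hess_spec D2_sym[of u v x]
  by (simp add: scaling_def Let_def inner_add_left inner_diff_left)

lemma scaling_sym:
  assumes "x \<in> U" "u \<in> Rn n" "v \<in> Rn n"
  shows "W x s u \<bullet> v = W x s v \<bullet> u"
  using assms D2_sym[of u v x] by (simp add: scaling_inner mult.commute)

end

text \<open>The cone part of the neighbourhood condition. The bound \<open>21/1000\<close> on
  \<open>\<eta>\<close> covers both the iterates, with \<open>\<eta> = 1/50\<close>, and the points
  between predictor and corrector.\<close>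

locale near_central = lhscb +
  fixes x s :: rseq and \<eta> \<mu> :: real
  assumes x: "x \<in> U" and s: "s \<in> Rn n" and mu: "mu \<nu> x s = \<mu>" and mu_pos: "\<mu> > 0"
    and psi: "dual_le x (\<psi> n U F x s \<mu>) (\<eta> * \<mu>)" and eta: "0 \<le> \<eta>" "\<eta> \<le> 21/1000"
begin

abbreviation "\<delta> \<equiv> \<eta>\<^sup>2 + 2 * \<eta>"
abbreviation "P \<equiv> \<psi> n U F x s \<mu>"

lemma x_Rn [simp]: "x \<in> Rn n"
  using U_subset x by auto

lemma nu1: "\<nu> \<ge> 1"
  using nu_ge_1[OF x] .

lemma s_inner_x: "s \<bullet> x = \<nu> * \<mu>"
  using mu nu1 by (simp add: mu_def inner_commute field_simps)

lemma P_in_Rn [simp]: "P \<in> Rn n"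
  using s grad_spec[OF x] by (auto simp: \<psi>_def)

lemma P_inner_x: "P \<bullet> x = 0"
  using s_inner_x grad_self[OF x] by (simp add: \<psi>_def inner_add_left)

lemma delta_le: "\<delta> \<le> 425/10000" "\<delta> \<ge> 0"
proof -
  have "\<eta> * \<eta> \<le> (21/1000) * (21/1000)" using eta by (intro mult_mono) auto
  then show "\<delta> \<le> 425/10000" using eta by (simp add: power2_eq_square)
qed (use eta in simp)

text \<open>The secant equation for which \<open>W\<close> is built: \<open>H x x = - g x\<close>
  cancels against the rank-one term in the gradient, and the rank-one term in \<open>s\<close>
  supplies the right side.\<close>

lemma scaling_self: "W x s x = (1 / \<mu>) *\<^sub>R s"
proof (rule Rn_eqI)
  fix h assume h: "h \<in> Rn n"
  show "W x s x \<bullet> h = ((1 / \<mu>) *\<^sub>R s) \<bullet> h"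
    using h x s nu1 mu_pos mu s_inner_x
    by (simp add: scaling_inner D2_self grad_self grad_spec power2_eq_square field_simps)
qed (use x s in auto)

text \<open>With \<open>s = P - \<mu> *\<^sub>R g x\<close> the product of the two gradient terms
  cancels, so each remaining term contains a factor from \<open>P\<close>. The other factor may be a
  gradient term costing \<open>sqrt \<nu>\<close>, which the division by \<open>\<nu>\<close>
  absorbs. What remains is \<open>\<eta>\<^sup>2 + 2 * \<eta>\<close>.\<close>

lemma scaling_near_hess:
  assumes u: "u \<in> Rn n" and v: "v \<in> Rn n"
  shows "\<bar>W x s u \<bullet> v - D2 u v x\<bar> \<le> \<delta> * N x u * N x v"
proof -
  define pu pv gu gv where "pu = (P \<bullet> u) / \<mu>" and "pv = (P \<bullet> v) / \<mu>" and "gu = g x \<bullet> u" and "gv = g x \<bullet> v"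
  define a b where "a = N x u" and "b = N x v"
  have ab: "a \<ge> 0" "b \<ge> 0" using x u v by (auto simp: a_def b_def)
  have su: "s \<bullet> u = \<mu> * (pu - gu)" "s \<bullet> v = \<mu> * (pv - gv)"
    using mu_pos by (simp_all add: \<psi>_def inner_add_left pu_def gu_def pv_def gv_def field_simps)
  have "W x s u \<bullet> v - D2 u v x = ((pu - gu) * (pv - gv) - gu * gv) / \<nu>"
    using x u v mu_pos mu nu1
    by (simp add: scaling_inner su gu_def gv_def power2_eq_square diff_divide_distrib)
  also have "\<dots> = (pu * pv - pu * gv - gu * pv) / \<nu>" by (simp add: algebra_simps)
  finally have eq: "W x s u \<bullet> v - D2 u v x = (pu * pv - pu * gv - gu * pv) / \<nu>" .
  have p: "\<bar>pu\<bar> \<le> \<eta> * a" "\<bar>pv\<bar> \<le> \<eta> * b"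
    using dual_leD[OF psi u] dual_leD[OF psi v] mu_pos
    by (simp_all add: pu_def pv_def a_def b_def field_simps)
  have gb: "\<bar>gu\<bar> \<le> sqrt \<nu> * a" "\<bar>gv\<bar> \<le> sqrt \<nu> * b"
    using grad_bound[OF x] u v by (simp_all add: gu_def gv_def a_def b_def)
  have "\<bar>pu * pv\<bar> \<le> (\<eta> * a) * (\<eta> * b)" "\<bar>pu * gv\<bar> \<le> (\<eta> * a) * (sqrt \<nu> * b)" "\<bar>gu * pv\<bar> \<le> (sqrt \<nu> * a) * (\<eta> * b)"
    unfolding abs_mult using p gb ab eta nu1 by (auto intro!: mult_mono)
  then have 1: "\<bar>pu * pv - pu * gv - gu * pv\<bar> \<le> \<eta>\<^sup>2 * (a * b) + 2 * \<eta> * sqrt \<nu> * (a * b)"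
    by (simp add: power2_eq_square algebra_simps)
  have "sqrt \<nu> \<le> \<nu>" using nu1 by (simp add: real_le_lsqrt power2_eq_square)
  then have "2 * \<eta> * sqrt \<nu> * (a * b) \<le> 2 * \<eta> * \<nu> * (a * b)"
    using ab eta by (intro mult_right_mono mult_left_mono) auto
  moreover have "\<eta>\<^sup>2 * (a * b) \<le> \<eta>\<^sup>2 * \<nu> * (a * b)"
    using nu1 ab by (intro mult_right_mono) (auto simp: mult_le_cancel_left1)
  ultimately have "\<bar>pu * pv - pu * gv - gu * pv\<bar> \<le> \<nu> * (\<delta> * a * b)"
    using 1 by (simp add: algebra_simps)
  then show ?thesis using nu1 by (simp add: eq a_def b_def field_simps)
qed

lemma scaling_ge:
  assumes "v \<in> Rn n"
  shows "(1 - \<delta>) * (N x v)\<^sup>2 \<le> W x s v \<bullet> v"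
  using scaling_near_hess[OF assms assms] N_sq[OF x assms]
  by (simp add: power2_eq_square algebra_simps abs_le_iff)

lemma scaling_nonneg:
  assumes "v \<in> Rn n"
  shows "W x s v \<bullet> v \<ge> 0"
proof -
  have "(1 - \<delta>) * (N x v)\<^sup>2 \<ge> 0" using delta_le by (intro mult_nonneg_nonneg) auto
  then show ?thesis using scaling_ge[OF assms] by linarith
qed

lemma scaling_pos:
  assumes "v \<in> Rn n" "v \<noteq> 0"
  shows "W x s v \<bullet> v > 0"
proof -
  have "(1 - \<delta>) * (N x v)\<^sup>2 > 0"
    using N_pos[OF x assms] delta_le by (intro mult_pos_pos) auto
  then show ?thesis using scaling_ge[OF assms(1)] by linarith
qed

section \<open>One step, of either kind, from a near-central point\<close>

context
  fixes X ds :: rseq and l Q :: real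
  assumes X: "X \<in> Rn n" and ds: "ds = - P + (l * \<mu>) *\<^sub>R g x - \<mu> *\<^sub>R W x s X"
    and Q: "Q = X \<bullet> ds / \<mu>"
begin

lemma step_ds_Rn [simp]: "ds \<in> Rn n"
  using X x s grad_spec[OF x] by (auto simp: ds)

text \<open>\<open>P\<close> is orthogonal to \<open>x\<close>, and by symmetry of \<open>W\<close>
  and the secant equation \<open>\<mu> * (W x s X \<bullet> x)\<close> equals
  \<open>X \<bullet> s\<close>. Only the gradient term survives, so the first-order change of
  \<open>\<mu>\<close> is governed by \<open>l\<close> alone.\<close>

lemma step_mixed: "x \<bullet> ds + X \<bullet> s = - l * \<nu> * \<mu>"
proof -
  have "W x s X \<bullet> x = (s \<bullet> X) / \<mu>"
    using scaling_sym[OF x X x_Rn] scaling_self by simp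
  then show ?thesis
    using P_inner_x grad_self[OF x] mu_pos
    by (simp add: ds inner_add_left inner_diff_left inner_commute[of x] inner_commute[of X])
qed

lemma step_mu: "mu \<nu> (x + \<alpha> *\<^sub>R X) (s + \<alpha> *\<^sub>R ds) = \<mu> * (1 - \<alpha> * l + \<alpha>\<^sup>2 * Q / \<nu>)"
proof -
  have "(x + \<alpha> *\<^sub>R X) \<bullet> (s + \<alpha> *\<^sub>R ds) = x \<bullet> s + \<alpha> * (x \<bullet> ds + X \<bullet> s) + \<alpha>\<^sup>2 * (X \<bullet> ds)"
    by (simp add: inner_add_left inner_add_right power2_eq_square algebra_simps)
  also have "\<dots> = \<nu> * \<mu> + \<alpha> * (- l * \<nu> * \<mu>) + \<alpha>\<^sup>2 * (\<mu> * Q)"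
    unfolding step_mixed using s_inner_x mu_pos by (simp add: Q inner_commute[of x])
  finally show ?thesis using nu1 by (simp add: mu_def field_simps)
qed

context
  fixes \<alpha> r :: real
  assumes \<alpha>: "0 \<le> \<alpha>" "\<alpha> \<le> 1" and r: "\<alpha> * N x X < r" "r \<le> 1 / 50"
begin

lemma step_in_U: "x + \<alpha> *\<^sub>R X \<in> U"
  using Dikin[of x "\<alpha> *\<^sub>R X" 1] X x r \<alpha> N_scale[OF x X, of \<alpha>] by auto

text \<open>The new centrality error splits into five parts: the damped old error, the second-order
  change of \<open>\<mu>\<close> times the gradient, the gap between \<open>W\<close> and the
  Hessian, the factor \<open>k - 1\<close> times the Hessian term, and the linearisation error of
  the gradient. They give the five summands on the left of the budget. All are measured at
  \<open>x\<close>; the factor \<open>1 - 3.1 * r\<close> moves the bound to the local norm at the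
  new point.\<close>

lemma step_psi:
  fixes B k e
  assumes k: "k = 1 - \<alpha> * l + \<alpha>\<^sup>2 * Q / \<nu>" "k > 0" and e: "\<bar>\<alpha>\<^sup>2 * Q\<bar> \<le> e"
    and B: "(1 - \<alpha>) * \<eta> + e + \<delta> * r + \<bar>k - 1\<bar> * r + 7 * k * r\<^sup>2 \<le> B * (1 - 3.1 * r)"
  shows "dual_le (x + \<alpha> *\<^sub>R X) (\<psi> n U F (x + \<alpha> *\<^sub>R X) (s + \<alpha> *\<^sub>R ds) (\<mu> * k)) (B * \<mu>)"
  unfolding dual_le_def
proof
  fix h assume h: "h \<in> Rn n"
  let ?x = "x + \<alpha> *\<^sub>R X"
  define X' where "X' = \<alpha> *\<^sub>R X"
  have X': "X' \<in> Rn n" "N x X' < r" using X r N_scale[OF x X, of \<alpha>] \<alpha> by (auto simp: X'_def)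
  define b where "b = N x h"
  have b: "b \<ge> 0" using x h by (simp add: b_def)
  have r0: "r \<ge> 0" using X' N_nonneg[OF x X'(1)] by linarith
  define E where "E = D1 h ?x - D1 h x - D2 X' h x"
  have E: "\<bar>E\<bar> \<le> 7 * r\<^sup>2 * b"
    using small_gradient_change[OF x X' r(2) h] by (simp add: E_def b_def X'_def)
  have gx: "g ?x \<bullet> h = g x \<bullet> h + D2 X' h x + E"
    using grad_spec(2)[OF step_in_U h] grad_spec(2)[OF x h] by (simp add: E_def)
  have WX: "\<alpha> * (W x s X \<bullet> h) = W x s X' \<bullet> h"
    using scaling_linear(2)[OF x X X] by (simp add: X'_def)
  have "\<psi> n U F ?x (s + \<alpha> *\<^sub>R ds) (\<mu> * k) \<bullet> h = s \<bullet> h + \<alpha> * (ds \<bullet> h) + \<mu> * k * (g ?x \<bullet> h)"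
    by (simp add: \<psi>_def inner_add_left)
  also have "s \<bullet> h = P \<bullet> h - \<mu> * (g x \<bullet> h)"
    by (simp add: \<psi>_def inner_add_left)
  also have "ds \<bullet> h = - (P \<bullet> h) + l * \<mu> * (g x \<bullet> h) - \<mu> * (W x s X \<bullet> h)"
    by (simp add: ds inner_add_left inner_diff_left)
  also have "P \<bullet> h - \<mu> * (g x \<bullet> h) + \<alpha> * (- (P \<bullet> h) + l * \<mu> * (g x \<bullet> h) - \<mu> * (W x s X \<bullet> h))
      + \<mu> * k * (g ?x \<bullet> h)
    = (1 - \<alpha>) * (P \<bullet> h) + \<mu> * ((k - 1 + \<alpha> * l) * (g x \<bullet> h))
      - \<mu> * (W x s X' \<bullet> h - D2 X' h x) + \<mu> * ((k - 1) * D2 X' h x) + \<mu> * (k * E)"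
    by (simp add: gx WX[symmetric] algebra_simps)
  finally have eq: "\<psi> n U F ?x (s + \<alpha> *\<^sub>R ds) (\<mu> * k) \<bullet> h =
      (1 - \<alpha>) * (P \<bullet> h) + \<mu> * ((k - 1 + \<alpha> * l) * (g x \<bullet> h))
      - \<mu> * (W x s X' \<bullet> h - D2 X' h x) + \<mu> * ((k - 1) * D2 X' h x) + \<mu> * (k * E)" .
  have 1: "\<bar>(1 - \<alpha>) * (P \<bullet> h)\<bar> \<le> \<mu> * ((1 - \<alpha>) * \<eta> * b)"
  proof -
    have "\<bar>(1 - \<alpha>) * (P \<bullet> h)\<bar> \<le> (1 - \<alpha>) * (\<eta> * \<mu> * b)"
      using dual_leD[OF psi h] \<alpha> by (simp add: abs_mult b_def mult_left_mono)
    then show ?thesis by (simp add: algebra_simps)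
  qed
  \<comment> \<open>The first factor is \<open>\<alpha>\<^sup>2 * Q / \<nu>\<close>, and its
    division by \<open>\<nu>\<close> outweighs the \<open>sqrt \<nu>\<close> from the
    gradient.\<close>
  have 2: "\<bar>(k - 1 + \<alpha> * l) * (g x \<bullet> h)\<bar> \<le> e * b"
  proof -
    have "sqrt \<nu> \<le> \<nu>" using nu1 by (simp add: real_le_lsqrt power2_eq_square)
    then have "sqrt \<nu> / \<nu> \<le> 1" using nu1 by simp
    have "\<bar>(k - 1 + \<alpha> * l) * (g x \<bullet> h)\<bar> = \<bar>\<alpha>\<^sup>2 * Q\<bar> / \<nu> * \<bar>g x \<bullet> h\<bar>"
      using nu1 by (simp add: k abs_mult)
    also have "\<dots> \<le> \<bar>\<alpha>\<^sup>2 * Q\<bar> / \<nu> * (sqrt \<nu> * b)"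
      using grad_bound[OF x h] nu1 by (intro mult_left_mono) (auto simp: b_def)
    also have "\<dots> = \<bar>\<alpha>\<^sup>2 * Q\<bar> * (sqrt \<nu> / \<nu>) * b" by simp
    also have "\<dots> \<le> e * 1 * b"
      using e b nu1 \<open>sqrt \<nu> / \<nu> \<le> 1\<close> by (intro mult_right_mono mult_mono) auto
    finally show ?thesis by simp
  qed
  have D: "\<bar>D2 X' h x\<bar> \<le> r * b"
    using D2_Cauchy_Schwarz[OF x X'(1) h] X' b mult_right_mono[of "N x X'" r b] by (simp add: b_def)
  have 3: "\<bar>W x s X' \<bullet> h - D2 X' h x\<bar> \<le> \<delta> * r * b"
  proof -
    have "\<delta> * N x X' * b \<le> \<delta> * r * b"
      using X' b delta_le by (intro mult_right_mono mult_left_mono) auto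
    then show ?thesis using scaling_near_hess[OF X'(1) h] by (simp add: b_def)
  qed
  have 4: "\<bar>(k - 1) * D2 X' h x\<bar> \<le> \<bar>k - 1\<bar> * r * b"
    using mult_left_mono[OF D, of "\<bar>k - 1\<bar>"] by (simp add: abs_mult mult.assoc)
  have 5: "\<bar>k * E\<bar> \<le> 7 * k * r\<^sup>2 * b"
    using mult_left_mono[OF E, of k] k(2) by (simp add: abs_mult algebra_simps)
  have scale: "\<bar>\<mu> * u\<bar> \<le> \<mu> * w" if "\<bar>u\<bar> \<le> w" for u w
    using that mu_pos by (simp add: abs_mult)
  have "\<bar>\<psi> n U F ?x (s + \<alpha> *\<^sub>R ds) (\<mu> * k) \<bullet> h\<bar> \<le> \<mu> * ((1 - \<alpha>) * \<eta> * b) + \<mu> * (e * b)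
      + \<mu> * (\<delta> * r * b) + \<mu> * (\<bar>k - 1\<bar> * r * b) + \<mu> * (7 * k * r\<^sup>2 * b)"
    unfolding eq using 1 scale[OF 2] scale[OF 3] scale[OF 4] scale[OF 5] by linarith
  also have "\<dots> = \<mu> * b * ((1 - \<alpha>) * \<eta> + e + \<delta> * r + \<bar>k - 1\<bar> * r + 7 * k * r\<^sup>2)"
    by (simp add: algebra_simps)
  also have "\<dots> \<le> \<mu> * b * (B * (1 - 3.1 * r))"
    using B b mu_pos by (intro mult_left_mono) auto
  also have "\<dots> = B * \<mu> * ((1 - 3.1 * r) * b)" by simp
  also have "\<dots> \<le> B * \<mu> * N ?x h"
  proof -
    have "0 \<le> (1 - \<alpha>) * \<eta> + e + \<delta> * r + \<bar>k - 1\<bar> * r + 7 * k * r\<^sup>2"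
      using \<alpha> eta e k(2) r0 delta_le by (intro add_nonneg_nonneg mult_nonneg_nonneg) auto
    then have "0 \<le> B * (1 - 3.1 * r)" using B by linarith
    then have "B \<ge> 0" using r(2) by (simp add: zero_le_mult_iff)
    moreover have "(1 - 3.1 * r) * b \<le> N ?x h"
      using small_hessian(1)[OF x X' r(2) _ _ h, of 1] by (simp add: b_def X'_def)
    ultimately show ?thesis using mu_pos by (intro mult_left_mono) auto
  qed
  finally show "\<bar>\<psi> n U F ?x (s + \<alpha> *\<^sub>R ds) (\<mu> * k) \<bullet> h\<bar> \<le> B * \<mu> * N ?x h" .
qed

lemma step_near_central:
  fixes B k e \<eta>'
  assumes k: "k = 1 - \<alpha> * l + \<alpha>\<^sup>2 * Q / \<nu>" "k > 0" and e: "\<bar>\<alpha>\<^sup>2 * Q\<bar> \<le> e"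
    and B: "(1 - \<alpha>) * \<eta> + e + \<delta> * r + \<bar>k - 1\<bar> * r + 7 * k * r\<^sup>2 \<le> \<eta>' * k * (1 - 3.1 * r)"
    and eta': "0 \<le> \<eta>'" "\<eta>' \<le> 21/1000"
  shows "near_central n K \<nu> F (x + \<alpha> *\<^sub>R X) (s + \<alpha> *\<^sub>R ds) \<eta>' (\<mu> * k)"
proof (unfold_locales)
  show "mu \<nu> (x + \<alpha> *\<^sub>R X) (s + \<alpha> *\<^sub>R ds) = \<mu> * k" by (simp add: step_mu k)
  show "dual_le (x + \<alpha> *\<^sub>R X) (\<psi> n U F (x + \<alpha> *\<^sub>R X) (s + \<alpha> *\<^sub>R ds) (\<mu> * k)) (\<eta>' * (\<mu> * k))"
    using step_psi[OF k e, of "\<eta>' * k"] B by (simp add: mult_ac)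
qed (use s step_in_U mu_pos k eta' in auto)

end

end

end

section \<open>Unique solvability of the Newton system at a state\<close>

locale hsd_state = near_central +
  fixes m :: nat and A :: "nat \<Rightarrow> nat \<Rightarrow> real" and b c y :: rseq and \<tau> \<kappa> \<beta> :: real
  assumes A: "full_row_rank m n A" and b: "b \<in> Rn m" and c: "c \<in> Rn n" and y: "y \<in> Rn m"
    and \<tau>: "\<tau> > 0" and \<kappa>: "\<kappa> > 0" and \<beta>: "\<kappa> * \<tau> = \<beta> * \<mu>"
begin

abbreviation "newton \<rho> \<theta> \<xi> \<equiv> newton_system m n U \<nu> F A b c \<rho> \<theta> \<xi> ((x, \<tau>), y, (s, \<kappa>))"

text \<open>Skew-symmetry turns a kernel vector into a vanishing sum of two nonnegative terms,
  \<open>\<mu> * (W x s dx \<bullet> dx)\<close> and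
  \<open>\<kappa> / \<tau> * d\<tau>\<^sup>2\<close>. Positive definiteness of \<open>W\<close>
  gives \<open>dx = 0\<close>; full row rank finally removes \<open>dy\<close>.\<close>

lemma newton_kernel:
  assumes "newton 0 0 0 \<Delta>"
  shows "\<Delta> = 0"
proof -
  obtain dx d\<tau> dy ds d\<kappa> where \<Delta>: "\<Delta> = ((dx, d\<tau>), dy, (ds, d\<kappa>))" by (metis prod.collapse)
  have R: "dx \<in> Rn n" "dy \<in> Rn m" "ds \<in> Rn n"
    and eq: "hsd_G m n A b c (dy, dx, d\<tau>) = (0, ds, d\<kappa>)"
    and tk: "\<tau> * d\<kappa> + \<kappa> * d\<tau> = 0" and dse: "ds = - (\<mu> *\<^sub>R W x s dx)"
    using assms mu by (auto simp: newton_system_def \<Delta> eq_neg_iff_add_eq_0)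
  have sk: "dx \<bullet> ds + d\<tau> * d\<kappa> = 0" by (rule hsd_G_skew[OF R(1,2) eq])
  have dk: "d\<kappa> = - (\<kappa> * d\<tau> / \<tau>)" using tk \<tau> by (simp add: field_simps)
  have "\<mu> * (W x s dx \<bullet> dx) + \<kappa> / \<tau> * d\<tau>\<^sup>2 = 0"
    using sk by (simp add: dse dk inner_commute[of dx] power2_eq_square algebra_simps)
  moreover have "\<mu> * (W x s dx \<bullet> dx) \<ge> 0" "\<kappa> / \<tau> * d\<tau>\<^sup>2 \<ge> 0"
    using mu_pos scaling_nonneg[OF R(1)] \<tau> \<kappa> by auto
  ultimately have "\<mu> * (W x s dx \<bullet> dx) = 0" "\<kappa> / \<tau> * d\<tau>\<^sup>2 = 0" by linarith+
  then have dx: "dx = 0" and dt: "d\<tau> = 0"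
    using scaling_pos[OF R(1)] mu_pos \<tau> \<kappa> by auto
  have "W x s 0 = 0" using scaling_linear(2)[OF x x_Rn x_Rn, of s 0] by simp
  then have "ds = 0" "d\<kappa> = 0" using dse dk dx dt by auto
  moreover have "mat_tmult m n A dy = 0"
    using eq dx dt \<open>ds = 0\<close> by (simp add: hsd_G_def)
  then have "dy = 0" by (rule mat_tmult_inj[OF A R(2)])
  ultimately show ?thesis by (simp add: \<Delta> dx dt zero_prod_def)
qed

lemma newton_ex1:
  assumes \<rho>: "\<rho>1 \<in> Rn m" "\<rho>2 \<in> Rn n" and \<xi>: "\<xi> \<in> Rn n"
  shows "\<exists>!\<Delta>. newton (\<rho>1, \<rho>2, \<rho>3) \<theta> \<xi> \<Delta>"
proof -
  define S where "S = (Rn n \<times> (UNIV :: real set)) \<times> Rn m \<times> (Rn n \<times> (UNIV :: real set))"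
  \<comment> \<open>The left sides of the system are arranged to lie in the same product
    \<open>S\<close> as the unknowns, so that \<open>T\<close> is an endomorphism of
    \<open>S\<close>.\<close>
  define T where "T = (\<lambda>((dx, d\<tau>), dy, (ds, d\<kappa>)).
     let p = hsd_G m n A b c (dy, dx, d\<tau>) - (0, ds, d\<kappa>)
     in ((fst (snd p), snd (snd p)), fst p, (ds + \<mu> *\<^sub>R W x s dx, \<tau> * d\<kappa> + \<kappa> * d\<tau>)))"
  obtain B where B: "finite B" "S = span B"
    using finitely_spanned_Times[OF finitely_spanned_Times[OF finitely_spanned_Rn finitely_spanned_real]
        finitely_spanned_Times[OF finitely_spanned_Rn
          finitely_spanned_Times[OF finitely_spanned_Rn finitely_spanned_real]]]
    unfolding S_def finitely_spanned_def by blast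
  have iff: "newton (\<rho>1, \<rho>2, \<rho>3) \<theta> \<xi> \<Delta> \<longleftrightarrow> \<Delta> \<in> S \<and> T \<Delta> = ((\<rho>2, \<rho>3), \<rho>1, (\<xi>, \<theta>))"
    for \<rho>1 \<rho>2 \<rho>3 \<theta> \<xi> \<Delta>
    by (cases \<Delta>) (auto simp: newton_system_def S_def T_def Let_def mu prod_eq_iff)
  have add: "T (u + v) = T u + T v" if "u \<in> S" "v \<in> S" for u v
  proof -
    obtain u1 u2 u3 u4 u5 where u: "u = ((u1, u2), u3, (u4, u5))" by (metis prod.collapse)
    obtain v1 v2 v3 v4 v5 where v: "v = ((v1, v2), v3, (v4, v5))" by (metis prod.collapse)
    have "W x s (u1 + v1) = W x s u1 + W x s v1" using that x by (intro scaling_linear) (auto simp: S_def u v)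
    moreover have "hsd_G m n A b c (u3 + v3, u1 + v1, u2 + v2)
        = hsd_G m n A b c (u3, u1, u2) + hsd_G m n A b c (v3, v1, v2)"
      using hsd_G_linear(1)[of m n A b c "(u3, u1, u2)" "(v3, v1, v2)"] by simp
    ultimately show ?thesis by (simp add: T_def Let_def u v algebra_simps)
  qed
  have scale: "T (q *\<^sub>R u) = q *\<^sub>R T u" if "u \<in> S" for q u
  proof -
    obtain u1 u2 u3 u4 u5 where u: "u = ((u1, u2), u3, (u4, u5))" by (metis prod.collapse)
    have "W x s (q *\<^sub>R u1) = q *\<^sub>R W x s u1" using that x by (intro scaling_linear) (auto simp: S_def u)
    moreover have "hsd_G m n A b c (q *\<^sub>R u3, q *\<^sub>R u1, q *\<^sub>R u2) = q *\<^sub>R hsd_G m n A b c (u3, u1, u2)"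
      using hsd_G_linear(2)[of m n A b c q "(u3, u1, u2)"] by simp
    ultimately show ?thesis by (simp add: T_def Let_def u algebra_simps)
  qed
  have maps: "T u \<in> S" if "u \<in> S" for u
    using that x s b c by (auto simp: T_def Let_def S_def hsd_G_def)
  have ker: "u = 0" if "u \<in> S" "T u = 0" for u
    using newton_kernel[of u] iff[of 0 0 0 0 0 u] that by (simp add: zero_prod_def)
  have "((\<rho>2, \<rho>3), \<rho>1, (\<xi>, \<theta>)) \<in> S" using assms by (simp add: S_def)
  from inj_endomorphism_surj[OF B add scale maps ker this]
  obtain \<Delta> where \<Delta>: "\<Delta> \<in> S" "T \<Delta> = ((\<rho>2, \<rho>3), \<rho>1, (\<xi>, \<theta>))" by blast
  have sub: "subspace S" by (simp add: B)
  show ?thesis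
  proof (rule ex1I)
    show "newton (\<rho>1, \<rho>2, \<rho>3) \<theta> \<xi> \<Delta>" using iff \<Delta> by blast
    fix \<Delta>' assume "newton (\<rho>1, \<rho>2, \<rho>3) \<theta> \<xi> \<Delta>'"
    then have \<Delta>': "\<Delta>' \<in> S" "T \<Delta>' = T \<Delta>" using iff \<Delta> by auto
    have neg: "(- 1) *\<^sub>R \<Delta> \<in> S" by (rule subspace_scale[OF sub \<Delta>(1)])
    have "T (\<Delta>' + (- 1) *\<^sub>R \<Delta>) = T \<Delta>' + T ((- 1) *\<^sub>R \<Delta>)"
      by (rule add[OF \<Delta>'(1) neg])
    also have "\<dots> = 0" using scale[OF \<Delta>(1), of "-1"] \<Delta>' by simp
    finally have "\<Delta>' + (- 1) *\<^sub>R \<Delta> = 0" by (rule ker[OF subspace_add[OF sub \<Delta>'(1) neg]])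
    then show "\<Delta>' = \<Delta>" by simp
  qed
qed

end

section \<open>Predictor and corrector\<close>

text \<open>Both bounds come from
  \<open>\<nu> + 905/2000 < \<gamma>\<^sup>2 \<le> 1537/1000 * \<nu>\<close>: the lower one limits
  the local length of the predictor, the upper one yields the rate. The number
  \<open>9596/10000\<close> is \<open>1 - \<delta>\<close> at \<open>\<eta> = 1/50\<close>.\<close>

lemma step_length_bounds:
  fixes \<nu> :: real
  assumes \<nu>: "\<nu> \<ge> 1"
    and \<gamma>: "\<gamma> = sqrt ((1/50 + sqrt \<nu>)\<^sup>2 / (9596/10000) + 905/2000)"
    and \<alpha>: "\<alpha> = 5/1000 * sqrt (9596/10000) / \<gamma>"
  shows "0 < \<alpha>" "\<alpha> \<le> 5/1000" "\<alpha>\<^sup>2 * (\<nu> + 905/2000) < 9596/10000 * (25/1000000)"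
    "\<alpha> \<ge> 39/10000 / sqrt \<nu>"
proof -
  define \<gamma>2 where "\<gamma>2 = (1/50 + sqrt \<nu>)\<^sup>2 / (9596/10000) + 905/2000"
  have sq: "(sqrt \<nu>)\<^sup>2 = \<nu>" "sqrt \<nu> \<ge> 1" using \<nu> by auto
  have up: "(1/50 + sqrt \<nu>)\<^sup>2 \<le> (51/50)\<^sup>2 * \<nu>"
  proof -
    have "(1/50 + sqrt \<nu>)\<^sup>2 \<le> (51/50 * sqrt \<nu>)\<^sup>2" using sq by (intro power_mono) auto
    then show ?thesis by (simp only: power_mult_distrib sq)
  qed
  have "(sqrt \<nu>)\<^sup>2 < (1/50 + sqrt \<nu>)\<^sup>2" using sq by (intro power_strict_mono) auto
  then have lo: "\<nu> < (1/50 + sqrt \<nu>)\<^sup>2" using sq by simp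
  then have g2: "\<nu> + 905/2000 < \<gamma>2" unfolding \<gamma>2_def using \<nu> by simp
  then have pos: "\<gamma>2 > 0" using \<nu> by linarith
  have hi: "\<gamma>2 \<le> 1537/1000 * \<nu>" using up \<nu> by (simp add: \<gamma>2_def power2_eq_square)
  have g: "\<gamma> > 0" using pos by (simp add: \<gamma> \<gamma>2_def)
  then show "0 < \<alpha>" by (simp add: \<alpha>)
  have \<alpha>2: "\<alpha>\<^sup>2 = 25/1000000 * (9596/10000) / \<gamma>2"
    using pos by (simp add: \<alpha> \<gamma> \<gamma>2_def power_divide power_mult_distrib)
  have "\<alpha>\<^sup>2 * (\<nu> + 905/2000) < \<alpha>\<^sup>2 * \<gamma>2"
    using g2 \<open>0 < \<alpha>\<close> by (intro mult_strict_left_mono) auto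
  then show "\<alpha>\<^sup>2 * (\<nu> + 905/2000) < 9596/10000 * (25/1000000)"
    using pos by (simp add: \<alpha>2)
  have "\<alpha>\<^sup>2 \<le> 25/1000000 * (9596/10000) / 1"
    unfolding \<alpha>2 using g2 \<nu> by (intro divide_left_mono) auto
  then have "\<alpha>\<^sup>2 \<le> (5/1000)\<^sup>2" by (simp add: power2_eq_square)
  then show "\<alpha> \<le> 5/1000" by (rule power2_le_imp_le) simp
  have "(39/10000 / sqrt \<nu>)\<^sup>2 \<le> \<alpha>\<^sup>2"
    using hi pos \<nu> by (simp add: \<alpha>2 power_divide sq field_simps)
  then show "\<alpha> \<ge> 39/10000 / sqrt \<nu>" by (rule power2_le_imp_le) (use \<open>0 < \<alpha>\<close> in simp)
qed

text \<open>Meant for the relative changes of \<open>\<tau>\<close> and \<open>\<kappa>\<close>: the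
  sum of their squares is \<open>e\<^sup>2\<close> minus twice their product. This keeps both
  variables positive after a step.\<close>

lemma complementary_products:
  fixes t k q e :: real
  assumes "t + k = e" "\<bar>e\<bar> \<le> 1" "t * k \<ge> - q"
  shows "t\<^sup>2 \<le> 2 * q + 1" "k\<^sup>2 \<le> 2 * q + 1"
proof -
  have e: "e\<^sup>2 \<le> 1" using assms(2) by (simp add: abs_square_le_1)
  have "t\<^sup>2 + k\<^sup>2 = e\<^sup>2 - 2 * (t * k)"
    using assms(1) by (simp add: power2_eq_square algebra_simps flip: assms(1))
  then have "t\<^sup>2 + k\<^sup>2 \<le> 1 + 2 * q" using e assms(3) by linarith
  then show "t\<^sup>2 \<le> 2 * q + 1" "k\<^sup>2 \<le> 2 * q + 1"
    using zero_le_power2[of t] zero_le_power2[of k] by linarith+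
qed

lemma product_le_quarter_square:
  fixes t k e :: real
  assumes "t + k = e"
  shows "t * k \<le> e\<^sup>2 / 4"
  using zero_le_power2[of "t - k"] by (simp add: power2_eq_square algebra_simps flip: assms)

lemma positive_after_step:
  fixes v dv a t :: real
  assumes "v > 0" "a\<^sup>2 * t\<^sup>2 < 1" "dv = v * t"
  shows "v + a * dv > 0"
proof -
  have "\<bar>a * t\<bar> < 1" using assms(2) by (simp add: abs_square_less_1 flip: power_mult_distrib)
  then have "v * (1 + a * t) > 0" using assms(1) by (intro mult_pos_pos) auto
  then show ?thesis by (simp add: assms(3) algebra_simps)
qed

lemma residual_step:
  "residual m n A b c (((x, \<tau>), y, (s, \<kappa>)) + a *\<^sub>R ((dx, d\<tau>), dy, (ds, d\<kappa>))) =
     residual m n A b c ((x, \<tau>), y, (s, \<kappa>)) + a *\<^sub>R (hsd_G m n A b c (dy, dx, d\<tau>) - (0, ds, d\<kappa>))"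
proof -
  have "hsd_G m n A b c ((y, x, \<tau>) + a *\<^sub>R (dy, dx, d\<tau>))
      = hsd_G m n A b c (y, x, \<tau>) + a *\<^sub>R hsd_G m n A b c (dy, dx, d\<tau>)"
    unfolding hsd_G_linear ..
  then show ?thesis by (simp add: residual_def algebra_simps)
qed

section \<open>Estimates for a single predictor or corrector step\<close>

context hsd_state
begin

abbreviation "cur \<equiv> ((x, \<tau>), y, (s, \<kappa>))"

lemma beta_pos: "\<beta> > 0"
proof -
  have "\<beta> * \<mu> > 0" using \<tau> \<kappa> unfolding \<beta>[symmetric] by simp
  then show ?thesis using mu_pos by (simp add: zero_less_mult_iff)
qed

context
  fixes dx dy ds d\<tau> d\<kappa> assumes pred: "newton (- residual m n A b c cur) (- (\<kappa> * \<tau>)) (- s) ((dx, d\<tau>), dy, (ds, d\<kappa>))"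
begin

lemma predictor_eqs:
  shows "dx \<in> Rn n" "dy \<in> Rn m" "ds \<in> Rn n"
    "hsd_G m n A b c (dy, dx, d\<tau>) - (0, ds, d\<kappa>) = - residual m n A b c cur"
    "\<tau> * d\<kappa> + \<kappa> * d\<tau> = - (\<kappa> * \<tau>)"
    "ds = - P + (1 * \<mu>) *\<^sub>R g x - \<mu> *\<^sub>R W x s dx"
  using pred mu by (auto simp: newton_system_def \<psi>_def algebra_simps eq_diff_eq)

text \<open>The direction itself has a nonzero residual equation, but the full step reaches residual
  zero, so the skew identity holds at its end point. On expansion the linearised complementarity
  equations cancel everything except the second-order products.\<close>

lemma predictor_orthogonal: "dx \<bullet> ds + d\<tau> * d\<kappa> = 0"
proof -
  have "residual m n A b c (cur + 1 *\<^sub>R ((dx, d\<tau>), dy, (ds, d\<kappa>))) = 0"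
    unfolding residual_step predictor_eqs(4) by simp
  then have "hsd_G m n A b c (y + dy, x + dx, \<tau> + d\<tau>) = (0, s + ds, \<kappa> + d\<kappa>)"
    by (simp add: residual_def)
  then have "(x + dx) \<bullet> (s + ds) + (\<tau> + d\<tau>) * (\<kappa> + d\<kappa>) = 0"
    by (intro hsd_G_skew[of _ n _ m]) (use y predictor_eqs in auto)
  moreover have "x \<bullet> ds + dx \<bullet> s = - (x \<bullet> s)"
    using step_mixed[OF predictor_eqs(1,6) refl] s_inner_x by (simp add: inner_commute)
  ultimately show ?thesis
    using predictor_eqs(5) by (simp add: inner_add_left inner_add_right algebra_simps)
qed

text \<open>With \<open>w\<close> and \<open>a\<close> the \<open>W\<close>-products of
  \<open>dx\<close> with \<open>x\<close> and with itself, \<open>Q = - w - a\<close>. Since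
  \<open>x\<close> has \<open>W\<close>-square \<open>\<nu>\<close>, nonnegativity of the form at
  \<open>x + dx\<close> gives \<open>a \<le> \<nu> - 2 * Q\<close>. The arithmetic-geometric
  inequality for \<open>\<tau>\<close> and \<open>\<kappa>\<close> gives
  \<open>- Q \<le> \<beta> / 4\<close>, whence the summand \<open>\<beta> / 2\<close>.\<close>

lemma predictor_size:
  assumes Q: "Q = dx \<bullet> ds / \<mu>"
  shows "W x s dx \<bullet> dx \<le> \<nu> + \<beta> / 2" "\<bar>Q\<bar> \<le> \<nu> + \<beta> / 2"
    "d\<tau> / \<tau> + d\<kappa> / \<kappa> = - 1" "\<beta> * ((d\<tau> / \<tau>) * (d\<kappa> / \<kappa>)) = - Q"
proof -
  note R = predictor_eqs(1)
  define w where "w = W x s dx \<bullet> x"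
  define a where "a = W x s dx \<bullet> dx"
  have Wx: "W x s x \<bullet> dx = w" "W x s x \<bullet> x = \<nu>"
    using scaling_sym[OF x R x_Rn] scaling_self s_inner_x mu_pos by (simp_all add: w_def)
  have Qw: "Q = - w - a"
  proof -
    have "ds = - s - \<mu> *\<^sub>R W x s dx" using predictor_eqs(6) by (simp add: \<psi>_def)
    then have "dx \<bullet> ds = - (s \<bullet> dx) - \<mu> * a"
      by (simp add: a_def inner_diff_right inner_commute[of dx])
    moreover have "s \<bullet> dx = \<mu> * w" using Wx(1) scaling_self mu_pos by (simp add: field_simps)
    ultimately show ?thesis using mu_pos by (simp add: Q field_simps)
  qed
  show tk: "d\<tau> / \<tau> + d\<kappa> / \<kappa> = - 1"
    using predictor_eqs(5) \<tau> \<kappa> by (simp add: field_simps)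
  show prod: "\<beta> * ((d\<tau> / \<tau>) * (d\<kappa> / \<kappa>)) = - Q"
  proof -
    have "\<mu> * (\<beta> * ((d\<tau> / \<tau>) * (d\<kappa> / \<kappa>))) = \<kappa> * \<tau> * ((d\<tau> / \<tau>) * (d\<kappa> / \<kappa>))"
      unfolding \<beta> by simp
    also have "\<dots> = \<mu> * (- Q)"
      using predictor_orthogonal \<tau> \<kappa> mu_pos by (simp add: Q)
    finally show ?thesis using mu_pos by (metis less_irrefl mult_cancel_left)
  qed
  have "(d\<tau> / \<tau>) * (d\<kappa> / \<kappa>) \<le> (- 1)\<^sup>2 / 4"
    by (rule product_le_quarter_square[OF tk])
  also have "(- 1)\<^sup>2 / 4 = 1 / (4 :: real)" by simp
  finally have "\<beta> * ((d\<tau> / \<tau>) * (d\<kappa> / \<kappa>)) \<le> \<beta> * (1 / 4)" using beta_pos by (intro mult_left_mono) auto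
  then have Qlow: "- Q \<le> \<beta> / 4" using prod by linarith
  have expand: "W x s (x + t *\<^sub>R dx) \<bullet> (x + t *\<^sub>R dx) = \<nu> + 2 * t * w + t\<^sup>2 * a" for t
    using scaling_linear[OF x] R Wx
    by (simp add: inner_add_left inner_add_right power2_eq_square a_def w_def algebra_simps)
  have "W x s (x + 1 *\<^sub>R dx) \<bullet> (x + 1 *\<^sub>R dx) \<ge> 0" using R by (intro scaling_nonneg) auto
  then have 1: "\<nu> + 2 * w + a \<ge> 0" using expand[of 1] by simp
  \<comment> \<open>The multiplier 2 minimises the bound on \<open>Q\<close>: it yields
    \<open>Q \<le> \<nu> / 4\<close>.\<close>
  have "W x s (x + 2 *\<^sub>R dx) \<bullet> (x + 2 *\<^sub>R dx) \<ge> 0" using R by (intro scaling_nonneg) auto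
  then have 2: "\<nu> + 4 * w + 4 * a \<ge> 0" using expand[of 2] by simp
  have 3: "a \<ge> 0" using scaling_nonneg[OF R] by (simp add: a_def)
  show "W x s dx \<bullet> dx \<le> \<nu> + \<beta> / 2" using 1 Qlow Qw by (simp add: a_def[symmetric])
  show "\<bar>Q\<bar> \<le> \<nu> + \<beta> / 2" using 1 2 3 Qlow Qw nu1 beta_pos by (simp add: abs_le_iff)
qed

end

text \<open>The step is short enough that the relative centrality error grows only from
  \<open>0.02\<close> to \<open>0.021\<close>, and \<open>\<kappa> * \<tau> / \<mu>\<close> leaves
  its interval by at most \<open>1/10000\<close>. The second-order terms in
  \<open>\<nu> * \<mu>'\<close> and in the new product of \<open>\<kappa>\<close> and
  \<open>\<tau>\<close> are opposite, so the total complementarity shrinks exactly.\<close>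

lemma predictor_point:
  fixes \<alpha>
  assumes \<eta>: "\<eta> = 1/50" and \<beta>_bd: "9/10 \<le> \<beta>" "\<beta> \<le> 905/1000"
    and pred: "newton (- residual m n A b c cur) (- (\<kappa> * \<tau>)) (- s) ((dx, d\<tau>), dy, (ds, d\<kappa>))"
    and \<alpha>: "0 < \<alpha>" "\<alpha> \<le> 5/1000" "\<alpha>\<^sup>2 * (\<nu> + 905/2000) < 9596/10000 * (25/1000000)"
  defines "\<mu>' \<equiv> mu \<nu> (x + \<alpha> *\<^sub>R dx) (s + \<alpha> *\<^sub>R ds)"
  shows "near_central n K \<nu> F (x + \<alpha> *\<^sub>R dx) (s + \<alpha> *\<^sub>R ds) (21/1000) \<mu>'"
    "\<tau> + \<alpha> * d\<tau> > 0" "\<kappa> + \<alpha> * d\<kappa> > 0"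
    "8999/10000 * \<mu>' \<le> (\<kappa> + \<alpha> * d\<kappa>) * (\<tau> + \<alpha> * d\<tau>)"
    "(\<kappa> + \<alpha> * d\<kappa>) * (\<tau> + \<alpha> * d\<tau>) \<le> 9051/10000 * \<mu>'"
    "\<nu> * \<mu>' + (\<kappa> + \<alpha> * d\<kappa>) * (\<tau> + \<alpha> * d\<tau>) = (1 - \<alpha>) * (\<nu> * \<mu> + \<kappa> * \<tau>)"
proof -
  note eqs = predictor_eqs[OF pred]
  define Q where "Q = dx \<bullet> ds / \<mu>"
  note size = predictor_size[OF pred Q_def]
  define k where "k = 1 - \<alpha> * 1 + \<alpha>\<^sup>2 * Q / \<nu>"
  define q where "q = \<alpha>\<^sup>2 * Q"
  have "\<alpha>\<^sup>2 * (\<nu> + \<beta> / 2) \<le> \<alpha>\<^sup>2 * (\<nu> + 905/2000)"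
    by (intro mult_left_mono) (use \<beta>_bd(2) in auto)
  then have small: "\<alpha>\<^sup>2 * (\<nu> + \<beta> / 2) < 9596/10000 * (25/1000000)" using \<alpha>(3) by linarith
  have "\<bar>q\<bar> \<le> \<alpha>\<^sup>2 * (\<nu> + \<beta> / 2)"
    using size(2) by (simp add: q_def abs_mult mult_left_mono)
  then have q: "\<bar>q\<bar> \<le> 25/1000000" using small by linarith
  have qn: "\<bar>q / \<nu>\<bar> \<le> \<bar>q\<bar>" using nu1 by (simp add: divide_le_eq mult_le_cancel_left1)
  have qb: "q \<le> 25/1000000" "- q \<le> 25/1000000" "q / \<nu> \<le> 25/1000000" "- (q / \<nu>) \<le> 25/1000000"
    using q qn by linarith+
  have kq: "k = 1 - \<alpha> + q / \<nu>" by (simp add: k_def q_def)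
  have k: "994975/1000000 \<le> k" "k \<le> 1000025/1000000" "\<bar>k - 1\<bar> \<le> 5025/1000000"
    using kq q qn \<alpha> by linarith+
  have delta: "\<delta> = 404/10000" by (simp add: \<eta> power2_eq_square)
  \<comment> \<open>\<open>5/1000\<close> is \<open>\<omega>\<close>: dividing
    \<open>\<alpha>\<^sup>2 * (\<nu> + \<beta> / 2)\<close> by \<open>1 - \<delta>\<close> leaves
    less than its square.\<close>
  have N: "\<alpha> * N x dx < 5/1000"
  proof (rule power2_less_imp_less)
    have "9596/10000 * (N x dx)\<^sup>2 \<le> \<nu> + \<beta> / 2"
      using scaling_ge[OF eqs(1)] size(1) by (simp add: delta)
    then have "\<alpha>\<^sup>2 * (9596/10000 * (N x dx)\<^sup>2) \<le> \<alpha>\<^sup>2 * (\<nu> + \<beta> / 2)" by (intro mult_left_mono) auto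
    moreover have "9596/10000 * (\<alpha> * N x dx)\<^sup>2 = \<alpha>\<^sup>2 * (9596/10000 * (N x dx)\<^sup>2)"
      by (simp add: power_mult_distrib)
    ultimately have "(\<alpha> * N x dx)\<^sup>2 < 25/1000000" using small by linarith
    then show "(\<alpha> * N x dx)\<^sup>2 < (5/1000)\<^sup>2" by (simp add: power2_eq_square)
  qed simp
  have mu': "\<mu>' = \<mu> * k"
    unfolding \<mu>'_def k_def by (rule step_mu[OF eqs(1,6) Q_def])
  have B: "(1 - \<alpha>) * \<eta> + 25/1000000 + \<delta> * (5/1000) + \<bar>k - 1\<bar> * (5/1000) + 7 * k * (5/1000)\<^sup>2
      \<le> 21/1000 * k * (1 - 3.1 * (5/1000))"
    unfolding delta by (simp add: \<eta> power2_eq_square) (use k \<alpha>(1) in argo)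
  show "near_central n K \<nu> F (x + \<alpha> *\<^sub>R dx) (s + \<alpha> *\<^sub>R ds) (21/1000) \<mu>'"
    unfolding mu'
    by (rule step_near_central[OF eqs(1,6) Q_def _ _ N _ k_def _ q[unfolded q_def] B]) (use \<alpha> k in auto)
  have tk: "(d\<tau> / \<tau>) * (d\<kappa> / \<kappa>) = - (Q / \<beta>)" using size(4) beta_pos by (simp add: field_simps)
  have t2: "(d\<tau> / \<tau>)\<^sup>2 \<le> 2 * (\<bar>Q\<bar> / \<beta>) + 1" "(d\<kappa> / \<kappa>)\<^sup>2 \<le> 2 * (\<bar>Q\<bar> / \<beta>) + 1"
    by (rule complementary_products[OF size(3)]; use tk beta_pos in \<open>simp add: divide_right_mono\<close>)+
  have "\<alpha>\<^sup>2 * (2 * (\<bar>Q\<bar> / \<beta>) + 1) = 2 * (\<bar>q\<bar> / \<beta>) + \<alpha>\<^sup>2"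
    by (simp add: q_def abs_mult algebra_simps)
  also have "\<bar>q\<bar> / \<beta> \<le> (25/1000000) / (9/10)" using q \<beta>_bd by (intro frac_le) auto
  also have "\<alpha>\<^sup>2 \<le> (5/1000)\<^sup>2" using \<alpha> by (intro power_mono) auto
  also have "2 * ((25/1000000) / (9/10)) + (5/1000)\<^sup>2 < (1 :: real)" by (simp add: power2_eq_square)
  finally have "\<alpha>\<^sup>2 * (2 * (\<bar>Q\<bar> / \<beta>) + 1) < 1" by simp
  then have "\<alpha>\<^sup>2 * (d\<tau> / \<tau>)\<^sup>2 < 1" "\<alpha>\<^sup>2 * (d\<kappa> / \<kappa>)\<^sup>2 < 1"
    using mult_left_mono[OF t2(1), of "\<alpha>\<^sup>2"] mult_left_mono[OF t2(2), of "\<alpha>\<^sup>2"] by auto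
  then show "\<tau> + \<alpha> * d\<tau> > 0" "\<kappa> + \<alpha> * d\<kappa> > 0"
    using \<tau> \<kappa> by (auto intro: positive_after_step)
  have "(\<kappa> + \<alpha> * d\<kappa>) * (\<tau> + \<alpha> * d\<tau>) = \<kappa> * \<tau> + \<alpha> * (\<tau> * d\<kappa> + \<kappa> * d\<tau>) + \<alpha>\<^sup>2 * (d\<tau> * d\<kappa>)"
    by (simp add: power2_eq_square algebra_simps)
  also have "d\<tau> * d\<kappa> = - (\<mu> * Q)" using predictor_orthogonal[OF pred] mu_pos by (simp add: Q_def)
  also have "\<kappa> * \<tau> + \<alpha> * (\<tau> * d\<kappa> + \<kappa> * d\<tau>) + \<alpha>\<^sup>2 * - (\<mu> * Q) = \<mu> * (\<beta> * (1 - \<alpha>) - q)"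
    unfolding eqs(5) \<beta> by (simp add: q_def algebra_simps)
  finally have tk': "(\<kappa> + \<alpha> * d\<kappa>) * (\<tau> + \<alpha> * d\<tau>) = \<mu> * (\<beta> * (1 - \<alpha>) - q)" .
  have u: "\<beta> * (1 - \<alpha>) \<le> 905/1000 * (1 - \<alpha>)" "9/10 * (1 - \<alpha>) \<le> \<beta> * (1 - \<alpha>)"
    using \<beta>_bd \<alpha> by (intro mult_right_mono; simp)+
  have "8999/10000 * k \<le> \<beta> * (1 - \<alpha>) - q" using u qb \<alpha>(1,2) kq by argo
  then show "8999/10000 * \<mu>' \<le> (\<kappa> + \<alpha> * d\<kappa>) * (\<tau> + \<alpha> * d\<tau>)"
    unfolding tk' mu' using mu_pos by (simp add: mult.left_commute)
  have "\<beta> * (1 - \<alpha>) - q \<le> 9051/10000 * k" using u qb \<alpha>(1,2) kq by argo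
  then show "(\<kappa> + \<alpha> * d\<kappa>) * (\<tau> + \<alpha> * d\<tau>) \<le> 9051/10000 * \<mu>'"
    unfolding tk' mu' using mu_pos by (simp add: mult.left_commute)
  show "\<nu> * \<mu>' + (\<kappa> + \<alpha> * d\<kappa>) * (\<tau> + \<alpha> * d\<tau>) = (1 - \<alpha>) * (\<nu> * \<mu> + \<kappa> * \<tau>)"
    unfolding tk' mu' kq \<beta> using nu1 by (simp add: field_simps)
qed

text \<open>Here \<open>l = 0\<close>, so \<open>\<mu>\<close> changes only to second order and the
  centrality error is multiplied by \<open>15/100\<close> up to small terms. The centering parameter
  \<open>9025/10000\<close> is the midpoint of \<open>9/10\<close> and \<open>905/1000\<close>; the
  ratio \<open>\<kappa> * \<tau> / \<mu>\<close> moves 85 percent of the way towards it and so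
  re-enters that interval.\<close>

lemma corrector_point:
  assumes \<beta>_bd: "8999/10000 \<le> \<beta>" "\<beta> \<le> 9051/10000"
    and corr: "newton 0 (9025/10000 * \<mu> - \<kappa> * \<tau>) (- P) ((dx, d\<tau>), dy, (ds, d\<kappa>))"
    and \<alpha>: "\<alpha> = 85/100"
  defines "\<mu>' \<equiv> mu \<nu> (x + \<alpha> *\<^sub>R dx) (s + \<alpha> *\<^sub>R ds)"
  shows "near_central n K \<nu> F (x + \<alpha> *\<^sub>R dx) (s + \<alpha> *\<^sub>R ds) (1/50) \<mu>'"
    "\<tau> + \<alpha> * d\<tau> > 0" "\<kappa> + \<alpha> * d\<kappa> > 0"
    "9/10 * \<mu>' \<le> (\<kappa> + \<alpha> * d\<kappa>) * (\<tau> + \<alpha> * d\<tau>)"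
    "(\<kappa> + \<alpha> * d\<kappa>) * (\<tau> + \<alpha> * d\<tau>) \<le> 905/1000 * \<mu>'"
    "\<nu> * \<mu>' + (\<kappa> + \<alpha> * d\<kappa>) * (\<tau> + \<alpha> * d\<tau>) \<le> \<nu> * \<mu> + \<kappa> * \<tau> + 221/100000 * \<mu>"
proof -
  have eqs: "dx \<in> Rn n" "dy \<in> Rn m" "ds \<in> Rn n"
    "hsd_G m n A b c (dy, dx, d\<tau>) = (0, ds, d\<kappa>)"
    "\<tau> * d\<kappa> + \<kappa> * d\<tau> = 9025/10000 * \<mu> - \<kappa> * \<tau>"
    "ds = - P + (0 * \<mu>) *\<^sub>R g x - \<mu> *\<^sub>R W x s dx"
    using corr mu by (auto simp: newton_system_def \<psi>_def algebra_simps eq_diff_eq)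
  have orth: "dx \<bullet> ds + d\<tau> * d\<kappa> = 0" by (rule hsd_G_skew[OF eqs(1,2,4)])
  define Q where "Q = dx \<bullet> ds / \<mu>"
  define p where "p = N x dx"
  define e where "e = (9025/10000 - \<beta>) / \<beta>"
  have p0: "p \<ge> 0" using x eqs by (simp add: p_def)
  have b0: "\<beta> > 0" by (rule beta_pos)
  have tke: "d\<tau> / \<tau> + d\<kappa> / \<kappa> = e"
  proof -
    have "d\<tau> / \<tau> + d\<kappa> / \<kappa> = (\<tau> * d\<kappa> + \<kappa> * d\<tau>) / (\<kappa> * \<tau>)"
      using \<tau> \<kappa> by (simp add: field_simps)
    also have "\<dots> = (\<mu> * (9025/10000 - \<beta>)) / (\<mu> * \<beta>)"
      unfolding eqs(5) \<beta> by (simp add: algebra_simps)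
    finally show ?thesis using mu_pos by (simp add: e_def)
  qed
  have e: "\<bar>e\<bar> \<le> 3/1000"
  proof -
    have "e \<le> 3/1000" "- e \<le> 3/1000"
      unfolding e_def minus_divide_left using \<beta>_bd b0 by (simp_all add: pos_divide_le_eq)
    then show ?thesis by simp
  qed
  have e2: "e\<^sup>2 \<le> 9/1000000"
    using power_mono[OF e, of 2] by (simp add: power2_eq_square)
  have prod: "\<beta> * ((d\<tau> / \<tau>) * (d\<kappa> / \<kappa>)) = - Q"
  proof -
    have "\<mu> * (\<beta> * ((d\<tau> / \<tau>) * (d\<kappa> / \<kappa>))) = \<kappa> * \<tau> * ((d\<tau> / \<tau>) * (d\<kappa> / \<kappa>))"
      unfolding \<beta> by simp
    also have "\<dots> = \<mu> * (- Q)"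
      using orth \<tau> \<kappa> mu_pos by (simp add: Q_def)
    finally show ?thesis using mu_pos by (metis less_irrefl mult_cancel_left)
  qed
  have "(d\<tau> / \<tau>) * (d\<kappa> / \<kappa>) \<le> e\<^sup>2 / 4" by (rule product_le_quarter_square[OF tke])
  also have "\<dots> \<le> 225/100000000" using e2 by simp
  finally have "\<beta> * ((d\<tau> / \<tau>) * (d\<kappa> / \<kappa>)) \<le> \<beta> * (225/100000000)"
    using b0 by (intro mult_left_mono) auto
  then have Qlow: "- Q \<le> 204/100000000" using prod \<beta>_bd(2) by linarith
  have Qa: "Q = - (P \<bullet> dx / \<mu>) - W x s dx \<bullet> dx"
    using mu_pos by (simp add: Q_def eqs(6) inner_diff_right inner_commute[of dx] diff_divide_distrib)
  have Pdx: "\<bar>P \<bullet> dx / \<mu>\<bar> \<le> 21/1000 * p"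
  proof -
    have "\<bar>P \<bullet> dx\<bar> \<le> \<eta> * \<mu> * p" using dual_leD[OF psi eqs(1)] by (simp add: p_def)
    then have "\<bar>P \<bullet> dx / \<mu>\<bar> \<le> \<eta> * p" using mu_pos by (simp add: field_simps)
    also have "\<dots> \<le> 21/1000 * p" using eta p0 by (intro mult_right_mono) auto
    finally show ?thesis .
  qed
  have "(1 - 425/10000) * p\<^sup>2 \<le> (1 - \<delta>) * p\<^sup>2" using delta_le by (intro mult_right_mono) auto
  then have Wp: "9575/10000 * p\<^sup>2 \<le> W x s dx \<bullet> dx"
    using scaling_ge[OF eqs(1)] by (simp add: p_def)
  \<comment> \<open>\<open>9575/10000 * p\<^sup>2\<close> is at most \<open>21/1000 * p\<close> plus
    the tiny bound on \<open>- Q\<close>. The threshold lies slightly above the quotient of the two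
    coefficients, which absorbs that bound.\<close>
  have p: "p < 223/10000"
  proof (rule ccontr)
    assume "\<not> p < 223/10000"
    then have "223/10000 * p \<le> p\<^sup>2" unfolding power2_eq_square using p0 by (intro mult_right_mono) auto
    moreover have "- (P \<bullet> dx / \<mu>) \<le> 21/1000 * p" using Pdx by linarith
    ultimately show False using Wp Qa Qlow \<open>\<not> p < 223/10000\<close> by linarith
  qed
  have W0: "W x s dx \<bullet> dx \<ge> 0" by (rule scaling_nonneg[OF eqs(1)])
  \<comment> \<open>The value is \<open>21/1000 * 223/10000\<close>.\<close>
  have Qhigh: "Q \<le> 46830/100000000" using Qa Pdx p W0 by linarith
  define k where "k = 1 - \<alpha> * 0 + \<alpha>\<^sup>2 * Q / \<nu>"
  define q where "q = \<alpha>\<^sup>2 * Q"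
  have q: "- q \<le> 204/100000000" "q \<le> 339/1000000"
    using Qlow Qhigh by (simp_all add: q_def \<alpha> power2_eq_square)
  have qabs: "\<bar>\<alpha>\<^sup>2 * Q\<bar> \<le> 339/1000000" using q by (simp add: q_def[symmetric] abs_le_iff)
  have kq: "k = 1 + q / \<nu>" by (simp add: k_def q_def)
  have qn: "- (q / \<nu>) \<le> 204/100000000" "q / \<nu> \<le> 339/1000000"
  proof -
    have "- q / \<nu> \<le> (204/100000000) / \<nu>" using q nu1 by (intro divide_right_mono) auto
    also have "\<dots> \<le> (204/100000000) / 1" using nu1 by (intro divide_left_mono) auto
    finally show "- (q / \<nu>) \<le> 204/100000000" by simp
    have "q / \<nu> \<le> (339/1000000) / \<nu>" using q nu1 by (intro divide_right_mono) auto
    also have "\<dots> \<le> (339/1000000) / 1" using nu1 by (intro divide_left_mono) auto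
    finally show "q / \<nu> \<le> 339/1000000" by simp
  qed
  have k: "9999/10000 \<le> k" "k \<le> 10004/10000" "\<bar>k - 1\<bar> \<le> 4/10000"
    using kq qn by (simp_all add: abs_le_iff)
  \<comment> \<open>The radius rounds up \<open>85/100 * 223/10000\<close> and stays below the
    \<open>1/50\<close> required of a small step.\<close>
  have N: "\<alpha> * N x dx < 19/1000" using p by (simp add: p_def[symmetric] \<alpha>)
  have mu': "\<mu>' = \<mu> * k"
    unfolding \<mu>'_def k_def by (rule step_mu[OF eqs(1,6) Q_def])
  have B: "(1 - \<alpha>) * \<eta> + 339/1000000 + \<delta> * (19/1000) + \<bar>k - 1\<bar> * (19/1000) + 7 * k * (19/1000)\<^sup>2
      \<le> 1/50 * k * (1 - 3.1 * (19/1000))"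
  proof -
    have "(1 - \<alpha>) * \<eta> \<le> 315/100000" using eta by (simp add: \<alpha>)
    moreover have "\<delta> * (19/1000) \<le> 81/100000" using delta_le by simp
    moreover have "\<bar>k - 1\<bar> * (19/1000) \<le> 1/100000" using k by simp
    moreover have "7 * k * (19/1000)\<^sup>2 \<le> 253/100000" using k by (simp add: power2_eq_square)
    moreover have "1/50 * k * (1 - 3.1 * (19/1000)) \<ge> 18/1000" using k by simp
    ultimately show ?thesis by linarith
  qed
  show "near_central n K \<nu> F (x + \<alpha> *\<^sub>R dx) (s + \<alpha> *\<^sub>R ds) (1/50) \<mu>'"
    unfolding mu'
    by (rule step_near_central[OF eqs(1,6) Q_def _ _ N _ k_def _ qabs B]) (use \<alpha> k in auto)
  have tk: "(d\<tau> / \<tau>) * (d\<kappa> / \<kappa>) = - (Q / \<beta>)" using prod b0 by (simp add: field_simps)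
  have Qb: "\<bar>Q\<bar> / \<beta> \<le> (1/1000) / (8999/10000)"
    using Qlow Qhigh \<beta>_bd by (intro frac_le) (auto simp: abs_le_iff)
  have t2: "(d\<tau> / \<tau>)\<^sup>2 \<le> 2 * (\<bar>Q\<bar> / \<beta>) + 1" "(d\<kappa> / \<kappa>)\<^sup>2 \<le> 2 * (\<bar>Q\<bar> / \<beta>) + 1"
    by (rule complementary_products[OF tke]; use tk b0 e in \<open>simp add: divide_right_mono\<close>)+
  have "\<alpha>\<^sup>2 * (2 * (\<bar>Q\<bar> / \<beta>) + 1) < 1" using Qb by (simp add: \<alpha> power2_eq_square)
  then have "\<alpha>\<^sup>2 * (d\<tau> / \<tau>)\<^sup>2 < 1" "\<alpha>\<^sup>2 * (d\<kappa> / \<kappa>)\<^sup>2 < 1"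
    using mult_left_mono[OF t2(1), of "\<alpha>\<^sup>2"] mult_left_mono[OF t2(2), of "\<alpha>\<^sup>2"] by auto
  then show "\<tau> + \<alpha> * d\<tau> > 0" "\<kappa> + \<alpha> * d\<kappa> > 0"
    using \<tau> \<kappa> by (auto intro: positive_after_step)
  have "(\<kappa> + \<alpha> * d\<kappa>) * (\<tau> + \<alpha> * d\<tau>) = \<kappa> * \<tau> + \<alpha> * (\<tau> * d\<kappa> + \<kappa> * d\<tau>) + \<alpha>\<^sup>2 * (d\<tau> * d\<kappa>)"
    by (simp add: power2_eq_square algebra_simps)
  also have "d\<tau> * d\<kappa> = - (\<mu> * Q)" using orth mu_pos by (simp add: Q_def)
  also have "\<kappa> * \<tau> + \<alpha> * (\<tau> * d\<kappa> + \<kappa> * d\<tau>) + \<alpha>\<^sup>2 * - (\<mu> * Q)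
      = \<mu> * (15/100 * \<beta> + 85/100 * (9025/10000) - q)"
    unfolding eqs(5) \<beta> by (simp add: q_def \<alpha> algebra_simps)
  finally have tk': "(\<kappa> + \<alpha> * d\<kappa>) * (\<tau> + \<alpha> * d\<tau>) = \<mu> * (15/100 * \<beta> + 85/100 * (9025/10000) - q)" .
  have "9/10 * k \<le> 15/100 * \<beta> + 85/100 * (9025/10000) - q" using \<beta>_bd q qn kq by linarith
  then show "9/10 * \<mu>' \<le> (\<kappa> + \<alpha> * d\<kappa>) * (\<tau> + \<alpha> * d\<tau>)"
    unfolding tk' mu' using mu_pos by (simp add: mult.left_commute)
  have "15/100 * \<beta> + 85/100 * (9025/10000) - q \<le> 905/1000 * k" using \<beta>_bd q qn kq by linarith
  then show "(\<kappa> + \<alpha> * d\<kappa>) * (\<tau> + \<alpha> * d\<tau>) \<le> 905/1000 * \<mu>'"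
    unfolding tk' mu' using mu_pos by (simp add: mult.left_commute)
  \<comment> \<open>The second-order terms cancel again. Only the pull towards the midpoint remains,
    at most \<open>85/100 * (9025/10000 - 8999/10000) = 221/100000\<close> times
    \<open>\<mu>\<close>.\<close>
  have "\<nu> * \<mu>' + (\<kappa> + \<alpha> * d\<kappa>) * (\<tau> + \<alpha> * d\<tau>)
      = \<nu> * \<mu> + \<kappa> * \<tau> + \<mu> * (85/100 * (9025/10000 - \<beta>))"
    unfolding tk' mu' kq \<beta> using nu1 by (simp add: field_simps)
  also have "\<dots> \<le> \<nu> * \<mu> + \<kappa> * \<tau> + \<mu> * (221/100000)"
    using \<beta>_bd mu_pos by (intro add_left_mono mult_left_mono) auto
  finally show "\<nu> * \<mu>' + (\<kappa> + \<alpha> * d\<kappa>) * (\<tau> + \<alpha> * d\<tau>) \<le> \<nu> * \<mu> + \<kappa> * \<tau> + 221/100000 * \<mu>"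
    by (simp add: mult.commute)
qed

end

section \<open>The two half-steps as maps between two neighbourhoods\<close>

locale hsd_problem = lhscb +
  fixes m :: nat and A :: "nat \<Rightarrow> nat \<Rightarrow> real" and b c :: rseq
  assumes A: "full_row_rank m n A" and b: "b \<in> Rn m" and c: "c \<in> Rn n"
begin

definition nbhd :: "real \<Rightarrow> real \<Rightarrow> real \<Rightarrow> point \<Rightarrow> bool" where
  "nbhd \<eta> \<beta>l \<beta>u = (\<lambda>((x, \<tau>), y, (s, \<kappa>)).
     near_central n K \<nu> F x s \<eta> (mu \<nu> x s) \<and> y \<in> Rn m \<and> 0 < \<tau> \<and> 0 < \<kappa> \<and>
     \<beta>l * mu \<nu> x s \<le> \<kappa> * \<tau> \<and> \<kappa> * \<tau> \<le> \<beta>u * mu \<nu> x s)"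

lemma nbhd_state:
  assumes "nbhd \<eta> \<beta>l \<beta>u ((x, \<tau>), y, (s, \<kappa>))"
  defines "\<beta> \<equiv> \<kappa> * \<tau> / mu \<nu> x s"
  shows "hsd_state n K \<nu> F x s \<eta> (mu \<nu> x s) m A b c y \<tau> \<kappa> \<beta>" "\<beta>l \<le> \<beta>" "\<beta> \<le> \<beta>u"
proof -
  interpret near_central n K \<nu> F x s \<eta> "mu \<nu> x s" using assms by (simp add: nbhd_def)
  show "hsd_state n K \<nu> F x s \<eta> (mu \<nu> x s) m A b c y \<tau> \<kappa> \<beta>"
    by unfold_locales (use assms A b c mu_pos in \<open>auto simp: nbhd_def \<beta>_def\<close>)
  show "\<beta>l \<le> \<beta>" "\<beta> \<le> \<beta>u"
    using assms(1) mu_pos by (simp_all add: nbhd_def \<beta>_def field_simps)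
qed

lemma mu_bar_eq: "\<nu> \<ge> 1 \<Longrightarrow> mu_bar \<nu> ((x, \<tau>), y, (s, \<kappa>)) = (\<nu> * mu \<nu> x s + \<kappa> * \<tau>) / (\<nu> + 1)"
  by (simp add: mu_bar_def mu_def mult.commute)

lemma predictor_step:
  assumes z: "nbhd (1/50) (9/10) (905/1000) z"
    and \<alpha>: "0 < \<alpha>" "\<alpha> \<le> 5/1000" "\<alpha>\<^sup>2 * (\<nu> + 905/2000) < 9596/10000 * (25/1000000)"
  defines "z' \<equiv> z + \<alpha> *\<^sub>R predictor_dir m n U \<nu> F A b c z"
  shows "nbhd (21/1000) (8999/10000) (9051/10000) z'"
    "residual m n A b c z' = (1 - \<alpha>) *\<^sub>R residual m n A b c z"
    "mu_bar \<nu> z' = (1 - \<alpha>) * mu_bar \<nu> z"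
proof -
  obtain x \<tau> y s \<kappa> where zeq: "z = ((x, \<tau>), y, (s, \<kappa>))" by (metis prod.collapse)
  define \<beta> where "\<beta> = \<kappa> * \<tau> / mu \<nu> x s"
  interpret hsd_state n K \<nu> F x s "1/50" "mu \<nu> x s" m A b c y \<tau> \<kappa> \<beta>
    using nbhd_state(1) z by (simp add: zeq \<beta>_def)
  have bd: "9/10 \<le> \<beta>" "\<beta> \<le> 905/1000" unfolding \<beta>_def by (rule nbhd_state(2,3)[OF z[unfolded zeq]])+
  let ?r = "residual m n A b c z"
  have "- fst ?r \<in> Rn m" "- fst (snd ?r) \<in> Rn n"
    using s b c by (auto simp: zeq residual_def hsd_G_def)
  from newton_ex1[OF this, of "- s" "- snd (snd ?r)" "- (\<kappa> * \<tau>)"] s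
  have "\<exists>!\<Delta>. newton (- ?r) (- (\<kappa> * \<tau>)) (- s) \<Delta>" by (simp add: uminus_prod_def)
  from theI'[OF this]
  have "newton (- ?r) (- (\<kappa> * \<tau>)) (- s) (predictor_dir m n U \<nu> F A b c z)"
    by (simp add: predictor_dir_def zeq)
  moreover obtain dx d\<tau> dy ds d\<kappa>
    where d: "predictor_dir m n U \<nu> F A b c z = ((dx, d\<tau>), dy, (ds, d\<kappa>))" by (metis prod.collapse)
  ultimately have new: "newton (- residual m n A b c ((x, \<tau>), y, (s, \<kappa>))) (- (\<kappa> * \<tau>)) (- s) ((dx, d\<tau>), dy, (ds, d\<kappa>))"
    by (simp add: zeq)
  note pt = predictor_point[OF refl bd new \<alpha>]
  have z': "z' = ((x + \<alpha> *\<^sub>R dx, \<tau> + \<alpha> * d\<tau>), y + \<alpha> *\<^sub>R dy, (s + \<alpha> *\<^sub>R ds, \<kappa> + \<alpha> * d\<kappa>))"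
    by (simp add: z'_def zeq d[unfolded zeq])
  show "nbhd (21/1000) (8999/10000) (9051/10000) z'"
    using pt(1-5) y predictor_eqs(2)[OF new] by (simp add: nbhd_def z')
  have "z' = ((x, \<tau>), y, (s, \<kappa>)) + \<alpha> *\<^sub>R ((dx, d\<tau>), dy, (ds, d\<kappa>))"
    by (simp add: z'_def zeq d[unfolded zeq])
  then have "residual m n A b c z' = ?r + \<alpha> *\<^sub>R (- ?r)"
    using residual_step predictor_eqs(4)[OF new] by (simp add: zeq)
  then show "residual m n A b c z' = (1 - \<alpha>) *\<^sub>R ?r" by (simp add: algebra_simps)
  show "mu_bar \<nu> z' = (1 - \<alpha>) * mu_bar \<nu> z"
    using pt(6) by (simp add: z' zeq mu_bar_eq[OF nu1])
qed

lemma corrector_step: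
  assumes z: "nbhd (21/1000) (8999/10000) (9051/10000) z"
  defines "z' \<equiv> z + (85/100) *\<^sub>R corrector_dir m n U \<nu> F A b c (9025/10000) z"
  shows "nbhd (1/50) (9/10) (905/1000) z'"
    "residual m n A b c z' = residual m n A b c z"
    "mu_bar \<nu> z' \<le> (1 + 221/100000 / (\<nu> + 8999/10000)) * mu_bar \<nu> z" "mu_bar \<nu> z > 0"
proof -
  obtain x \<tau> y s \<kappa> where zeq: "z = ((x, \<tau>), y, (s, \<kappa>))" by (metis prod.collapse)
  define \<beta> where "\<beta> = \<kappa> * \<tau> / mu \<nu> x s"
  define \<mu> where "\<mu> = mu \<nu> x s"
  interpret hsd_state n K \<nu> F x s "21/1000" \<mu> m A b c y \<tau> \<kappa> \<beta>
    using nbhd_state(1) z by (simp add: zeq \<beta>_def \<mu>_def)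
  have bd: "8999/10000 \<le> \<beta>" "\<beta> \<le> 9051/10000" unfolding \<beta>_def by (rule nbhd_state(2,3)[OF z[unfolded zeq]])+
  define \<theta> where "\<theta> = 9025/10000 * \<mu> - \<kappa> * \<tau>"
  have "\<exists>!\<Delta>. newton (0, 0, 0) \<theta> (- P) \<Delta>" by (rule newton_ex1) auto
  from theI'[OF this]
  have "newton 0 \<theta> (- P) (corrector_dir m n U \<nu> F A b c (9025/10000) z)"
    by (simp add: corrector_dir_def zeq \<theta>_def \<mu>_def[symmetric] zero_prod_def)
  moreover obtain dx d\<tau> dy ds d\<kappa>
    where d: "corrector_dir m n U \<nu> F A b c (9025/10000) z = ((dx, d\<tau>), dy, (ds, d\<kappa>))" by (metis prod.collapse)
  ultimately have new: "newton 0 (9025/10000 * \<mu> - \<kappa> * \<tau>) (- P) ((dx, d\<tau>), dy, (ds, d\<kappa>))"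
    by (simp add: \<theta>_def)
  note pt = corrector_point[OF bd new refl]
  have eqs: "dy \<in> Rn m" "hsd_G m n A b c (dy, dx, d\<tau>) - (0, ds, d\<kappa>) = 0"
    using new by (simp_all add: newton_system_def)
  have z'1: "z' = ((x, \<tau>), y, (s, \<kappa>)) + (85/100) *\<^sub>R ((dx, d\<tau>), dy, (ds, d\<kappa>))"
    using d by (simp only: z'_def zeq)
  have z': "z' = ((x + (85/100) *\<^sub>R dx, \<tau> + (85/100) * d\<tau>), y + (85/100) *\<^sub>R dy,
      (s + (85/100) *\<^sub>R ds, \<kappa> + (85/100) * d\<kappa>))"
    by (simp add: z'1)
  show "nbhd (1/50) (9/10) (905/1000) z'"
    unfolding z' nbhd_def using pt(1-5) y eqs(1) by simp
  show "residual m n A b c z' = residual m n A b c z"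
    unfolding z'1 residual_step eqs(2) by (simp add: zeq)
  define M where "M = \<nu> * \<mu> + \<kappa> * \<tau>"
  \<comment> \<open>The lower bound on \<open>\<kappa> * \<tau>\<close> turns the additive increase
    by a multiple of \<open>\<mu>\<close> into a relative increase of the total
    complementarity.\<close>
  have "(\<nu> + 8999/10000) * \<mu> \<le> M"
    using bd(1) mu_pos by (simp add: M_def \<beta> distrib_right)
  then have "\<mu> \<le> M / (\<nu> + 8999/10000)" using nu1 by (simp add: field_simps)
  then have "M + 221/100000 * \<mu> \<le> M + 221/100000 * (M / (\<nu> + 8999/10000))"
    by (intro add_left_mono mult_left_mono) auto
  also have "\<dots> = (1 + 221/100000 / (\<nu> + 8999/10000)) * M" by (simp add: distrib_right)
  finally have "M + 221/100000 * \<mu> \<le> (1 + 221/100000 / (\<nu> + 8999/10000)) * M" .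
  then have "mu_bar \<nu> z' * (\<nu> + 1) \<le> (1 + 221/100000 / (\<nu> + 8999/10000)) * M"
    using pt(6) nu1 unfolding z' by (simp add: mu_bar_eq M_def)
  moreover have M: "mu_bar \<nu> z = M / (\<nu> + 1)" using nu1 by (simp add: zeq mu_bar_eq M_def \<mu>_def)
  ultimately show "mu_bar \<nu> z' \<le> (1 + 221/100000 / (\<nu> + 8999/10000)) * mu_bar \<nu> z"
    using nu1 by (simp add: pos_le_divide_eq)
  have "M > 0" using nu1 mu_pos \<tau> \<kappa> by (auto simp: M_def intro!: add_pos_pos)
  then show "mu_bar \<nu> z > 0" using nu1 by (simp add: M)
qed

end

section \<open>Convergence\<close>

text \<open>The corrector loss is of order \<open>1 / \<nu>\<close>, which the arithmetic-geometric
  inequality dominates by a multiple of \<open>1 / sqrt \<nu>\<close>. The number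
  \<open>18972/10000\<close> is \<open>2 * 9486/10000\<close>, where the square of
  \<open>9486/10000\<close> is just below \<open>8999/10000\<close>. The loss is then below
  \<open>12/10000\<close>, against a gain of \<open>39/10000\<close>.\<close>

lemma rate_bound:
  fixes \<nu> \<alpha> :: real
  assumes \<nu>: "\<nu> \<ge> 1" and \<alpha>: "39/10000 / sqrt \<nu> \<le> \<alpha>"
  shows "(1 - \<alpha>) * (1 + 221/100000 / (\<nu> + 8999/10000)) \<le> 1 - 27/10000 / sqrt \<nu>"
proof -
  define u where "u = 221/100000 / (\<nu> + 8999/10000)"
  have s: "sqrt \<nu> > 0" "(sqrt \<nu>)\<^sup>2 = \<nu>" using \<nu> by auto
  have "18972/10000 * sqrt \<nu> \<le> \<nu> + 8999/10000"
  proof -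
    have "(sqrt \<nu> - 9486/10000)\<^sup>2 = (sqrt \<nu>)\<^sup>2 - 18972/10000 * sqrt \<nu> + (9486/10000)\<^sup>2"
      by (simp add: power2_diff)
    moreover have "(9486/10000)\<^sup>2 \<le> (8999/10000 :: real)" by (simp add: power2_eq_square)
    ultimately show ?thesis using s(2) zero_le_power2[of "sqrt \<nu> - 9486/10000"] by linarith
  qed
  then have "u \<le> 221/100000 / (18972/10000 * sqrt \<nu>)"
    unfolding u_def using s(1) \<nu> by (intro divide_left_mono mult_pos_pos) auto
  also have "\<dots> = 221/189720 * (1 / sqrt \<nu>)" by simp
  finally have u: "u \<le> 221/189720 * (1 / sqrt \<nu>)" .
  have pos: "1 / sqrt \<nu> > 0" using s by simp
  have \<alpha>': "39/10000 * (1 / sqrt \<nu>) \<le> \<alpha>" using \<alpha> by simp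
  have "u \<ge> 0" using \<nu> by (simp add: u_def)
  moreover have "\<alpha> \<ge> 0" using \<alpha>' pos by linarith
  ultimately have "\<alpha> * u \<ge> 0" by simp
  then have "(1 - \<alpha>) * (1 + u) \<le> 1 - \<alpha> + u" by (simp add: algebra_simps)
  also have "\<dots> \<le> 1 - 27/10000 * (1 / sqrt \<nu>)" using u \<alpha>' pos by linarith
  finally show ?thesis by (simp add: u_def)
qed

lemma power_decay:
  fixes d \<epsilon> :: real
  assumes d: "0 \<le> d" "d \<le> 1" and \<epsilon>: "0 < \<epsilon>" and N: "ln (1 / \<epsilon>) \<le> d * real N"
  shows "(1 - d) ^ N \<le> \<epsilon>"
proof -
  have "(1 - d) ^ N \<le> exp (- d) ^ N"
    using d exp_ge_add_one_self[of "- d"] by (intro power_mono) auto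
  also have "\<dots> = exp (- (d * real N))" by (simp add: mult.commute flip: exp_of_nat_mult)
  also have "\<dots> \<le> exp (- ln (1 / \<epsilon>))" using N by simp
  also have "\<dots> = \<epsilon>" using \<epsilon> by (simp add: ln_div)
  finally show ?thesis .
qed

context hsd_problem
begin

text \<open>With \<open>s0 = - g x0\<close> the complementarity measure is \<open>1\<close> and the
  centrality error vanishes, so the point lies exactly on the central path.\<close>

lemma initial_point_in_nbhd:
  assumes x0: "x0 \<in> U" and y0: "y0 \<in> Rn m" and \<beta>0: "9/10 \<le> \<beta>0" "\<beta>0 \<le> 905/1000"
  shows "nbhd (1/50) (9/10) (905/1000) (initial_point n U F x0 y0 \<beta>0)"
proof -
  have nu: "\<nu> \<ge> 1" by (rule nu_ge_1[OF x0])
  have mu: "mu \<nu> x0 (- g x0) = 1" using grad_self[OF x0] nu by (simp add: mu_def inner_commute)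
  have "near_central n K \<nu> F x0 (- g x0) (1/50) 1"
    by unfold_locales (use x0 grad_spec(1)[OF x0] mu in \<open>auto simp: dual_le_def \<psi>_def\<close>)
  then show ?thesis using y0 \<beta>0 by (simp add: initial_point_def nbhd_def mu)
qed

lemma pc_iterate_bounds:
  assumes z0: "nbhd (1/50) (9/10) (905/1000) z0" and nu: "\<nu> \<ge> 1"
    and \<alpha>: "0 < \<alpha>" "\<alpha> \<le> 5/1000" "\<alpha>\<^sup>2 * (\<nu> + 905/2000) < 9596/10000 * (25/1000000)"
      "39/10000 / sqrt \<nu> \<le> \<alpha>"
  defines "z \<equiv> pc_iterate m n U \<nu> F A b c \<alpha> (85/100) (9025/10000) z0"
    and "d \<equiv> 27/10000 / sqrt \<nu>"
  shows "nbhd (1/50) (9/10) (905/1000) (z k)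
    \<and> mu_bar \<nu> (z k) \<le> (1 - d) ^ k * mu_bar \<nu> (z 0)
    \<and> norm (residual m n A b c (z k)) \<le> (1 - d) ^ k * norm (residual m n A b c (z 0))"
proof (induction k)
  case 0
  then show ?case using z0 by (simp add: z_def pc_iterate_def)
next
  case (Suc k)
  let ?r = "residual m n A b c"
  have "d \<le> 27/10000 / 1" unfolding d_def using nu by (intro divide_left_mono) auto
  then have d: "d \<le> 1" by simp
  have d\<alpha>: "1 - \<alpha> \<le> 1 - d"
  proof -
    have "d \<le> 39/10000 / sqrt \<nu>" unfolding d_def using nu by (intro divide_right_mono) auto
    then show ?thesis using \<alpha>(4) by simp
  qed
  define w where "w = z k + \<alpha> *\<^sub>R predictor_dir m n U \<nu> F A b c (z k)"
  have zS: "z (Suc k) = w + (85/100) *\<^sub>R corrector_dir m n U \<nu> F A b c (9025/10000) w"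
    by (simp add: z_def pc_iterate_def pc_step_def w_def Let_def)
  note p = predictor_step[OF conjunct1[OF Suc] \<alpha>(1-3), folded w_def]
  note q = corrector_step[OF p(1), folded zS]
  have "mu_bar \<nu> (z (Suc k)) \<le> (1 + 221/100000 / (\<nu> + 8999/10000)) * ((1 - \<alpha>) * mu_bar \<nu> (z k))"
    using q(3) by (simp add: p(2,3))
  also have "\<dots> = ((1 - \<alpha>) * (1 + 221/100000 / (\<nu> + 8999/10000))) * mu_bar \<nu> (z k)" by simp
  also have "\<dots> \<le> (1 - d) * mu_bar \<nu> (z k)"
  proof (rule mult_right_mono)
    show "(1 - \<alpha>) * (1 + 221/100000 / (\<nu> + 8999/10000)) \<le> 1 - d"
      unfolding d_def by (rule rate_bound[OF nu \<alpha>(4)])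
    \<comment> \<open>Positivity is inferred backwards from the point after the predictor, whose
      measure is exactly \<open>1 - \<alpha>\<close> times this one.\<close>
    have "(1 - \<alpha>) * mu_bar \<nu> (z k) > 0" using q(4) by (simp add: p(3))
    then show "0 \<le> mu_bar \<nu> (z k)" using \<alpha>(2) by (simp add: zero_less_mult_iff)
  qed
  also have "\<dots> \<le> (1 - d) * ((1 - d) ^ k * mu_bar \<nu> (z 0))"
    using Suc d by (intro mult_left_mono) auto
  finally have 1: "mu_bar \<nu> (z (Suc k)) \<le> (1 - d) ^ Suc k * mu_bar \<nu> (z 0)" by simp
  have "norm (?r (z (Suc k))) = (1 - \<alpha>) * norm (?r (z k))"
    using \<alpha>(2) by (simp add: q(2) p(2))
  also have "\<dots> \<le> (1 - d) * norm (?r (z k))" using d\<alpha> by (intro mult_right_mono) auto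
  also have "\<dots> \<le> (1 - d) * ((1 - d) ^ k * norm (?r (z 0)))"
    using Suc d by (intro mult_left_mono) auto
  finally have "norm (?r (z (Suc k))) \<le> (1 - d) ^ Suc k * norm (?r (z 0))" by simp
  with q(1) 1 show ?case by simp
qed

lemma complexity:
  assumes z0: "nbhd (1/50) (9/10) (905/1000) z0" and nu: "\<nu> \<ge> 1"
    and \<alpha>: "0 < \<alpha>" "\<alpha> \<le> 5/1000" "\<alpha>\<^sup>2 * (\<nu> + 905/2000) < 9596/10000 * (25/1000000)"
      "39/10000 / sqrt \<nu> \<le> \<alpha>"
    and \<epsilon>: "0 < \<epsilon>" "\<epsilon> < 1"
  defines "z \<equiv> pc_iterate m n U \<nu> F A b c \<alpha> (85/100) (9025/10000) z0"
  shows "\<exists>N::nat. int N \<le> \<lceil>400 * sqrt \<nu> * ln (1 / \<epsilon>)\<rceil> \<and>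
      mu_bar \<nu> (z N) \<le> \<epsilon> * mu_bar \<nu> (z 0) \<and>
      norm (residual m n A b c (z N)) \<le> \<epsilon> * norm (residual m n A b c (z 0))"
proof -
  define L where "L = ln (1 / \<epsilon>)"
  have L: "L > 0" using \<epsilon> by (simp add: L_def)
  define N where "N = nat \<lceil>400 * sqrt \<nu> * L\<rceil>"
  define d where "d = 27/10000 / sqrt \<nu>"
  have "0 \<le> 400 * sqrt \<nu> * L" using L nu by simp
  then have "0 \<le> \<lceil>400 * sqrt \<nu> * L\<rceil>" by (metis ceiling_mono ceiling_zero)
  then have N: "int N = \<lceil>400 * sqrt \<nu> * L\<rceil>" "400 * sqrt \<nu> * L \<le> real N"
    unfolding N_def by (simp_all add: le_nat_iff of_nat_nat)
  have "d \<le> 27/10000 / 1" unfolding d_def using nu by (intro divide_left_mono) auto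
  moreover have "0 \<le> d" using nu by (simp add: d_def)
  ultimately have d: "0 \<le> d" "d \<le> 1" by simp_all
  \<comment> \<open>\<open>400 * 27/10000 = 1.08\<close> exceeds \<open>1\<close>, which is all that
    is asked of the constant.\<close>
  have "d * (400 * sqrt \<nu> * L) = 108/100 * L" using nu by (simp add: d_def)
  moreover have "d * (400 * sqrt \<nu> * L) \<le> d * real N" using N(2) d(1) by (rule mult_left_mono)
  ultimately have "ln (1 / \<epsilon>) \<le> d * real N" unfolding L_def[symmetric] using L by linarith
  then have decay: "(1 - d) ^ N \<le> \<epsilon>" by (rule power_decay[OF d \<epsilon>(1)])
  note bounds = pc_iterate_bounds[OF z0 nu \<alpha>, folded z_def d_def]
  have "mu_bar \<nu> (z 0) \<ge> 0"
    using corrector_step(4)[OF predictor_step(1)[OF conjunct1[OF bounds[of 0]] \<alpha>(1-3)]]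
      predictor_step(3)[OF conjunct1[OF bounds[of 0]] \<alpha>(1-3)] \<alpha>(2)
    by (simp add: zero_less_mult_iff)
  then have "(1 - d) ^ N * mu_bar \<nu> (z 0) \<le> \<epsilon> * mu_bar \<nu> (z 0)"
    using decay by (intro mult_right_mono)
  moreover have "(1 - d) ^ N * norm (residual m n A b c (z 0)) \<le> \<epsilon> * norm (residual m n A b c (z 0))"
    using decay by (intro mult_right_mono) auto
  ultimately show ?thesis using bounds[of N] N(1) by (intro exI[of _ N]) (auto simp: L_def)
qed

end

theorem theorem4p15:
  fixes \<eta> \<beta>l \<beta>u \<omega> \<alpha>c \<sigma> \<delta> :: real
  assumes "\<eta> = 0.02" and "\<beta>l = 0.9" and "\<beta>u = 0.905" and "\<omega> = 0.005"
    and "\<alpha>c = 0.85" and "\<sigma> = 0.9025" and "\<delta> = \<eta>\<^sup>2 + 2 * \<eta>"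
  shows "\<exists>C>0. \<forall>(m::nat) (n::nat) (K::rseq set) (\<nu>::real) (F::rseq \<Rightarrow> real)
      (A::nat \<Rightarrow> nat \<Rightarrow> real) (b::rseq) (c::rseq) (x0::rseq) (y0::rseq) (\<beta>0::real).
    n \<ge> 1 \<longrightarrow> proper_cone n K \<longrightarrow> LHSCB n K \<nu> F \<longrightarrow>
    full_row_rank m n A \<longrightarrow> b \<in> Rn m \<longrightarrow> c \<in> Rn n \<longrightarrow>
    x0 \<in> int_Rn n K \<longrightarrow> y0 \<in> Rn m \<longrightarrow> \<beta>0 \<in> {\<beta>l..\<beta>u} \<longrightarrow>
    (let \<gamma> = sqrt ((\<eta> + sqrt \<nu>)\<^sup>2 / (1 - \<delta>) + \<beta>u / 2);
         \<alpha>p = \<omega> * sqrt (1 - \<delta>) / \<gamma>;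
         z = pc_iterate m n (int_Rn n K) \<nu> F A b c \<alpha>p \<alpha>c \<sigma>
               (initial_point n (int_Rn n K) F x0 y0 \<beta>0)
     in \<forall>\<epsilon>\<in>{0<..<1}. \<exists>N::nat. int N \<le> \<lceil>C * sqrt \<nu> * ln (1 / \<epsilon>)\<rceil> \<and>
          mu_bar \<nu> (z N) \<le> \<epsilon> * mu_bar \<nu> (z 0) \<and>
          norm (residual m n A b c (z N)) \<le> \<epsilon> * norm (residual m n A b c (z 0)))"
proof (rule exI[of _ 400], intro conjI allI impI)
  show "(0::real) < 400" by simp
next
  fix m n :: nat and K :: "rseq set" and \<nu> :: real and F :: "rseq \<Rightarrow> real"
    and A :: "nat \<Rightarrow> nat \<Rightarrow> real" and b c x0 y0 :: rseq and \<beta>0 :: real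
  assume basic: "n \<ge> 1" "proper_cone n K" "LHSCB n K \<nu> F" "full_row_rank m n A" "b \<in> Rn m" "c \<in> Rn n"
    and x0: "x0 \<in> int_Rn n K" and y0: "y0 \<in> Rn m" and \<beta>0: "\<beta>0 \<in> {\<beta>l..\<beta>u}"
  interpret hsd_problem n K \<nu> F m A b c
    by unfold_locales (use basic in auto)
  \<comment> \<open>The decimal parameters are put into the fractional form of the numerical lemmas;
    \<open>1 - \<delta>\<close> is \<open>1 - 0.0004 - 0.04\<close>.\<close>
  have params: "\<eta> = 1/50" "1 - \<delta> = 9596/10000" "\<beta>u / 2 = 905/2000" "\<omega> = 5/1000" "\<alpha>c = 85/100"
    "\<sigma> = 9025/10000"
    unfolding assms(7) unfolding assms by (simp_all add: power2_eq_square)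
  have nu: "\<nu> \<ge> 1" by (rule nu_ge_1[OF x0])
  note step = step_length_bounds[OF nu refl refl]
  have nb: "nbhd (1/50) (9/10) (905/1000) (initial_point n (int_Rn n K) F x0 y0 \<beta>0)"
    by (rule initial_point_in_nbhd[OF x0 y0]) (use \<beta>0 assms in auto)
  show "let \<gamma> = sqrt ((\<eta> + sqrt \<nu>)\<^sup>2 / (1 - \<delta>) + \<beta>u / 2);
         \<alpha>p = \<omega> * sqrt (1 - \<delta>) / \<gamma>;
         z = pc_iterate m n (int_Rn n K) \<nu> F A b c \<alpha>p \<alpha>c \<sigma>
               (initial_point n (int_Rn n K) F x0 y0 \<beta>0)
     in \<forall>\<epsilon>\<in>{0<..<1}. \<exists>N::nat. int N \<le> \<lceil>400 * sqrt \<nu> * ln (1 / \<epsilon>)\<rceil> \<and>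
          mu_bar \<nu> (z N) \<le> \<epsilon> * mu_bar \<nu> (z 0) \<and>
          norm (residual m n A b c (z N)) \<le> \<epsilon> * norm (residual m n A b c (z 0))"
    unfolding params Let_def by (rule ballI, rule complexity[OF nb nu step]) simp_all
qed

end
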